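(* Let $\tau(\mathbf t_1,\mathbf t_2)\in\mathbb C[[\mathbf t_1,\mathbf t_2]]$ be an arbitrary tau-function of the 2-component BKP hierarchy with $\tau(0)\neq0$. Let $N_1,N_2\ge0$ be integers with $N_1+N_2$ even, $Z_a=\operatorname{diag}(z_{a,1},\dots,z_{a,N_a})$ for $a=1,2$, and let $\tau(Z_1,Z_2)$ be the result of the substitution $t_{a,m}=-\frac2m\operatorname{Tr}(Z_a^{-m})$ in $\tau$. Then $$\tau(Z_1,Z_2)=\tau(0)\,\frac{2^{(N_1+N_2)/2}\,\operatorname{Pf}(\tilde\Phi(Z_1,Z_2))}{\mathbf i^{N_1^2}\prod_{a=1,2}\prod_{1\le i<j\le N_a}\frac{z_{a,i}-z_{a,j}}{z_{a,i}+z_{a,j}}},$$ where $\tilde\Phi(Z_1,Z_2)=\begin{bmatrix}\tilde\Phi^{11}&\tilde\Phi^{12}\\ \tilde\Phi^{21}&\tilde\Phi^{22}\end{bmatrix}$ is the skew-symmetric matrix of size $N_1+N_2$ whose diagonal blocks $\tilde\Phi^{aa}$ are skew-symmetric with entries $\tilde\Phi^{aa}_{i,j}=\tilde\phi_{a,a}(z_{a,i},z_{a,j})$ for $1\le i<j\le N_a$, and $\tilde\Phi^{12}_{i,j}=\mathbf i\,\tilde\phi_{1,2}(z_{1,i},z_{2,j})$ for $1\le i\le N_1$, $1\le j\le N_2$, $\tilde\Phi^{21}=-(\tilde\Phi^{12})^T$.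
   Context: $\mathbb Z_{\rm odd}^+$ is the set of positive odd integers, $\mathbf t_a=(t_{a,m})_{m\in\mathbb Z_{\rm odd}^+}$ ($a=1,2$) are formal variables, $\mathbf t=(\mathbf t_1,\mathbf t_2)$, $\mathbf i=\sqrt{-1}$. The vertex operators are $$\Gamma_a(\mathbf t,z)=\exp\Big(\sum_{m\in\mathbb Z_{\rm odd}^+}t_{a,m}z^m\Big)\exp\Big(-\sum_{m\in\mathbb Z_{\rm odd}^+}2\,\partial_{t_{a,m}}\frac{z^{-m}}{m}\Big).$$ A formal power series $\tau$ is a tau-function of the 2-component BKP hierarchy if $$\operatorname{Res}_{z=0}\frac{dz}{z}\Big(\Gamma_1(\mathbf t,z)\otimes\Gamma_1(\mathbf t,-z)-\Gamma_2(\mathbf t,z)\otimes\Gamma_2(\mathbf t,-z)\Big)\tau\otimes\tau=0$$ (coefficient of $z^0$; the two tensor factors act on two independent copies of the variables). $\tau(\mathbf t_1-[z_1^{-1}],\mathbf t_2-[z_2^{-1}])$ denotes the result of $t_{a,m}\mapsto t_{a,m}-2z_a^{-m}/m$ in $\tau$; e.g. $\tau(-[z^{-1}]-[w^{-1}],0)$ is $\tau$ at $t_{1,m}=-2z^{-m}/m-2w^{-m}/m$, $t_{2,m}=0$. Put $$\tilde\phi_{1,1}(z,w)=\frac12\frac{z-w}{z+w}\frac{\tau(-[z^{-1}]-[w^{-1}],0)}{\tau(0)},\quad\tilde\phi_{1,2}(z,w)=\frac12\frac{\tau(-[z^{-1}],-[w^{-1}])}{\tau(0)},\quad\tilde\phi_{2,2}(z,w)=\frac12\frac{z-w}{z+w}\frac{\tau(0,-[z^{-1}]-[w^{-1}])}{\tau(0)}.$$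 The identity is one of formal power series in the $z_{a,i}^{-1}$ (with rational factors $\frac{z-w}{z+w}$ as indicated). *)

theory Defs
  imports
    "HOL-Library.Poly_Mapping"
    "HOL-Computational_Algebra.Fraction_Field"
    "HOL-Combinatorics.Permutations"
    "Jordan_Normal_Form.Matrix"
begin

section \<open>Formal power series in arbitrarily many variables\<close>

text \<open>
  A formal power series in variables indexed by \<open>'v\<close> is an arbitrary family of complex
  coefficients, one for every finitely supported exponent \<open>'v \<Rightarrow>\<^sub>0 nat\<close>.
\<close>

typedef 'v mfps = "UNIV :: (('v \<Rightarrow>\<^sub>0 nat) \<Rightarrow> complex) set"
  morphisms mfps_nth Abs_mfps
  by simp

setup_lifting type_definition_mfps

lemma mfps_eqI: "(\<And>\<alpha>. mfps_nth f \<alpha> = mfps_nth g \<alpha>) \<Longrightarrow> f = g"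
  by (metis mfps_nth_inject ext)

lemma mfps_nth_Abs_mfps [simp]: "mfps_nth (Abs_mfps c) = c"
  by (simp add: Abs_mfps_inverse)

lemma finite_bounded_exponents:
  fixes V :: "'v set"
  assumes "finite V"
  shows "finite {\<alpha> :: 'v \<Rightarrow>\<^sub>0 nat. Poly_Mapping.keys \<alpha> \<subseteq> V \<and> (\<forall>v\<in>V. Poly_Mapping.lookup \<alpha> v \<le> n)}"
proof (rule finite_imageD)
  have "Poly_Mapping.lookup ` {\<alpha> :: 'v \<Rightarrow>\<^sub>0 nat. Poly_Mapping.keys \<alpha> \<subseteq> V \<and> (\<forall>v\<in>V. Poly_Mapping.lookup \<alpha> v \<le> n)}
      \<subseteq> {f. \<forall>v. (v \<in> V \<longrightarrow> f v \<in> {..n}) \<and> (v \<notin> V \<longrightarrow> f v = 0)}"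
    by (auto simp: in_keys_iff)
  then show "finite (Poly_Mapping.lookup ` {\<alpha> :: 'v \<Rightarrow>\<^sub>0 nat. Poly_Mapping.keys \<alpha> \<subseteq> V \<and> (\<forall>v\<in>V. Poly_Mapping.lookup \<alpha> v \<le> n)})"
    by (rule finite_subset) (rule finite_set_of_finite_funs, simp_all add: assms)
  show "inj_on Poly_Mapping.lookup {\<alpha> :: 'v \<Rightarrow>\<^sub>0 nat. Poly_Mapping.keys \<alpha> \<subseteq> V \<and> (\<forall>v\<in>V. Poly_Mapping.lookup \<alpha> v \<le> n)}"
    by (auto intro!: inj_onI poly_mapping_eqI)
qed

lemma keys_plus_nat:
  "Poly_Mapping.keys ((\<alpha> :: 'v \<Rightarrow>\<^sub>0 nat) + \<beta>) = Poly_Mapping.keys \<alpha> \<union> Poly_Mapping.keys \<beta>"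
  by (auto simp: in_keys_iff lookup_add)

lemma finite_decompositions: "finite {(\<alpha>, \<beta>). \<alpha> + \<beta> = (\<gamma> :: 'v \<Rightarrow>\<^sub>0 nat)}"
proof -
  let ?V = "Poly_Mapping.keys \<gamma>" and ?n = "\<Sum>v\<in>Poly_Mapping.keys \<gamma>. Poly_Mapping.lookup \<gamma> v"
  let ?E = "{\<alpha> :: 'v \<Rightarrow>\<^sub>0 nat. Poly_Mapping.keys \<alpha> \<subseteq> ?V \<and> (\<forall>v\<in>?V. Poly_Mapping.lookup \<alpha> v \<le> ?n)}"
  have fE: "finite ?E" by (rule finite_bounded_exponents) simp
  have "{(\<alpha>, \<beta>). \<alpha> + \<beta> = \<gamma>} \<subseteq> ?E \<times> ?E"
  proof safe
    fix \<alpha> \<beta> :: "'v \<Rightarrow>\<^sub>0 nat" assume eq: "\<gamma> = \<alpha> + \<beta>"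
    fix v
    have le: "Poly_Mapping.lookup (\<alpha> + \<beta>) v \<le> (\<Sum>v\<in>Poly_Mapping.keys (\<alpha> + \<beta>). Poly_Mapping.lookup (\<alpha> + \<beta>) v)"
      if "v \<in> Poly_Mapping.keys (\<alpha> + \<beta>)"
      using that by (intro member_le_sum) auto
    show "Poly_Mapping.lookup \<alpha> v \<le> (\<Sum>v\<in>Poly_Mapping.keys (\<alpha> + \<beta>). Poly_Mapping.lookup (\<alpha> + \<beta>) v)"
      "Poly_Mapping.lookup \<beta> v \<le> (\<Sum>v\<in>Poly_Mapping.keys (\<alpha> + \<beta>). Poly_Mapping.lookup (\<alpha> + \<beta>) v)"
      if "v \<in> Poly_Mapping.keys (\<alpha> + \<beta>)"
      using le[OF that] by (simp_all add: lookup_add)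
  qed (auto simp: keys_plus_nat)
  then show ?thesis using fE by (meson finite_SigmaI finite_subset)
qed

instantiation mfps :: (type) comm_ring_1
begin

lift_definition zero_mfps :: "'v mfps" is "\<lambda>_. 0" .
lift_definition one_mfps :: "'v mfps" is "\<lambda>\<alpha>. if \<alpha> = 0 then 1 else 0" .
lift_definition plus_mfps :: "'v mfps \<Rightarrow> 'v mfps \<Rightarrow> 'v mfps" is "\<lambda>f g \<alpha>. f \<alpha> + g \<alpha>" .
lift_definition minus_mfps :: "'v mfps \<Rightarrow> 'v mfps \<Rightarrow> 'v mfps" is "\<lambda>f g \<alpha>. f \<alpha> - g \<alpha>" .
lift_definition uminus_mfps :: "'v mfps \<Rightarrow> 'v mfps" is "\<lambda>f \<alpha>. - f \<alpha>" .
lift_definition times_mfps :: "'v mfps \<Rightarrow> 'v mfps \<Rightarrow> 'v mfps"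
  is "\<lambda>f g \<gamma>. \<Sum>(\<alpha>, \<beta>) \<in> {(\<alpha>, \<beta>). \<alpha> + \<beta> = \<gamma>}. f \<alpha> * g \<beta>" .

instance
proof
  fix a b c :: "'v mfps"
  show "a * b = b * a"
  proof (transfer, rule ext)
    fix f g :: "('v \<Rightarrow>\<^sub>0 nat) \<Rightarrow> complex" and \<gamma> :: "'v \<Rightarrow>\<^sub>0 nat"
    show "(\<Sum>(\<alpha>, \<beta>) \<in> {(\<alpha>, \<beta>). \<alpha> + \<beta> = \<gamma>}. f \<alpha> * g \<beta>)
        = (\<Sum>(\<alpha>, \<beta>) \<in> {(\<alpha>, \<beta>). \<alpha> + \<beta> = \<gamma>}. g \<alpha> * f \<beta>)"
      by (rule sum.reindex_bij_witness[where i = prod.swap and j = prod.swap])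
        (auto simp: add.commute mult.commute)
  qed
  show "a * b * c = a * (b * c)"
  proof (transfer, rule ext)
    fix f g h :: "('v \<Rightarrow>\<^sub>0 nat) \<Rightarrow> complex" and \<gamma> :: "'v \<Rightarrow>\<^sub>0 nat"
    let ?D = "\<lambda>\<gamma> :: 'v \<Rightarrow>\<^sub>0 nat. {(\<alpha>, \<beta>). \<alpha> + \<beta> = \<gamma>}"
    have "(\<Sum>(\<delta>, \<epsilon>) \<in> ?D \<gamma>. (\<Sum>(\<alpha>, \<beta>) \<in> ?D \<delta>. f \<alpha> * g \<beta>) * h \<epsilon>)
        = (\<Sum>p \<in> ?D \<gamma>. \<Sum>q \<in> ?D (fst p). f (fst q) * g (snd q) * h (snd p))"
      by (simp add: case_prod_unfold sum_distrib_right)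
    also have "\<dots> = (\<Sum>(p, q) \<in> Sigma (?D \<gamma>) (\<lambda>p. ?D (fst p)). f (fst q) * g (snd q) * h (snd p))"
      by (rule sum.Sigma) (auto simp: finite_decompositions)
    also have "\<dots> = (\<Sum>(p, q) \<in> Sigma (?D \<gamma>) (\<lambda>p. ?D (snd p)). f (fst p) * (g (fst q) * h (snd q)))"
      by (rule sum.reindex_bij_witness[where
            i = "\<lambda>(p, q). ((fst p + fst q, snd q), (fst p, fst q))" and
            j = "\<lambda>(p, q). ((fst q, snd q + snd p), (snd q, snd p))"])
        (auto simp: add.assoc mult.assoc)
    also have "\<dots> = (\<Sum>p \<in> ?D \<gamma>. \<Sum>q \<in> ?D (snd p). f (fst p) * (g (fst q) * h (snd q)))"
      by (rule sum.Sigma[symmetric]) (auto simp: finite_decompositions)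
    also have "\<dots> = (\<Sum>(\<alpha>, \<delta>) \<in> ?D \<gamma>. f \<alpha> * (\<Sum>(\<beta>, \<epsilon>) \<in> ?D \<delta>. g \<beta> * h \<epsilon>))"
      by (simp add: case_prod_unfold sum_distrib_left)
    finally show "(\<Sum>(\<delta>, \<epsilon>) \<in> ?D \<gamma>. (\<Sum>(\<alpha>, \<beta>) \<in> ?D \<delta>. f \<alpha> * g \<beta>) * h \<epsilon>)
        = (\<Sum>(\<alpha>, \<delta>) \<in> ?D \<gamma>. f \<alpha> * (\<Sum>(\<beta>, \<epsilon>) \<in> ?D \<delta>. g \<beta> * h \<epsilon>))" .
  qed
  show "1 * a = a"
  proof (transfer, rule ext)
    fix f :: "('v \<Rightarrow>\<^sub>0 nat) \<Rightarrow> complex" and \<gamma> :: "'v \<Rightarrow>\<^sub>0 nat"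
    have "(\<Sum>(\<alpha>, \<beta>) \<in> {(\<alpha>, \<beta>). \<alpha> + \<beta> = \<gamma>}. (if \<alpha> = 0 then 1 else 0) * f \<beta>)
        = (\<Sum>(\<alpha>, \<beta>) \<in> {(0 :: 'v \<Rightarrow>\<^sub>0 nat, \<gamma>)}. (if \<alpha> = 0 then 1 else 0) * f \<beta>)"
      by (rule sum.mono_neutral_right) (auto simp: finite_decompositions split: if_splits)
    then show "(\<Sum>(\<alpha>, \<beta>) \<in> {(\<alpha>, \<beta>). \<alpha> + \<beta> = \<gamma>}. (if \<alpha> = 0 then 1 else 0) * f \<beta>) = f \<gamma>"
      by simp
  qed
  show "(a + b) * c = a * c + b * c"
    by transfer (simp add: case_prod_unfold sum.distrib distrib_right)
  show "a + b + c = a + (b + c)" by transfer (simp add: add.assoc)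
  show "a + b = b + a" by transfer (simp add: add.commute)
  show "0 + a = a" by transfer simp
  show "- a + a = 0" by transfer simp
  show "a - b = a + - b" by transfer simp
  show "(0 :: 'v mfps) \<noteq> 1"
  proof
    assume "(0 :: 'v mfps) = 1"
    then have "mfps_nth (0 :: 'v mfps) 0 = mfps_nth (1 :: 'v mfps) 0" by (rule arg_cong)
    then show False by (simp add: zero_mfps.rep_eq one_mfps.rep_eq)
  qed
qed

end

lemma mfps_nth_times:
  "mfps_nth (f * g) \<gamma> = (\<Sum>(\<alpha>, \<beta>) \<in> {(\<alpha>, \<beta>). \<alpha> + \<beta> = \<gamma>}. mfps_nth f \<alpha> * mfps_nth g \<beta>)"
  by (simp add: times_mfps.rep_eq)

instance mfps :: (type) idom
proof
  fix f g :: "'v mfps"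
  assume "f \<noteq> 0" "g \<noteq> 0"
  then obtain \<alpha>1 \<beta>1 where nz: "mfps_nth f \<alpha>1 \<noteq> 0" "mfps_nth g \<beta>1 \<noteq> 0"
    by (metis mfps_eqI zero_mfps.rep_eq)
  define V where "V = Poly_Mapping.keys \<alpha>1 \<union> Poly_Mapping.keys \<beta>1"
  have finV: "finite V" by (simp add: V_def)
  then obtain h :: "'v \<Rightarrow> nat" where h: "inj_on h V"
    using finite_imp_inj_to_nat_seg by metis
  define key where "key \<alpha> = (\<Sum>v\<in>V. Poly_Mapping.single (h v) (Poly_Mapping.lookup \<alpha> v))" for \<alpha> :: "'v \<Rightarrow>\<^sub>0 nat"
  define deg where "deg \<alpha> = (\<Sum>v\<in>V. Poly_Mapping.lookup \<alpha> v)" for \<alpha> :: "'v \<Rightarrow>\<^sub>0 nat"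
  have key_add: "key (\<alpha> + \<beta>) = key \<alpha> + key \<beta>" for \<alpha> \<beta>
    by (simp add: key_def lookup_add single_add sum.distrib)
  have deg_add: "deg (\<alpha> + \<beta>) = deg \<alpha> + deg \<beta>" for \<alpha> \<beta>
    by (simp add: deg_def lookup_add sum.distrib)
  have key_inj: "\<alpha> = \<beta>"
    if "Poly_Mapping.keys \<alpha> \<subseteq> V" "Poly_Mapping.keys \<beta> \<subseteq> V" "key \<alpha> = key \<beta>" for \<alpha> \<beta>
  proof (rule poly_mapping_eqI)
    have nth: "Poly_Mapping.lookup (key \<gamma>) (h v) = Poly_Mapping.lookup \<gamma> v" if "v \<in> V" for \<gamma> v
    proof -
      have "Poly_Mapping.lookup (key \<gamma>) (h v) = (\<Sum>w\<in>V. if w = v then Poly_Mapping.lookup \<gamma> w else 0)"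
        unfolding key_def lookup_sum
        by (rule sum.cong) (use h that in \<open>auto simp: lookup_single when_def inj_on_def\<close>)
      also have "\<dots> = Poly_Mapping.lookup \<gamma> v" using finV that by simp
      finally show ?thesis .
    qed
    fix v
    show "Poly_Mapping.lookup \<alpha> v = Poly_Mapping.lookup \<beta> v"
      using that nth by (cases "v \<in> V") (metis, metis in_keys_iff subsetD)
  qed
  have lead: "\<exists>\<alpha>0. Poly_Mapping.keys \<alpha>0 \<subseteq> V \<and> mfps_nth u \<alpha>0 \<noteq> 0 \<and>
      (\<forall>\<alpha>. Poly_Mapping.keys \<alpha> \<subseteq> V \<and> mfps_nth u \<alpha> \<noteq> 0 \<longrightarrow>
        deg \<alpha>0 \<le> deg \<alpha> \<and> (deg \<alpha> = deg \<alpha>0 \<longrightarrow> key \<alpha>0 \<le> key \<alpha>))"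
    if "Poly_Mapping.keys \<gamma> \<subseteq> V" "mfps_nth u \<gamma> \<noteq> 0" for u :: "'v mfps" and \<gamma>
  proof -
    define S where "S = {\<alpha>. Poly_Mapping.keys \<alpha> \<subseteq> V \<and> mfps_nth u \<alpha> \<noteq> 0}"
    define d where "d = (LEAST d. d \<in> deg ` S)"
    have "deg \<gamma> \<in> deg ` S" using that by (auto simp: S_def)
    then have d: "d \<in> deg ` S" unfolding d_def by (rule LeastI)
    have dmin: "d \<le> deg \<alpha>" if "\<alpha> \<in> S" for \<alpha>
      unfolding d_def by (rule Least_le) (use that in auto)
    define T where "T = {\<alpha>\<in>S. deg \<alpha> = d}"
    have "T \<subseteq> {\<alpha>. Poly_Mapping.keys \<alpha> \<subseteq> V \<and> (\<forall>v\<in>V. Poly_Mapping.lookup \<alpha> v \<le> d)}"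
      unfolding T_def S_def deg_def using finV by (auto intro: member_le_sum)
    then have finT: "finite T"
      using finite_bounded_exponents[OF finV] finite_subset by blast
    have neT: "T \<noteq> {}" using d by (auto simp: T_def)
    have "Min (key ` T) \<in> key ` T" using finT neT by (intro Min_in) auto
    then obtain \<alpha>0 where "\<alpha>0 \<in> T" "Min (key ` T) = key \<alpha>0" by auto
    moreover have "\<forall>\<alpha>\<in>T. Min (key ` T) \<le> key \<alpha>" using finT by simp
    ultimately have "\<alpha>0 \<in> T" "\<forall>\<alpha>\<in>T. key \<alpha>0 \<le> key \<alpha>" by simp_all
    then show ?thesis using dmin by (intro exI[of _ \<alpha>0]) (auto simp: T_def S_def)
  qed
  obtain \<alpha>0 where a: "Poly_Mapping.keys \<alpha>0 \<subseteq> V" "mfps_nth f \<alpha>0 \<noteq> 0"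
    and amin: "\<And>\<alpha>. Poly_Mapping.keys \<alpha> \<subseteq> V \<Longrightarrow> mfps_nth f \<alpha> \<noteq> 0 \<Longrightarrow>
        deg \<alpha>0 \<le> deg \<alpha> \<and> (deg \<alpha> = deg \<alpha>0 \<longrightarrow> key \<alpha>0 \<le> key \<alpha>)"
    using lead[of \<alpha>1 f] nz by (auto simp: V_def)
  obtain \<beta>0 where b: "Poly_Mapping.keys \<beta>0 \<subseteq> V" "mfps_nth g \<beta>0 \<noteq> 0"
    and bmin: "\<And>\<beta>. Poly_Mapping.keys \<beta> \<subseteq> V \<Longrightarrow> mfps_nth g \<beta> \<noteq> 0 \<Longrightarrow>
        deg \<beta>0 \<le> deg \<beta> \<and> (deg \<beta> = deg \<beta>0 \<longrightarrow> key \<beta>0 \<le> key \<beta>)"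
    using lead[of \<beta>1 g] nz by (auto simp: V_def)
  have only: "\<alpha> = \<alpha>0 \<and> \<beta> = \<beta>0"
    if eq: "\<alpha> + \<beta> = \<alpha>0 + \<beta>0" and nz': "mfps_nth f \<alpha> \<noteq> 0" "mfps_nth g \<beta> \<noteq> 0" for \<alpha> \<beta>
  proof -
    have sub: "Poly_Mapping.keys \<alpha> \<subseteq> V" "Poly_Mapping.keys \<beta> \<subseteq> V"
      using arg_cong[OF eq, of Poly_Mapping.keys] a(1) b(1) by (auto simp: keys_plus_nat)
    note A = amin[OF sub(1) nz'(1)] and B = bmin[OF sub(2) nz'(2)]
    have "deg \<alpha> + deg \<beta> = deg \<alpha>0 + deg \<beta>0" using eq by (metis deg_add)
    then have "deg \<alpha> = deg \<alpha>0" "deg \<beta> = deg \<beta>0" using A B by linarith+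
    then have le: "key \<alpha>0 \<le> key \<alpha>" "key \<beta>0 \<le> key \<beta>" using A B by blast+
    have keq: "key \<alpha> + key \<beta> = key \<alpha>0 + key \<beta>0" using eq by (metis key_add)
    have "key \<alpha> = key \<alpha>0"
    proof (rule ccontr)
      assume "key \<alpha> \<noteq> key \<alpha>0"
      then have "key \<alpha>0 < key \<alpha>" using le by simp
      then have "key \<alpha>0 + key \<beta>0 < key \<alpha> + key \<beta>" using le by (intro add_less_le_mono)
      then show False using keq by simp
    qed
    then have "\<alpha> = \<alpha>0" using key_inj sub a by blast
    then show ?thesis using eq by simp
  qed
  have "mfps_nth (f * g) (\<alpha>0 + \<beta>0) = (\<Sum>(\<alpha>, \<beta>) \<in> {(\<alpha>0, \<beta>0)}. mfps_nth f \<alpha> * mfps_nth g \<beta>)"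
    unfolding mfps_nth_times
    by (rule sum.mono_neutral_right) (use only finite_decompositions in auto)
  then have "mfps_nth (f * g) (\<alpha>0 + \<beta>0) \<noteq> 0" using a b by simp
  then show "f * g \<noteq> 0" by (metis zero_mfps.rep_eq)
qed

definition mfps_const :: "complex \<Rightarrow> 'v mfps" where
  "mfps_const c = Abs_mfps (\<lambda>\<alpha>. if \<alpha> = 0 then c else 0)"

definition mfps_var :: "'v \<Rightarrow> 'v mfps" where
  "mfps_var v = Abs_mfps (\<lambda>\<alpha>. if \<alpha> = Poly_Mapping.single v 1 then 1 else 0)"

definition mfps_deriv :: "'v \<Rightarrow> 'v mfps \<Rightarrow> 'v mfps" where
  "mfps_deriv v f =
    Abs_mfps (\<lambda>\<alpha>. of_nat (Poly_Mapping.lookup \<alpha> v + 1) * mfps_nth f (\<alpha> + Poly_Mapping.single v 1))"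

text \<open>
  The sum of a locally finite family of formal power series, i.e. of a family in which every
  monomial has a nonzero coefficient in only finitely many members (for a monomial where this
  fails, \<open>Sum_any\<close> gives 0).  All families to which it is applied below are locally finite,
  because of the grading in which \<open>t\<^bsub>a,m\<^esub>\<close> has weight \<open>m\<close>.
\<close>

definition mfps_sum :: "('i \<Rightarrow> 'v mfps) \<Rightarrow> 'v mfps" where
  "mfps_sum f = Abs_mfps (\<lambda>\<alpha>. Sum_any (\<lambda>i. mfps_nth (f i) \<alpha>))"

definition mfps_subst :: "('v \<Rightarrow> 'w mfps) \<Rightarrow> 'v mfps \<Rightarrow> 'w mfps" where
  "mfps_subst s f =
    mfps_sum (\<lambda>\<alpha>. mfps_const (mfps_nth f \<alpha>) * (\<Prod>v\<in>Poly_Mapping.keys \<alpha>. s v ^ Poly_Mapping.lookup \<alpha> v))"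


section \<open>The 2-component BKP hierarchy\<close>

datatype comp = Comp1 | Comp2

text \<open>
  The pair \<open>(a, k)\<close> stands for the variable \<open>t\<^bsub>a,m\<^esub>\<close> with \<open>m = 2 * k + 1\<close>, so that \<open>k\<close> runs
  through all natural numbers when \<open>m\<close> runs through the positive odd integers.
\<close>

type_synonym tvar = "comp \<times> nat"

text \<open>
  A doubly infinite formal series in \<open>z\<close> with coefficients in \<open>\<complex>[[t]]\<close>; the value at \<open>n\<close> is the
  coefficient of \<open>z\<^sup>n\<close>.
\<close>

type_synonym zseries = "int \<Rightarrow> tvar mfps"

definition z_const :: "tvar mfps \<Rightarrow> zseries" where
  "z_const f = (\<lambda>n. if n = 0 then f else 0)"

definition z_neg :: "zseries \<Rightarrow> zseries" where
  "z_neg F = (\<lambda>n. mfps_const ((-1) powi n) * F n)"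

text \<open>The operators \<open>\<Sum>\<^sub>m t\<^bsub>a,m\<^esub> z\<^sup>m\<close> and \<open>- \<Sum>\<^sub>m 2 \<partial>\<^bsub>a,m\<^esub> z\<^bsup>-m\<^esup> / m\<close>.\<close>

definition op_times :: "comp \<Rightarrow> zseries \<Rightarrow> zseries" where
  "op_times a F = (\<lambda>n. mfps_sum (\<lambda>k. mfps_var (a, k) * F (n - int (2 * k + 1))))"

definition op_deriv :: "comp \<Rightarrow> zseries \<Rightarrow> zseries" where
  "op_deriv a F = (\<lambda>n. mfps_sum (\<lambda>k.
     mfps_const (- 2 / of_nat (2 * k + 1)) * mfps_deriv (a, k) (F (n + int (2 * k + 1)))))"

definition op_exp :: "(zseries \<Rightarrow> zseries) \<Rightarrow> zseries \<Rightarrow> zseries" where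
  "op_exp A F = (\<lambda>n. mfps_sum (\<lambda>j. mfps_const (1 / fact j) * (A ^^ j) F n))"

definition vertex_op :: "comp \<Rightarrow> tvar mfps \<Rightarrow> zseries" where
  "vertex_op a f = op_exp (op_times a) (op_exp (op_deriv a) (z_const f))"

text \<open>
  The coefficient of \<open>z\<^sup>0\<close> in \<open>F(z) \<otimes> G(z)\<close>, as a formal power series in two independent copies of
  the variables: the value at \<open>\<alpha>\<close>, \<open>\<beta>\<close> is the coefficient of \<open>t'\<^sup>\<alpha> t''\<^sup>\<beta>\<close>.
\<close>

definition res_tensor ::
    "zseries \<Rightarrow> zseries \<Rightarrow> (tvar \<Rightarrow>\<^sub>0 nat) \<Rightarrow> (tvar \<Rightarrow>\<^sub>0 nat) \<Rightarrow> complex" where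
  "res_tensor F G \<alpha> \<beta> = Sum_any (\<lambda>n. mfps_nth (F n) \<alpha> * mfps_nth (G (- n)) \<beta>)"

definition tau_function_2BKP :: "tvar mfps \<Rightarrow> bool" where
  "tau_function_2BKP \<tau> \<longleftrightarrow>
    (\<forall>\<alpha> \<beta>. res_tensor (vertex_op Comp1 \<tau>) (z_neg (vertex_op Comp1 \<tau>)) \<alpha> \<beta>
         - res_tensor (vertex_op Comp2 \<tau>) (z_neg (vertex_op Comp2 \<tau>)) \<alpha> \<beta> = 0)"


section \<open>The variables \<open>z\<^bsub>a,i\<^esub>\<close> and the Pfaffian\<close>

text \<open>
  The pair \<open>(a, i)\<close> stands for \<open>z\<^bsub>a,i+1\<^esub>\<close>.  The ring of power series \<open>zvar mfps\<close> has the
  \<open>z\<^bsub>a,i\<^esub>\<^bsup>-1\<^esup>\<close> as its variables, and identities with rational factors are stated in its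
  field of fractions \<open>zvar mfps fract\<close>, in which the variable \<open>mfps_var (a, i)\<close> is invertible.
\<close>

type_synonym zvar = "comp \<times> nat"

definition to_frac :: "zvar mfps \<Rightarrow> zvar mfps fract" where
  "to_frac f = Fraction_Field.Fract f 1"

definition scalar :: "complex \<Rightarrow> zvar mfps fract" where
  "scalar c = to_frac (mfps_const c)"

definition z_of :: "zvar \<Rightarrow> zvar mfps fract" where
  "z_of u = inverse (to_frac (mfps_var u))"

text \<open>
  \<open>miwa \<tau> us vs\<close> is \<open>\<tau>(- \<Sum>\<^sub>u [z\<^sub>u\<^bsup>-1\<^esup>], - \<Sum>\<^sub>v [z\<^sub>v\<^bsup>-1\<^esup>])\<close>, the sums running over
  the entries of the lists \<open>us\<close> and \<open>vs\<close>.
\<close>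

definition miwa :: "tvar mfps \<Rightarrow> zvar list \<Rightarrow> zvar list \<Rightarrow> zvar mfps" where
  "miwa \<tau> us vs = mfps_subst
    (\<lambda>(a, k). mfps_const (- 2 / of_nat (2 * k + 1)) *
       (\<Sum>u\<leftarrow>(case a of Comp1 \<Rightarrow> us | Comp2 \<Rightarrow> vs). mfps_var u ^ (2 * k + 1))) \<tau>"

definition tau_Z :: "tvar mfps \<Rightarrow> nat \<Rightarrow> nat \<Rightarrow> zvar mfps" where
  "tau_Z \<tau> N1 N2 = miwa \<tau> (map (Pair Comp1) [0..<N1]) (map (Pair Comp2) [0..<N2])"

definition tau_0 :: "tvar mfps \<Rightarrow> complex" where
  "tau_0 \<tau> = mfps_nth \<tau> 0"

definition phi11 :: "tvar mfps \<Rightarrow> zvar \<Rightarrow> zvar \<Rightarrow> zvar mfps fract" where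
  "phi11 \<tau> u v = 1 / 2 * ((z_of u - z_of v) / (z_of u + z_of v)) *
     (to_frac (miwa \<tau> [u, v] []) / scalar (tau_0 \<tau>))"

definition phi12 :: "tvar mfps \<Rightarrow> zvar \<Rightarrow> zvar \<Rightarrow> zvar mfps fract" where
  "phi12 \<tau> u v = 1 / 2 * (to_frac (miwa \<tau> [u] [v]) / scalar (tau_0 \<tau>))"

definition phi22 :: "tvar mfps \<Rightarrow> zvar \<Rightarrow> zvar \<Rightarrow> zvar mfps fract" where
  "phi22 \<tau> u v = 1 / 2 * ((z_of u - z_of v) / (z_of u + z_of v)) *
     (to_frac (miwa \<tau> [] [u, v]) / scalar (tau_0 \<tau>))"

definition skew_mat :: "nat \<Rightarrow> (nat \<Rightarrow> nat \<Rightarrow> 'a :: ab_group_add) \<Rightarrow> 'a mat" where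
  "skew_mat n f = mat n n (\<lambda>(i, j). if i < j then f i j else if j < i then - f j i else 0)"

definition Phi_mat :: "tvar mfps \<Rightarrow> nat \<Rightarrow> nat \<Rightarrow> zvar mfps fract mat" where
  "Phi_mat \<tau> N1 N2 =
    (let
       P11 = skew_mat N1 (\<lambda>i j. phi11 \<tau> (Comp1, i) (Comp1, j));
       P22 = skew_mat N2 (\<lambda>i j. phi22 \<tau> (Comp2, i) (Comp2, j));
       P12 = mat N1 N2 (\<lambda>(i, j). scalar \<i> * phi12 \<tau> (Comp1, i) (Comp2, j))
     in four_block_mat P11 P12 (- transpose_mat P12) P22)"

text \<open>
  The Pfaffian of a skew-symmetric matrix of even size, with rows and columns numbered from 0.
\<close>

definition pfaffian :: "'a :: field mat \<Rightarrow> 'a" where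
  "pfaffian A = (let n = dim_row A div 2 in
     (\<Sum>p | p permutes {0..<2 * n}. of_int (sign p) * (\<Prod>i<n. A $$ (p (2 * i), p (2 * i + 1))))
       / (2 ^ n * of_nat (fact n)))"

definition z_ratio_prod :: "comp \<Rightarrow> nat \<Rightarrow> zvar mfps fract" where
  "z_ratio_prod a n =
    (\<Prod>(i, j) \<in> {(i, j). i < j \<and> j < n}.
       (z_of (a, i) - z_of (a, j)) / (z_of (a, i) + z_of (a, j)))"

end

(*
  Contract the bilinear identity at t' = - sum over w # w0 of [1/z_w] and t'' = - [1/z_w0].  The
  exponential factors become the rational function prod_w (1 - xi_w y) / (1 + xi_w y) of the
  spectral parameter y, where xi_w = 1/z_w and xi_w0 = - 1/z_w0.  Its partial fraction expansion
  evaluates the residues: the pole of w in the factor shifts [1/z_w] from t' to t'', and the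
  residues at infinity cancel because N1 + N2 is even.  The outcome is a Fay identity expressing
  tau(A) tau(0) through the products tau(A - {w0, w}) tau({w0, w}).  After normalisation by the
  product of all (z_i - z_j) / (z_i + z_j) and suitable powers of i it says that the normalised
  tau(Z1, Z2), an alternating function of the points, satisfies the expansion of a Pfaffian along
  its first row.

  Convergence is dealt with by the grading in which t_{a,m} has weight m: the term of weight d is
  a finite sum, so that one can evaluate in an arbitrary field of characteristic 0, here the field
  of fractions of the ring of power series in the 1/z_{a,i}.
*)
theory Submission
  imports Defs "HOL-Computational_Algebra.Computational_Algebra"
begin

text \<open>Three points shape the argument. (1) The coefficient of z^n in a vertex operator raises
  the weight by n, so a residue at fixed target weights mixes parts of tau of many source weights.
  The Taylor shifts only appear for fixed source weights. Hence the identity is summed over all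
  splittings of a total weight d, which both factors together preserve. (2) Only odd powers occur,
  so [-y] = -[y]. This is why the point w0, which sits on the other side of the identity, enters as
  one more factor of the same shape with xi_w0 = -1/z_w0, and why its pole moves w0 in the opposite
  direction to all other poles. (3) The two components enter the bilinear identity with opposite
  signs, so half of the residues have the wrong sign for a Pfaffian expansion. A sign for each mixed
  pair of points and one factor \<i> for each set with an odd number of points in the first
  component repair this; that factor becomes the \<open>\<i>\<close> of the off-diagonal
  block.\<close>

no_notation vec_index (infixl "$" 100)

section \<open>Weights and monomials\<close>

abbreviation var_wt :: "tvar \<Rightarrow> nat" where
  "var_wt v \<equiv> 2 * snd v + 1"

definition wt :: "(tvar \<Rightarrow>\<^sub>0 nat) \<Rightarrow> nat" where
  "wt \<alpha> = (\<Sum>v\<in>Poly_Mapping.keys \<alpha>. Poly_Mapping.lookup \<alpha> v * var_wt v)"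

definition mono_val :: "('v \<Rightarrow> 'r) \<Rightarrow> ('v \<Rightarrow>\<^sub>0 nat) \<Rightarrow> 'r :: comm_monoid_mult" where
  "mono_val s \<alpha> = (\<Prod>v\<in>Poly_Mapping.keys \<alpha>. s v ^ Poly_Mapping.lookup \<alpha> v)"

lemma wt_superset:
  assumes "finite V" "Poly_Mapping.keys \<alpha> \<subseteq> V"
  shows "wt \<alpha> = (\<Sum>v\<in>V. Poly_Mapping.lookup \<alpha> v * var_wt v)"
  unfolding wt_def by (rule sum.mono_neutral_left) (use assms in \<open>auto simp: in_keys_iff\<close>)

lemma mono_val_superset:
  assumes "finite V" "Poly_Mapping.keys \<alpha> \<subseteq> V"
  shows "mono_val s \<alpha> = (\<Prod>v\<in>V. s v ^ Poly_Mapping.lookup \<alpha> v)"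
  unfolding mono_val_def by (rule prod.mono_neutral_left) (use assms in \<open>auto simp: in_keys_iff\<close>)

lemma wt_add: "wt (\<alpha> + \<beta>) = wt \<alpha> + wt \<beta>"
  using wt_superset[of "Poly_Mapping.keys \<alpha> \<union> Poly_Mapping.keys \<beta>"]
  by (simp add: keys_plus_nat lookup_add sum.distrib algebra_simps)

lemma mono_val_add: "mono_val s (\<alpha> + \<beta>) = mono_val s \<alpha> * mono_val s \<beta>"
  using mono_val_superset[of "Poly_Mapping.keys \<alpha> \<union> Poly_Mapping.keys \<beta>" _ s]
  by (simp add: keys_plus_nat lookup_add power_add prod.distrib)

lemma wt_single [simp]: "wt (Poly_Mapping.single v n) = n * var_wt v"
  by (simp add: wt_def)

lemma mono_val_single [simp]: "mono_val s (Poly_Mapping.single v n) = s v ^ n"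
  by (simp add: mono_val_def)

lemma UNIV_comp: "(UNIV :: comp set) = {Comp1, Comp2}"
  using comp.exhaust by auto

lemma finite_var_wt: "finite {v. var_wt v \<le> d}"
proof (rule finite_subset)
  show "{v. var_wt v \<le> d} \<subseteq> UNIV \<times> {..d}" by auto
qed (simp add: UNIV_comp)

text \<open>Every variable has weight at least 1 and there are two components, so weight
  \<open>d\<close> bounds the exponents as well as the indices of the variables that occur.\<close>

lemma finite_wt [simp]: "finite {\<alpha>. wt \<alpha> = d}"
proof (rule finite_subset)
  let ?V = "(UNIV :: comp set) \<times> {..d}"
  show "{\<alpha>. wt \<alpha> = d} \<subseteq> {\<alpha>. Poly_Mapping.keys \<alpha> \<subseteq> ?V \<and> (\<forall>v\<in>?V. Poly_Mapping.lookup \<alpha> v \<le> d)}"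
  proof (rule subsetI, intro CollectI conjI ballI)
    fix \<alpha> assume \<alpha>: "\<alpha> \<in> {\<alpha>. wt \<alpha> = d}"
    have *: "Poly_Mapping.lookup \<alpha> v * var_wt v \<le> d" if "v \<in> Poly_Mapping.keys \<alpha>" for v
      using \<alpha> member_le_sum[OF that, of "\<lambda>v. Poly_Mapping.lookup \<alpha> v * var_wt v"]
      by (auto simp: wt_def)
    show "Poly_Mapping.lookup \<alpha> v \<le> d" for v
      using *[of v] by (cases "v \<in> Poly_Mapping.keys \<alpha>") (auto simp: in_keys_iff)
    have "snd v \<le> d" if "v \<in> Poly_Mapping.keys \<alpha>" for v
    proof -
      have "1 * (2 * snd v + 1) \<le> Poly_Mapping.lookup \<alpha> v * var_wt v"
        using that by (intro mult_le_mono) (auto simp: in_keys_iff Suc_le_eq)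
      then have "1 * (2 * snd v + 1) \<le> d" using *[OF that] by (rule order_trans)
      then show ?thesis by simp
    qed
    then show "Poly_Mapping.keys \<alpha> \<subseteq> ?V" by (auto simp: mem_Times_iff)
  qed
  show "finite {\<alpha> :: tvar \<Rightarrow>\<^sub>0 nat. Poly_Mapping.keys \<alpha> \<subseteq> ?V \<and> (\<forall>v\<in>?V. Poly_Mapping.lookup \<alpha> v \<le> d)}"
    by (intro finite_bounded_exponents) (simp add: UNIV_comp)
qed

lemma keys_single_add:
  assumes "v \<in> Poly_Mapping.keys (\<alpha> :: 'v \<Rightarrow>\<^sub>0 nat)"
  shows "Poly_Mapping.single v 1 + (\<alpha> - Poly_Mapping.single v 1) = \<alpha>"
  using assms by (intro poly_mapping_eqI) (auto simp: lookup_add lookup_minus lookup_single when_def in_keys_iff)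

lemma wt_minus_single:
  assumes "v \<in> Poly_Mapping.keys \<alpha>"
  shows "wt \<alpha> = wt (\<alpha> - Poly_Mapping.single v 1) + var_wt v"
  using wt_add[of "Poly_Mapping.single v 1" "\<alpha> - Poly_Mapping.single v 1"] keys_single_add[OF assms]
  by simp

text \<open>Multiplication by a variable as a reindexing of monomials; it serves both for products
  with a variable and for partial derivatives.\<close>

lemma bij_betw_add_single:
  assumes "var_wt v \<le> d"
  shows "bij_betw (\<lambda>\<beta>. Poly_Mapping.single v 1 + \<beta>) {\<beta>. wt \<beta> = d - var_wt v}
    {\<alpha>. wt \<alpha> = d \<and> v \<in> Poly_Mapping.keys \<alpha>}"
proof (rule bij_betwI[where g = "\<lambda>\<alpha>. \<alpha> - Poly_Mapping.single v 1"])
  show "(\<lambda>\<beta>. Poly_Mapping.single v 1 + \<beta>) \<in> {\<beta>. wt \<beta> = d - var_wt v} \<rightarrow> {\<alpha>. wt \<alpha> = d \<and> v \<in> Poly_Mapping.keys \<alpha>}"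
    using assms by (auto simp: wt_add keys_plus_nat)
  show "(\<lambda>\<alpha>. \<alpha> - Poly_Mapping.single v 1) \<in> {\<alpha>. wt \<alpha> = d \<and> v \<in> Poly_Mapping.keys \<alpha>} \<rightarrow> {\<beta>. wt \<beta> = d - var_wt v}"
    using wt_minus_single by fastforce
qed (auto simp: keys_single_add[simplified])

section \<open>Coefficients of formal power series\<close>

lemma mfps_nth_0 [simp]: "mfps_nth 0 \<alpha> = 0"
  by (simp add: zero_mfps.rep_eq)

lemma mfps_nth_add [simp]: "mfps_nth (f + g) \<alpha> = mfps_nth f \<alpha> + mfps_nth g \<alpha>"
  by (simp add: plus_mfps.rep_eq)

lemma mfps_nth_sum [simp]: "mfps_nth (sum f A) \<alpha> = (\<Sum>i\<in>A. mfps_nth (f i) \<alpha>)"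
  by (induction A rule: infinite_finite_induct) auto

lemma mfps_nth_const_mult [simp]:
  fixes f :: "'v mfps"
  shows "mfps_nth (mfps_const c * f) \<gamma> = c * mfps_nth f \<gamma>"
proof -
  have "mfps_nth (mfps_const c * f) \<gamma> = (\<Sum>(\<alpha>, \<beta>) \<in> {(0 :: 'v \<Rightarrow>\<^sub>0 nat, \<gamma>)}. mfps_nth (mfps_const c) \<alpha> * mfps_nth f \<beta>)"
    unfolding mfps_nth_times
    by (rule sum.mono_neutral_right) (auto simp: finite_decompositions mfps_const_def split: if_splits)
  then show ?thesis by (simp add: mfps_const_def)
qed

lemma mfps_nth_var_mult:
  "mfps_nth (mfps_var v * f) \<gamma> =
    (if v \<in> Poly_Mapping.keys \<gamma> then mfps_nth f (\<gamma> - Poly_Mapping.single v 1) else 0)"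
proof (cases "v \<in> Poly_Mapping.keys \<gamma>")
  case True
  have "mfps_nth (mfps_var v * f) \<gamma> = (\<Sum>(\<alpha>, \<beta>) \<in> {(Poly_Mapping.single v 1, \<gamma> - Poly_Mapping.single v 1)}.
      mfps_nth (mfps_var v) \<alpha> * mfps_nth f \<beta>)"
    unfolding mfps_nth_times
    by (rule sum.mono_neutral_right)
      (use keys_single_add[OF True] in \<open>auto simp: finite_decompositions mfps_var_def split: if_splits\<close>)
  then show ?thesis using True by (simp add: mfps_var_def)
next
  case False
  have "mfps_nth (mfps_var v * f) \<gamma> = 0"
    unfolding mfps_nth_times
    by (rule sum.neutral) (use False in \<open>auto simp: mfps_var_def keys_plus_nat\<close>)
  then show ?thesis using False by simp
qed

text \<open>\<open>Sum_any\<close> is 0 on an infinite support, so each use of a formal infinite sum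
  has to exhibit a finite set that contains the support.\<close>

lemma mfps_nth_mfps_sum:
  assumes "finite A" "\<And>i. i \<notin> A \<Longrightarrow> mfps_nth (f i) \<alpha> = 0"
  shows "mfps_nth (mfps_sum f) \<alpha> = (\<Sum>i\<in>A. mfps_nth (f i) \<alpha>)"
  unfolding mfps_sum_def mfps_nth_Abs_mfps
  by (rule Sum_any.expand_superset) (use assms in auto)

lemma mfps_nth_deriv [simp]: "mfps_nth (mfps_deriv v f) \<alpha> =
    of_nat (Poly_Mapping.lookup \<alpha> v + 1) * mfps_nth f (\<alpha> + Poly_Mapping.single v 1)"
  by (simp add: mfps_deriv_def)

section \<open>Graded evaluation\<close>

text \<open>\<open>ev \<iota> s d f\<close> is the coefficient of \<open>h\<^sup>d\<close> in the value of \<open>f\<close> at \<open>t\<^bsub>a,m\<^esub> = s\<^bsub>a,m\<^esub> h\<^sup>m\<close>.\<close>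

definition ev :: "(complex \<Rightarrow> 'r) \<Rightarrow> (tvar \<Rightarrow> 'r) \<Rightarrow> nat \<Rightarrow> tvar mfps \<Rightarrow> 'r :: comm_ring_1" where
  "ev \<iota> s d f = (\<Sum>\<alpha> | wt \<alpha> = d. \<iota> (mfps_nth f \<alpha>) * mono_val s \<alpha>)"

text \<open>This allows a formal infinite sum to be replaced by a finite truncation that agrees with
  it in weight \<open>d\<close>.\<close>

lemma ev_cong:
  assumes "\<And>\<alpha>. wt \<alpha> = d \<Longrightarrow> mfps_nth f \<alpha> = mfps_nth g \<alpha>"
  shows "ev \<iota> s d f = ev \<iota> s d g"
  unfolding ev_def by (rule sum.cong) (use assms in auto)


locale complex_hom = comm_ring_hom \<iota> for \<iota> :: "complex \<Rightarrow> 'r :: comm_ring_1"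
begin

lemma ev_0 [simp]: "ev \<iota> s d 0 = 0"
  by (simp add: ev_def)

lemma ev_sum: "ev \<iota> s d (sum f A) = (\<Sum>i\<in>A. ev \<iota> s d (f i))"
  unfolding ev_def mfps_nth_sum hom_sum sum_distrib_right by (rule sum.swap)

lemma ev_const_mult: "ev \<iota> s d (mfps_const c * f) = \<iota> c * ev \<iota> s d f"
  by (simp add: ev_def hom_mult sum_distrib_left mult.assoc)

lemma ev_var_mult:
  "ev \<iota> s d (mfps_var v * f) = (if var_wt v \<le> d then s v * ev \<iota> s (d - var_wt v) f else 0)"
proof -
  have *: "ev \<iota> s d (mfps_var v * f) = (\<Sum>\<alpha> | wt \<alpha> = d \<and> v \<in> Poly_Mapping.keys \<alpha>.
      \<iota> (mfps_nth f (\<alpha> - Poly_Mapping.single v 1)) * mono_val s \<alpha>)"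
    unfolding ev_def by (rule sum.mono_neutral_cong_right) (auto simp: mfps_nth_var_mult)
  show ?thesis
  proof (cases "var_wt v \<le> d")
    case True
    show ?thesis
      unfolding * sum.reindex_bij_betw[OF bij_betw_add_single[OF True], symmetric]
      using True by (simp add: ev_def mono_val_add sum_distrib_left algebra_simps)
  next
    case False
    have empty: "{\<alpha>. wt \<alpha> = d \<and> v \<in> Poly_Mapping.keys \<alpha>} = {}"
      using False wt_minus_single by fastforce
    then show ?thesis using False unfolding * empty by simp
  qed
qed

end

section \<open>The multiplication part of the vertex operators\<close>

text \<open>The exponent of the multiplication part of the vertex operator, evaluated at
  \<open>s\<close>, as a power series in z.\<close>

definition odd_series :: "comp \<Rightarrow> (tvar \<Rightarrow> 'r) \<Rightarrow> 'r :: comm_ring_1 fps" where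
  "odd_series a s = Abs_fps (\<lambda>m. if odd m then s (a, m div 2) else 0)"

lemma mfps_nth_op_times:
  "mfps_nth (op_times a F n) \<alpha> =
    (\<Sum>k | (a, k) \<in> Poly_Mapping.keys \<alpha>. mfps_nth (F (n - int (2 * k + 1))) (\<alpha> - Poly_Mapping.single (a, k) 1))"
proof -
  have "finite (snd ` Poly_Mapping.keys \<alpha>)" by simp
  then have fin: "finite {k. (a, k) \<in> Poly_Mapping.keys \<alpha>}" by (rule rev_finite_subset) force
  have "mfps_nth (op_times a F n) \<alpha> =
      (\<Sum>k | (a, k) \<in> Poly_Mapping.keys \<alpha>. mfps_nth (mfps_var (a, k) * F (n - int (2 * k + 1))) \<alpha>)"
    unfolding op_times_def by (rule mfps_nth_mfps_sum[OF fin]) (simp add: mfps_nth_var_mult)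
  then show ?thesis by (simp add: mfps_nth_var_mult)
qed

text \<open>Each factor t_{a,m} uses up weight at least 1, so the exponential series is finite at
  every monomial.\<close>

lemma mfps_nth_op_times_power_eq_0:
  "wt \<alpha> < j \<Longrightarrow> mfps_nth ((op_times a ^^ j) F n) \<alpha> = 0"
proof (induction j arbitrary: \<alpha> n)
  case (Suc j)
  have "wt (\<alpha> - Poly_Mapping.single (a, k) 1) < j" if "(a, k) \<in> Poly_Mapping.keys \<alpha>" for k
    using wt_minus_single[OF that] Suc.prems by simp
  then show ?case using Suc.IH by (simp add: mfps_nth_op_times)
qed simp

text \<open>Multiplication by t_{a,m} z^m raises the weight and the power of z by the same amount,
  so a positive power z^n has to be paid for with weight n.\<close>

lemma mfps_nth_op_times_power_eq_0':
  assumes "\<And>n. n > 0 \<Longrightarrow> F n = 0"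
  shows "n > int (wt \<alpha>) \<Longrightarrow> mfps_nth ((op_times a ^^ j) F n) \<alpha> = 0"
proof (induction j arbitrary: \<alpha> n)
  case (Suc j)
  have "n - int (2 * k + 1) > int (wt (\<alpha> - Poly_Mapping.single (a, k) 1))" if "(a, k) \<in> Poly_Mapping.keys \<alpha>" for k
    using wt_minus_single[OF that] Suc.prems by simp
  then show ?case using Suc.IH by (simp add: mfps_nth_op_times)
qed (use assms in auto)

lemma mfps_nth_op_exp_op_times:
  assumes "wt \<alpha> \<le> N"
  shows "mfps_nth (op_exp (op_times a) F n) \<alpha> =
    (\<Sum>j\<le>N. 1 / fact j * mfps_nth ((op_times a ^^ j) F n) \<alpha>)"
proof -
  have "mfps_nth (op_exp (op_times a) F n) \<alpha> =
      (\<Sum>j\<le>N. mfps_nth (mfps_const (1 / fact j) * (op_times a ^^ j) F n) \<alpha>)"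
    unfolding op_exp_def
    by (rule mfps_nth_mfps_sum) (use assms in \<open>auto simp: mfps_nth_op_times_power_eq_0\<close>)
  then show ?thesis by simp
qed

lemma mfps_nth_op_exp_op_times_eq_0:
  assumes "\<And>n. n > 0 \<Longrightarrow> F n = 0" and "n > int (wt \<alpha>)"
  shows "mfps_nth (op_exp (op_times a) F n) \<alpha> = 0"
  by (simp add: mfps_nth_op_exp_op_times[OF order_refl] mfps_nth_op_times_power_eq_0'[OF assms])

lemma sum_triangle:
  fixes g :: "nat \<Rightarrow> nat \<Rightarrow> 'a :: comm_monoid_add"
  shows "(\<Sum>m\<le>p. \<Sum>m'\<le>p - m. g m m') = (\<Sum>k\<le>p. \<Sum>m\<le>k. g m (k - m))"
proof -
  have "(\<Sum>m\<le>p. \<Sum>m'\<le>p - m. g m m') = (\<Sum>(m, m') \<in> (SIGMA m:{..p}. {..p - m}). g m m')"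
    by (rule sum.Sigma) auto
  also have "(SIGMA m:{..p}. {..p - m}) = {(m, m'). m + m' \<le> p}" by auto
  finally show ?thesis by (simp add: sum.triangle_reindex_eq)
qed

context complex_hom
begin

text \<open>Weight and power of z move together, so one index \<open>m\<close> records both, and
  evaluation turns the operator into a convolution with \<open>odd_series a s\<close>.\<close>

lemma ev_op_times:
  "ev \<iota> s p (op_times a F n) = (\<Sum>m\<le>p. odd_series a s $ m * ev \<iota> s (p - m) (F (n - int m)))"
proof -
  have "ev \<iota> s p (op_times a F n) =
      ev \<iota> s p (\<Sum>k | 2 * k + 1 \<le> p. mfps_var (a, k) * F (n - int (2 * k + 1)))"
  proof (rule ev_cong)
    fix \<alpha> assume \<alpha>: "wt \<alpha> = p"
    have fin: "finite {k. 2 * k + 1 \<le> p}" by (rule finite_subset[of _ "{..p}"]) auto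
    show "mfps_nth (op_times a F n) \<alpha> =
        mfps_nth (\<Sum>k | 2 * k + 1 \<le> p. mfps_var (a, k) * F (n - int (2 * k + 1))) \<alpha>"
      unfolding op_times_def mfps_nth_sum
      by (rule mfps_nth_mfps_sum[OF fin])
        (use \<alpha> wt_minus_single[of "(a, _)" \<alpha>] in \<open>auto simp: mfps_nth_var_mult\<close>)
  qed
  also have "\<dots> = (\<Sum>k | 2 * k + 1 \<le> p. s (a, k) * ev \<iota> s (p - (2 * k + 1)) (F (n - int (2 * k + 1))))"
    unfolding ev_sum by (rule sum.cong) (auto simp: ev_var_mult)
  also have "\<dots> = (\<Sum>m | m \<le> p \<and> odd m. s (a, m div 2) * ev \<iota> s (p - m) (F (n - int m)))"
    by (rule sum.reindex_bij_witness[where i = "\<lambda>m. m div 2" and j = "\<lambda>k. 2 * k + 1"]) auto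
  also have "\<dots> = (\<Sum>m\<le>p. odd_series a s $ m * ev \<iota> s (p - m) (F (n - int m)))"
    by (rule sum.mono_neutral_cong_left) (auto simp: odd_series_def)
  finally show ?thesis .
qed

lemma ev_op_times_power:
  "ev \<iota> s p ((op_times a ^^ j) F n) = (\<Sum>m\<le>p. (odd_series a s ^ j) $ m * ev \<iota> s (p - m) (F (n - int m)))"
proof (induction j arbitrary: p n)
  case 0
  have "(\<Sum>m\<le>p. (1 :: 'r fps) $ m * ev \<iota> s (p - m) (F (n - int m))) =
      (\<Sum>m\<in>{0}. (1 :: 'r fps) $ m * ev \<iota> s (p - m) (F (n - int m)))"
    by (rule sum.mono_neutral_right) auto
  then show ?case by simp
next
  case (Suc j)
  let ?L = "odd_series a s"
  have "ev \<iota> s p ((op_times a ^^ Suc j) F n) =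
      (\<Sum>m\<le>p. \<Sum>m'\<le>p - m. ?L $ m * ((?L ^ j) $ m' * ev \<iota> s (p - m - m') (F (n - int m - int m'))))"
    by (simp add: ev_op_times Suc.IH sum_distrib_left)
  also have "\<dots> = (\<Sum>k\<le>p. \<Sum>m\<le>k. ?L $ m * ((?L ^ j) $ (k - m) * ev \<iota> s (p - m - (k - m)) (F (n - int m - int (k - m)))))"
    by (rule sum_triangle)
  also have "\<dots> = (\<Sum>k\<le>p. (?L ^ Suc j) $ k * ev \<iota> s (p - k) (F (n - int k)))"
    unfolding power_Suc fps_mult_nth atLeast0AtMost sum_distrib_right
    by (intro sum.cong refl) (auto simp: of_nat_diff mult.assoc)
  finally show ?case .
qed

end

locale complex_hom_field = complex_hom \<iota> for \<iota> :: "complex \<Rightarrow> 'r :: field_char_0"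
begin

lemma hom_inverse_fact: "\<iota> (1 / fact j) = 1 / fact j"
proof -
  have "\<iota> (1 / fact j) * of_nat (fact j) = \<iota> (1 / fact j * of_nat (fact j))"
    unfolding hom_mult hom_of_nat ..
  also have "\<dots> = 1" by simp
  finally show ?thesis by (simp add: field_simps)
qed

lemma ev_op_exp_op_times:
  "ev \<iota> s p (op_exp (op_times a) F n) =
    (\<Sum>m\<le>p. (fps_exp 1 oo odd_series a s) $ m * ev \<iota> s (p - m) (F (n - int m)))"
proof -
  let ?L = "odd_series a s"
  have L0: "(?L ^ j) $ m = 0" if "m < j" for j m
    using that by (intro startsby_zero_power_prefix[rule_format]) (auto simp: odd_series_def)
  have "ev \<iota> s p (op_exp (op_times a) F n) =
      ev \<iota> s p (\<Sum>j\<le>p. mfps_const (1 / fact j) * (op_times a ^^ j) F n)"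
    by (rule ev_cong) (simp add: mfps_nth_op_exp_op_times[OF eq_refl])
  also have "\<dots> = (\<Sum>j\<le>p. \<Sum>m\<le>p. 1 / fact j * (?L ^ j) $ m * ev \<iota> s (p - m) (F (n - int m)))"
    by (simp add: ev_sum ev_const_mult ev_op_times_power sum_distrib_left mult.assoc hom_inverse_fact)
  also have "\<dots> = (\<Sum>m\<le>p. (\<Sum>j\<le>p. 1 / fact j * (?L ^ j) $ m) * ev \<iota> s (p - m) (F (n - int m)))"
    unfolding sum_distrib_right by (rule sum.swap)
  also have "\<dots> = (\<Sum>m\<le>p. (fps_exp 1 oo ?L) $ m * ev \<iota> s (p - m) (F (n - int m)))"
  proof (rule sum.cong[OF refl])
    fix m assume "m \<in> {..p}"
    then have "(\<Sum>j\<le>p. 1 / fact j * (?L ^ j) $ m) = (\<Sum>j\<le>m. 1 / fact j * (?L ^ j) $ m)"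
      by (intro sum.mono_neutral_right) (auto simp: L0)
    also have "\<dots> = (fps_exp 1 oo ?L) $ m"
      by (simp add: fps_compose_nth atLeast0AtMost fps_exp_def)
    finally show "(\<Sum>j\<le>p. 1 / fact j * (?L ^ j) $ m) * ev \<iota> s (p - m) (F (n - int m)) =
        (fps_exp 1 oo ?L) $ m * ev \<iota> s (p - m) (F (n - int m))" by simp
  qed
  finally show ?thesis .
qed

end

section \<open>The differentiation part of the vertex operators\<close>

lemma op_deriv_finite:
  assumes "\<And>n. n > 0 \<Longrightarrow> F n = 0"
  shows "op_deriv a F (- int l) = (\<Sum>k | 2 * k + 1 \<le> l.
    mfps_const (- 2 / of_nat (2 * k + 1)) * mfps_deriv (a, k) (F (- int (l - (2 * k + 1)))))"
proof (rule mfps_eqI)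
  fix \<alpha>
  have fin: "finite {k. 2 * k + 1 \<le> l}" by (rule finite_subset[of _ "{..l}"]) auto
  have "mfps_nth (op_deriv a F (- int l)) \<alpha> = (\<Sum>k | 2 * k + 1 \<le> l. mfps_nth
      (mfps_const (- 2 / of_nat (2 * k + 1)) * mfps_deriv (a, k) (F (- int l + int (2 * k + 1)))) \<alpha>)"
    unfolding op_deriv_def by (rule mfps_nth_mfps_sum[OF fin]) (use assms in auto)
  also have "\<dots> = (\<Sum>k | 2 * k + 1 \<le> l. mfps_nth
      (mfps_const (- 2 / of_nat (2 * k + 1)) * mfps_deriv (a, k) (F (- int (l - (2 * k + 1))))) \<alpha>)"
    by (rule sum.cong) (auto simp: of_nat_diff)
  finally show "mfps_nth (op_deriv a F (- int l)) \<alpha> = mfps_nth (\<Sum>k | 2 * k + 1 \<le> l.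
    mfps_const (- 2 / of_nat (2 * k + 1)) * mfps_deriv (a, k) (F (- int (l - (2 * k + 1))))) \<alpha>"
    by simp
qed

text \<open>Each application lowers the power of z by at least 1, so only finitely many powers of
  the operator reach a given power of z.\<close>

lemma op_deriv_power_eq_0:
  assumes "n > - int j"
  shows "(op_deriv a ^^ j) (z_const f) n = 0"
  using assms
proof (induction j arbitrary: n)
  case (Suc j)
  show ?case
    by (rule mfps_eqI) (use Suc in \<open>simp add: op_deriv_def mfps_nth_mfps_sum[of "{}"]\<close>)
qed (simp add: z_const_def)

lemma op_exp_op_deriv_finite:
  assumes "l \<le> N"
  shows "op_exp (op_deriv a) (z_const f) (- int l) =
    (\<Sum>j\<le>N. mfps_const (1 / fact j) * (op_deriv a ^^ j) (z_const f) (- int l))"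
  unfolding op_exp_def
  by (rule mfps_eqI, subst mfps_nth_mfps_sum[of "{..N}"]) (use assms in \<open>auto simp: op_deriv_power_eq_0\<close>)

lemma pderiv_sum': "pderiv (sum f A) = (\<Sum>x\<in>A. pderiv (f x))"
  for f :: "'i \<Rightarrow> 'r :: idom poly"
  using higher_pderiv_sum[of 1 f A] by simp

lemma smult_sum2: "Polynomial.smult c (sum f A) = (\<Sum>x\<in>A. Polynomial.smult c (f x))" for c :: "'r :: comm_ring_1"
  by (induction A rule: infinite_finite_induct) (auto simp: smult_add_right)

context complex_hom
begin

text \<open>This is the Miwa shift -[y] in component \<open>a\<close>, that is, -[1/z] at z =
  1/y.\<close>

definition shift :: "comp \<Rightarrow> 'r \<Rightarrow> tvar \<Rightarrow> 'r" where
  "shift a y v = (if fst v = a then \<iota> (- 2 / of_nat (var_wt v)) * y ^ var_wt v else 0)"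

end

locale complex_hom_shift = complex_hom_field \<iota> for \<iota> :: "complex \<Rightarrow> 'r :: field_char_0" +
  fixes s :: "tvar \<Rightarrow> 'r" and a :: comp and y :: 'r
begin

text \<open>Taylor's formula is obtained by differentiating along the segment from \<open>s\<close> to \<open>s + shift a y\<close>.\<close>

definition segment :: "tvar \<Rightarrow> 'r poly" where
  "segment v = [:s v, shift a y v:]"

definition ev_seg :: "nat \<Rightarrow> tvar mfps \<Rightarrow> 'r poly" where
  "ev_seg = ev (\<lambda>c. [:\<iota> c:]) segment"

text \<open>Along the segment the values are polynomials in the parameter; the evaluation lemmas
  apply to them with the constants embedded as constant polynomials.\<close>

sublocale poly: complex_hom "\<lambda>c. [:\<iota> c:]"
  by unfold_locales (auto simp: hom_add hom_mult one_pCons)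

lemma poly_ev_seg: "poly (ev_seg d f) e = ev \<iota> (\<lambda>v. s v + e * shift a y v) d f"
  unfolding ev_seg_def ev_def mono_val_def
  by (simp add: poly_sum poly_prod segment_def)

lemma pderiv_mono_val:
  "pderiv (mono_val segment \<alpha>) = (\<Sum>v\<in>Poly_Mapping.keys \<alpha>.
     Polynomial.smult (of_nat (Poly_Mapping.lookup \<alpha> v) * shift a y v) (mono_val segment (\<alpha> - Poly_Mapping.single v 1)))"
  unfolding mono_val_def[of _ \<alpha>] pderiv_prod
proof (rule sum.cong[OF refl])
  fix v assume v: "v \<in> Poly_Mapping.keys \<alpha>"
  let ?K = "Poly_Mapping.keys \<alpha>" and ?l = "Poly_Mapping.lookup \<alpha>"
  have "mono_val segment (\<alpha> - Poly_Mapping.single v 1) =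
      (\<Prod>w\<in>?K. segment w ^ Poly_Mapping.lookup (\<alpha> - Poly_Mapping.single v 1) w)"
    by (rule mono_val_superset) (auto simp: in_keys_iff lookup_minus)
  also have "\<dots> = segment v ^ (?l v - 1) * (\<Prod>w\<in>?K - {v}. segment w ^ ?l w)"
    by (subst prod.remove[OF _ v]) (auto simp: lookup_minus lookup_single when_def intro!: prod.cong)
  finally have *: "mono_val segment (\<alpha> - Poly_Mapping.single v 1) =
      segment v ^ (?l v - 1) * (\<Prod>w\<in>?K - {v}. segment w ^ ?l w)" .
  obtain n where n: "?l v = Suc n" using v by (cases "?l v") (auto simp: in_keys_iff)
  have "pderiv (segment v ^ ?l v) = Polynomial.smult (of_nat (?l v) * shift a y v) (segment v ^ (?l v - 1))"
    unfolding n pderiv_power_Suc by (simp add: segment_def pderiv_pCons mult.commute)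
  then show "(\<Prod>w\<in>?K - {v}. segment w ^ ?l w) * pderiv (segment v ^ ?l v) =
      Polynomial.smult (of_nat (?l v) * shift a y v) (mono_val segment (\<alpha> - Poly_Mapping.single v 1))"
    unfolding * by (simp add: mult.commute)
qed

text \<open>The chain rule. Only variables of component \<open>a\<close> move along the segment, and
  each derivative lowers the weight by that of its variable.\<close>

lemma pderiv_ev_seg:
  "pderiv (ev_seg d f) = (\<Sum>k | 2 * k + 1 \<le> d.
     Polynomial.smult (shift a y (a, k)) (ev_seg (d - (2 * k + 1)) (mfps_deriv (a, k) f)))"
proof -
  define g where "g v \<alpha> = Polynomial.smult (\<iota> (mfps_nth f \<alpha>) * (of_nat (Poly_Mapping.lookup \<alpha> v) * shift a y v))
      (mono_val segment (\<alpha> - Poly_Mapping.single v 1))" for v \<alpha>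
  let ?V = "{v :: tvar. var_wt v \<le> d}"
  have "pderiv (ev_seg d f) = (\<Sum>\<alpha> | wt \<alpha> = d. \<Sum>v\<in>Poly_Mapping.keys \<alpha>. g v \<alpha>)"
    by (simp add: ev_seg_def ev_def pderiv_sum' pderiv_smult pderiv_mono_val g_def smult_sum2)
  also have "\<dots> = (\<Sum>\<alpha> | wt \<alpha> = d. \<Sum>v\<in>?V. g v \<alpha>)"
  proof (intro sum.cong[OF refl] sum.mono_neutral_left)
    fix \<alpha> assume "\<alpha> \<in> {\<alpha>. wt \<alpha> = d}"
    then show "Poly_Mapping.keys \<alpha> \<subseteq> ?V" using wt_minus_single by fastforce
  qed (use finite_var_wt in \<open>auto simp: g_def in_keys_iff\<close>)
  also have "\<dots> = (\<Sum>v\<in>?V. \<Sum>\<alpha> | wt \<alpha> = d. g v \<alpha>)" by (rule sum.swap)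
  also have "\<dots> = (\<Sum>v\<in>?V. Polynomial.smult (shift a y v) (ev_seg (d - var_wt v) (mfps_deriv v f)))"
  proof (rule sum.cong[OF refl])
    fix v assume "v \<in> ?V"
    then have v: "var_wt v \<le> d" by simp
    have "(\<Sum>\<alpha> | wt \<alpha> = d. g v \<alpha>) = (\<Sum>\<alpha> | wt \<alpha> = d \<and> v \<in> Poly_Mapping.keys \<alpha>. g v \<alpha>)"
      by (rule sum.mono_neutral_right) (auto simp: g_def in_keys_iff)
    also have "\<dots> = (\<Sum>\<beta> | wt \<beta> = d - var_wt v. g v (Poly_Mapping.single v 1 + \<beta>))"
      by (rule sum.reindex_bij_betw[OF bij_betw_add_single[OF v], symmetric])
    also have "\<dots> = Polynomial.smult (shift a y v) (ev_seg (d - var_wt v) (mfps_deriv v f))"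
      unfolding ev_seg_def ev_def smult_sum2
      by (rule sum.cong) (auto simp: g_def lookup_add hom_mult hom_of_nat hom_add algebra_simps)
    finally show "(\<Sum>\<alpha> | wt \<alpha> = d. g v \<alpha>) = Polynomial.smult (shift a y v) (ev_seg (d - var_wt v) (mfps_deriv v f))" .
  qed
  also have "\<dots> = (\<Sum>v | var_wt v \<le> d \<and> fst v = a. Polynomial.smult (shift a y v) (ev_seg (d - var_wt v) (mfps_deriv v f)))"
    by (rule sum.mono_neutral_right) (use finite_var_wt in \<open>auto simp: shift_def\<close>)
  also have "\<dots> = (\<Sum>k | 2 * k + 1 \<le> d. Polynomial.smult (shift a y (a, k)) (ev_seg (d - (2 * k + 1)) (mfps_deriv (a, k) f)))"
    by (rule sum.reindex_bij_witness[where i = "Pair a" and j = snd]) auto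
  finally show ?thesis .
qed

text \<open>The value of \<open>F\<close> at z = 1/y along the segment, in total weight
  \<open>N\<close> when y has weight 1. Only nonpositive powers of z are read.\<close>

definition ev_zseries :: "nat \<Rightarrow> zseries \<Rightarrow> 'r poly" where
  "ev_zseries N F = (\<Sum>l\<le>N. Polynomial.smult (y ^ l) (ev_seg (N - l) (F (- int l))))"

text \<open>The velocity of the segment in the direction t_{a,m} is -2 y^m / m, which is the
  coefficient of the m-th derivative in \<open>op_deriv\<close> at z = 1/y.\<close>

lemma pderiv_ev_zseries:
  assumes "\<And>n. n > 0 \<Longrightarrow> F n = 0"
  shows "pderiv (ev_zseries N F) = ev_zseries N (op_deriv a F)"
proof -
  define g where "g l k = Polynomial.smult (y ^ l * \<iota> (- 2 / of_nat (2 * k + 1)))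
      (ev_seg (N - l) (mfps_deriv (a, k) (F (- int (l - (2 * k + 1))))))" for l k
  have fin: "finite {k. 2 * k + 1 \<le> n}" for n :: nat by (rule finite_subset[of _ "{..n}"]) auto
  have "pderiv (ev_zseries N F) = (\<Sum>l\<le>N. \<Sum>k | 2 * k + 1 \<le> N - l. g (l + (2 * k + 1)) k)"
    unfolding ev_zseries_def pderiv_sum' pderiv_smult pderiv_ev_seg smult_sum2
    by (intro sum.cong refl) (simp add: shift_def g_def power_add algebra_simps)
  also have "\<dots> = (\<Sum>(l, k) \<in> (SIGMA l:{..N}. {k. 2 * k + 1 \<le> N - l}). g (l + (2 * k + 1)) k)"
    by (rule sum.Sigma) (use fin in auto)
  also have "\<dots> = (\<Sum>(l, k) \<in> (SIGMA l:{..N}. {k. 2 * k + 1 \<le> l}). g l k)"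
    by (rule sum.reindex_bij_witness[where i = "\<lambda>(l, k). (l - (2 * k + 1), k)" and
          j = "\<lambda>(l, k). (l + (2 * k + 1), k)"]) auto
  also have "\<dots> = (\<Sum>l\<le>N. \<Sum>k | 2 * k + 1 \<le> l. g l k)"
    by (rule sum.Sigma[symmetric]) (use fin in auto)
  also have "\<dots> = ev_zseries N (op_deriv a F)"
    unfolding ev_zseries_def
  proof (rule sum.cong[OF refl])
    fix l
    have "op_deriv a F (- int l) = (\<Sum>k | 2 * k + 1 \<le> l.
        mfps_const (- 2 / of_nat (2 * k + 1)) * mfps_deriv (a, k) (F (- int (l - (2 * k + 1)))))"
      by (rule op_deriv_finite) (rule assms)
    then show "(\<Sum>k | 2 * k + 1 \<le> l. g l k) =
        Polynomial.smult (y ^ l) (ev_seg (N - l) (op_deriv a F (- int l)))"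
      by (simp only: g_def ev_seg_def poly.ev_sum poly.ev_const_mult smult_sum2
          mult_pCons_left mult_zero_left smult_smult pCons_0_0 add_0_right)
  qed
  finally show ?thesis .
qed

text \<open>The Taylor expansion at parameter 0, summed at parameter 1: the j-th derivative of the
  polynomial \<open>ev_seg N f\<close> comes from the j-th power of \<open>op_deriv\<close>, and its
  coefficients vanish beyond \<open>N\<close>.\<close>

lemma ev_op_exp_op_deriv:
  "(\<Sum>l\<le>N. y ^ l * ev \<iota> s (N - l) (op_exp (op_deriv a) (z_const f) (- int l))) =
    ev \<iota> (\<lambda>v. s v + shift a y v) N f"
proof -
  let ?P = "ev_seg N f"
  have eq: "(pderiv ^^ j) ?P = ev_zseries N ((op_deriv a ^^ j) (z_const f))" for j
  proof (induction j)
    case 0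
    have "ev_zseries N (z_const f) = (\<Sum>l\<in>{0}. Polynomial.smult (y ^ l) (ev_seg (N - l) (z_const f (- int l))))"
      unfolding ev_zseries_def
      by (rule sum.mono_neutral_right) (auto simp: z_const_def ev_seg_def poly.ev_0)
    then show ?case by (simp add: z_const_def)
  next
    case (Suc j)
    then show ?case by (simp add: pderiv_ev_zseries op_deriv_power_eq_0)
  qed
  have "fact j * coeff ?P j = poly ((pderiv ^^ j) ?P) 0" for j
    by (simp add: poly_0_coeff_0 coeff_higher_pderiv pochhammer_fact)
  also have "\<dots> j = (\<Sum>l\<le>N. y ^ l * ev \<iota> s (N - l) ((op_deriv a ^^ j) (z_const f) (- int l)))" for j
    by (simp add: eq ev_zseries_def poly_sum poly_ev_seg)
  finally have c: "coeff ?P j = (\<Sum>l\<le>N. y ^ l * ev \<iota> s (N - l) ((op_deriv a ^^ j) (z_const f) (- int l))) / fact j" for j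
    by (simp add: field_simps)
  have c0: "coeff ?P j = 0" if "j > N" for j
    using that by (simp add: c op_deriv_power_eq_0)
  have "ev \<iota> (\<lambda>v. s v + shift a y v) N f = poly ?P 1"
    by (simp add: poly_ev_seg)
  also have "\<dots> = (\<Sum>j\<le>N. coeff ?P j)"
    unfolding poly_altdef
    using c0 by (intro sum.mono_neutral_cong) (auto simp: coeff_eq_0 not_le)
  also have "\<dots> = (\<Sum>j\<le>N. \<Sum>l\<le>N. y ^ l * (\<iota> (1 / fact j) * ev \<iota> s (N - l) ((op_deriv a ^^ j) (z_const f) (- int l))))"
    by (simp add: c sum_divide_distrib hom_inverse_fact algebra_simps)
  also have "\<dots> = (\<Sum>l\<le>N. \<Sum>j\<le>N. y ^ l * (\<iota> (1 / fact j) * ev \<iota> s (N - l) ((op_deriv a ^^ j) (z_const f) (- int l))))"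
    by (rule sum.swap)
  also have "\<dots> = (\<Sum>l\<le>N. y ^ l * ev \<iota> s (N - l) (op_exp (op_deriv a) (z_const f) (- int l)))"
    by (intro sum.cong refl) (simp add: op_exp_op_deriv_finite ev_sum ev_const_mult sum_distrib_left)
  finally show ?thesis ..
qed

end

section \<open>Exponentials of odd power series\<close>

text \<open>The quotient of two solutions of f' = f g has derivative 0. Identities between
  exponentials thus reduce to logarithmic derivatives.\<close>

lemma fps_ode_unique:
  fixes f h g :: "'r :: field_char_0 fps"
  assumes "fps_deriv f = f * g" "fps_deriv h = h * g" "f $ 0 = h $ 0" "h $ 0 \<noteq> 0"
  shows "f = h"
proof -
  have inv: "h * inverse h = 1" using inverse_mult_eq_1[OF assms(4)] by (simp add: mult.commute)
  have "fps_deriv (f * inverse h) = f * g * inverse h - f * inverse h * g * (h * inverse h)"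
    by (simp add: fps_inverse_deriv[OF assms(4)] assms(1,2) power2_eq_square algebra_simps)
  also have "\<dots> = 0" by (simp add: inv algebra_simps)
  finally have "f * inverse h = fps_const ((f * inverse h) $ 0)" by (rule fps_deriv_eq_0_iff[THEN iffD1])
  also have "(f * inverse h) $ 0 = 1" using assms(3,4) by simp
  finally have "f * inverse h = 1" by simp
  then have "h * (f * inverse h) = h" by simp
  then have "f * (h * inverse h) = h" by (simp only: mult_ac)
  then show ?thesis by (simp add: inv)
qed

abbreviation exp_comp :: "'r :: field_char_0 fps \<Rightarrow> 'r fps" where
  "exp_comp L \<equiv> fps_exp 1 oo L"

lemma fps_deriv_exp_comp:
  assumes "L $ 0 = 0"
  shows "fps_deriv (exp_comp L) = exp_comp L * fps_deriv L"
  by (simp add: fps_compose_deriv[OF assms])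

lemma exp_comp_add:
  assumes "L1 $ 0 = 0" "L2 $ 0 = 0"
  shows "exp_comp (L1 + L2) = exp_comp L1 * exp_comp L2"
proof (rule fps_ode_unique)
  show "fps_deriv (exp_comp (L1 + L2)) = exp_comp (L1 + L2) * (fps_deriv L1 + fps_deriv L2)"
    using assms by (subst fps_deriv_exp_comp) auto
  show "fps_deriv (exp_comp L1 * exp_comp L2) = exp_comp L1 * exp_comp L2 * (fps_deriv L1 + fps_deriv L2)"
    using assms by (simp add: fps_deriv_exp_comp algebra_simps)
qed simp_all

text \<open>The substitution of -z for z negates an odd exponent. This accounts for the argument -z
  of the second vertex operator.\<close>

lemma exp_comp_odd:
  assumes "\<And>m. even m \<Longrightarrow> L $ m = 0"
  shows "Abs_fps (\<lambda>k. (-1) ^ k * exp_comp L $ k) = exp_comp (- L)"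
proof -
  have "Abs_fps (\<lambda>n. (-1) ^ n * L $ n) $ m = (- L) $ m" for m
    by (cases "even m") (simp_all add: assms)
  then have L: "L oo (- fps_X) = - L"
    unfolding fps_compose_uminus' by (rule fps_ext)
  have "L $ 0 = 0" using assms by simp
  have "Abs_fps (\<lambda>k. (-1) ^ k * exp_comp L $ k) = exp_comp L oo (- fps_X)"
    by (rule fps_compose_uminus'[symmetric])
  also have "\<dots> = exp_comp (L oo (- fps_X))"
    using \<open>L $ 0 = 0\<close> by (intro fps_compose_assoc[symmetric]) auto
  finally show ?thesis by (simp only: L)
qed

text \<open>The expansion of 1 / (1 + x y) in y.\<close>

definition geo :: "'r :: comm_ring_1 \<Rightarrow> 'r fps" where
  "geo x = Abs_fps (\<lambda>n. (- x) ^ n)"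

lemma geo_mult: "fps_of_poly [:1, x:] * geo x = 1"
proof (rule fps_ext)
  fix n show "(fps_of_poly [:1, x:] * geo x) $ n = 1 $ n"
    by (cases n) (simp_all add: fps_of_poly_pCons geo_def algebra_simps)
qed

text \<open>The logarithmic derivative of (1 - x y) / (1 + x y) is -2 x / (1 - x^2 y^2), a geometric
  series in even powers of y.\<close>

lemma fps_deriv_ratio:
  fixes x :: "'r :: field_char_0"
  shows "fps_deriv (fps_of_poly [:1, - x:] * geo x) =
    fps_of_poly [:1, - x:] * geo x * Abs_fps (\<lambda>n. if even n then - 2 * x ^ Suc n else 0)"
    (is "fps_deriv (?p * _) = _ * ?g")
proof -
  let ?q = "fps_of_poly [:1, x:]"
  have g: "?p * ?q * ?g = fps_const (- 2 * x)"
  proof (rule fps_ext)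
    have "?p * ?q = fps_of_poly [:1, 0, - (x * x):]"
      by (simp flip: fps_of_poly_mult add: power2_eq_square)
    then show "(?p * ?q * ?g) $ n = fps_const (- 2 * x) $ n" for n
    proof (cases n)
      case (Suc m)
      then show ?thesis using \<open>?p * ?q = _\<close>
        by (cases m) (simp_all add: fps_of_poly_pCons algebra_simps)
    qed (simp add: fps_of_poly_pCons)
  qed
  have d: "fps_deriv (?q * geo x) = 0" by (simp add: geo_mult)
  have "fps_deriv ?q = fps_const x" by (simp add: fps_of_poly_pCons)
  then have "?q * fps_deriv (geo x) + fps_const x * geo x = 0" using d by (simp only: fps_deriv_mult)
  then have "?q * fps_deriv (geo x) = - fps_const x * geo x"
    by (simp only: eq_neg_iff_add_eq_0 minus_mult_left[symmetric])
  then have "(?q * geo x) * fps_deriv (geo x) = - fps_const x * geo x * geo x"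
    by (simp only: mult_ac)
  then have dg: "fps_deriv (geo x) = - fps_const x * geo x * geo x"
    by (simp add: geo_mult)
  have "fps_deriv (?p * geo x) = - fps_const x * geo x * 1 + ?p * (- fps_const x * geo x * geo x)"
    by (simp add: dg fps_of_poly_pderiv[symmetric] pderiv_pCons fps_of_poly_pCons fps_const_neg[symmetric] del: fps_const_neg)
  also have "\<dots> = - fps_const x * geo x * (?q * geo x) + ?p * (- fps_const x * geo x * geo x)"
    by (simp only: geo_mult)
  also have "\<dots> = fps_const (- 2 * x) * geo x * geo x"
    by (simp add: fps_of_poly_pCons algebra_simps fps_const_neg[symmetric] fps_const_mult[symmetric] numeral_fps_const del: fps_const_neg fps_const_mult)
  also have "\<dots> = ?p * geo x * ?g * (?q * geo x)" unfolding g[symmetric] by (simp add: mult_ac)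
  finally show ?thesis by (simp add: geo_mult)
qed

text \<open>The exponent is the sum over \<open>A\<close> of log((1 - \<xi> y) / (1 + \<xi> y)).
  Both sides have the same logarithmic derivative and constant term 1.\<close>

lemma exp_comp_log_ratio:
  fixes \<xi> :: "'w \<Rightarrow> 'r :: field_char_0"
  assumes "finite A"
  shows "exp_comp (Abs_fps (\<lambda>m. if odd m then - 2 / of_nat m * (\<Sum>w\<in>A. \<xi> w ^ m) else 0)) =
    (\<Prod>w\<in>A. fps_of_poly [:1, - \<xi> w:] * geo (\<xi> w))"
    (is "exp_comp ?L = ?R")
proof (rule fps_ode_unique)
  let ?g = "\<lambda>w. Abs_fps (\<lambda>n. if even n then - 2 * \<xi> w ^ Suc n else 0)"
  have "fps_deriv ?L = (\<Sum>w\<in>A. ?g w)"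
  proof (rule fps_ext)
    fix n
    have "of_nat (Suc n) * (- 2 / of_nat (Suc n) * c) = - 2 * c" for c :: 'r
      using of_nat_neq_0[of n, where 'a = 'r] by (simp only: times_divide_eq_left times_divide_eq_right nonzero_mult_div_cancel_left) simp
    then show "fps_deriv ?L $ n = (\<Sum>w\<in>A. ?g w) $ n"
      by (simp add: fps_sum_nth sum_distrib_left del: of_nat_Suc)
  qed
  then show "fps_deriv (exp_comp ?L) = exp_comp ?L * (\<Sum>w\<in>A. ?g w)"
    by (subst fps_deriv_exp_comp) auto
  show "fps_deriv ?R = ?R * (\<Sum>w\<in>A. ?g w)"
    using assms
  proof (induction A rule: finite_induct)
    case (insert w A)
    let ?f = "\<lambda>w. fps_of_poly [:1, - \<xi> w:] * geo (\<xi> w)"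
    have "fps_deriv (\<Prod>w\<in>insert w A. ?f w) = fps_deriv (?f w * (\<Prod>w\<in>A. ?f w))"
      by (simp only: prod.insert[OF insert.hyps])
    also have "\<dots> = ?f w * ((\<Prod>w\<in>A. ?f w) * (\<Sum>w\<in>A. ?g w)) + ?f w * ?g w * (\<Prod>w\<in>A. ?f w)"
      by (subst fps_deriv_mult) (simp only: insert.IH fps_deriv_ratio)
    also have "\<dots> = (?f w * (\<Prod>w\<in>A. ?f w)) * (?g w + (\<Sum>w\<in>A. ?g w))"
      by (simp only: distrib_left mult_ac add_ac)
    finally show ?case by (simp only: prod.insert[OF insert.hyps] sum.insert[OF insert.hyps])
  qed simp
  have "?R $ 0 = (\<Prod>w\<in>A. 1)"
    using assms by (induction A rule: finite_induct) (simp_all add: geo_def)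
  then show "exp_comp ?L $ 0 = ?R $ 0" "?R $ 0 \<noteq> 0" by auto
qed

section \<open>Partial fractions\<close>

lemma prod_linear_poly:
  fixes c :: "'w \<Rightarrow> 'r :: comm_ring_1"
  assumes "finite A"
  shows "degree (\<Prod>w\<in>A. [:1, c w:]) \<le> card A"
    and "coeff (\<Prod>w\<in>A. [:1, c w:]) (card A) = (\<Prod>w\<in>A. c w)"
  using assms
proof (induction A rule: finite_induct)
  case (insert w A)
  let ?P = "\<Prod>w\<in>A. [:1, c w:]"
  have "degree ([:1, c w:] * ?P) \<le> degree [:1, c w:] + degree ?P" by (rule degree_mult_le)
  also have "\<dots> \<le> 1 + card A" using insert by (intro add_mono) auto
  finally show "degree (\<Prod>w\<in>insert w A. [:1, c w:]) \<le> card (insert w A)" using insert by simp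
  have "coeff ?P (Suc (card A)) = 0" using insert by (intro coeff_eq_0) simp
  then show "coeff (\<Prod>w\<in>insert w A. [:1, c w:]) (card (insert w A)) = (\<Prod>w\<in>insert w A. c w)"
    using insert by simp
qed auto

text \<open>The coefficient of 1 / (1 + \<xi>_w y) in the partial fractions: the remaining factors
  at y = -1/\<xi>_w. The 2 is the value there of the numerator 1 - \<xi>_w y of \<open>w\<close>
  itself.\<close>

definition res_coeff :: "('w \<Rightarrow> 'r) \<Rightarrow> 'w set \<Rightarrow> 'w \<Rightarrow> 'r :: field" where
  "res_coeff \<xi> A w = 2 * (\<Prod>w'\<in>A - {w}. (\<xi> w + \<xi> w') / (\<xi> w - \<xi> w'))"

text \<open>The power of -1 is the value of the rational function at infinity, so the leading
  coefficients agree and the difference of the two sides has degree below \<open>card A\<close>. It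
  vanishes at the \<open>card A\<close> distinct points -1/\<xi>_v.\<close>

lemma partial_fractions_poly:
  fixes \<xi> :: "'w \<Rightarrow> 'r :: field"
  assumes fin: "finite A" and inj: "inj_on \<xi> A" and nz: "\<And>w. w \<in> A \<Longrightarrow> \<xi> w \<noteq> 0"
  shows "(\<Prod>w\<in>A. [:1, - \<xi> w:]) = Polynomial.smult ((-1) ^ card A) (\<Prod>w\<in>A. [:1, \<xi> w:]) +
    (\<Sum>w\<in>A. Polynomial.smult (res_coeff \<xi> A w) (\<Prod>w'\<in>A - {w}. [:1, \<xi> w':]))"
    (is "?L = ?R")
proof (cases "A = {}")
  case False
  let ?D = "?L - ?R" and ?N = "card A"
  have N: "?N > 0" using False fin by (simp add: card_gt_0_iff)
  have deg1: "degree (\<Prod>w'\<in>A - {w}. [:1, \<xi> w':]) < ?N" if "w \<in> A" for w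
    using prod_linear_poly(1)[of "A - {w}" \<xi>] fin that N by (simp add: card_Diff_singleton)
  have "degree ?R \<le> ?N"
    by (intro degree_add_le degree_sum_le order_trans[OF degree_smult_le])
      (use deg1 prod_linear_poly(1)[OF fin] fin in \<open>auto intro: less_imp_le\<close>)
  then have deg: "degree ?D \<le> ?N"
    by (intro degree_diff_le prod_linear_poly(1)[OF fin])
  have "coeff ?D ?N = (\<Prod>w\<in>A. - \<xi> w) - (-1) ^ ?N * (\<Prod>w\<in>A. \<xi> w)"
    using deg1 by (simp add: prod_linear_poly(2)[OF fin] coeff_sum coeff_eq_0)
  also have "\<dots> = 0" by (simp add: prod_uminus)
  finally have "coeff ?D ?N = 0" .
  have deg': "degree ?D < ?N"
  proof (rule ccontr)
    assume "\<not> degree ?D < ?N"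
    then have "degree ?D = ?N" using deg by (intro antisym) (simp_all only: not_less)
    then have "?D = 0" using \<open>coeff ?D ?N = 0\<close> leading_coeff_0_iff[of ?D] by (simp only: simp_thms)
    then have "degree ?D = 0" by (simp only: degree_0)
    then show False using \<open>degree ?D = ?N\<close> N by (simp only:)
  qed
  have root: "poly ?D (- 1 / \<xi> v) = 0" if v: "v \<in> A" for v
  proof -
    have nzv: "\<xi> v \<noteq> 0" using nz v by simp
    have lin: "poly [:1, c:] (- 1 / \<xi> v) = (\<xi> v - c) / \<xi> v" for c
      using nzv by (simp add: field_simps)
    have z: "(\<Prod>w'\<in>B. (\<xi> v - \<xi> w') / \<xi> v) = 0" if "v \<in> B" "finite B" for B
      using that by (intro prod_zero) auto
    have "poly ?R (- 1 / \<xi> v) =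
        (\<Sum>w\<in>A. res_coeff \<xi> A w * (\<Prod>w'\<in>A - {w}. (\<xi> v - \<xi> w') / \<xi> v))"
      using z[OF v fin] by (simp only: poly_add poly_smult poly_sum poly_prod lin) simp
    also have "\<dots> = (\<Sum>w\<in>{v}. res_coeff \<xi> A w * (\<Prod>w'\<in>A - {w}. (\<xi> v - \<xi> w') / \<xi> v))"
      by (rule sum.mono_neutral_right) (use fin v z in auto)
    also have "\<dots> = 2 * (\<Prod>w'\<in>A - {v}. (\<xi> v + \<xi> w') / (\<xi> v - \<xi> w') * ((\<xi> v - \<xi> w') / \<xi> v))"
      unfolding prod.distrib by (simp add: res_coeff_def mult.assoc)
    also have "\<dots> = 2 * (\<Prod>w'\<in>A - {v}. (\<xi> v + \<xi> w') / \<xi> v)"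
      by (intro arg_cong2[of _ _ _ _ "(*)"] prod.cong refl) (use inj v in \<open>auto simp: inj_on_def\<close>)
    also have "\<dots> = (\<Prod>w'\<in>A. (\<xi> v + \<xi> w') / \<xi> v)"
      unfolding prod.remove[OF fin v, of "\<lambda>w'. (\<xi> v + \<xi> w') / \<xi> v"] using nzv by simp
    also have "\<dots> = poly ?L (- 1 / \<xi> v)"
      by (simp only: poly_prod lin) simp
    finally show ?thesis by simp
  qed
  have "?D = 0"
  proof (rule ccontr)
    assume "?D \<noteq> 0"
    then have "card ((\<lambda>w. - 1 / \<xi> w) ` A) \<le> degree ?D"
      using root poly_roots_finite by (intro order_trans[OF card_mono card_poly_roots_bound]) blast+
    moreover have "inj_on (\<lambda>w. - 1 / \<xi> w) A"
      using inj nz by (auto simp: inj_on_def field_simps)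
    ultimately show False using deg' by (simp add: card_image)
  qed
  then show ?thesis by simp
qed auto

text \<open>The partial fractions, expanded in geometric series. The polynomial part is constant and
  is therefore seen at \<open>K = 0\<close> only.\<close>

lemma coeff_prod_ratio:
  fixes \<xi> :: "'w \<Rightarrow> 'r :: field_char_0"
  assumes fin: "finite A" and inj: "inj_on \<xi> A" and nz: "\<And>w. w \<in> A \<Longrightarrow> \<xi> w \<noteq> 0"
  shows "(\<Prod>w\<in>A. fps_of_poly [:1, - \<xi> w:] * geo (\<xi> w)) $ K =
    (if K = 0 then (-1) ^ card A else 0) + (\<Sum>w\<in>A. res_coeff \<xi> A w * (- \<xi> w) ^ K)"
proof -
  let ?G = "\<Prod>w\<in>A. geo (\<xi> w)"
  have 1: "(\<Prod>w\<in>B. fps_of_poly [:1, \<xi> w:]) * (\<Prod>w\<in>B. geo (\<xi> w)) = 1" for B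
    by (simp add: prod.distrib[symmetric] geo_mult)
  have "(\<Prod>w\<in>A. fps_of_poly [:1, - \<xi> w:] * geo (\<xi> w)) = fps_of_poly (\<Prod>w\<in>A. [:1, - \<xi> w:]) * ?G"
    by (simp add: prod.distrib fps_of_poly_prod)
  also have "\<dots> = fps_const ((-1) ^ card A) * ((\<Prod>w\<in>A. fps_of_poly [:1, \<xi> w:]) * ?G) +
      (\<Sum>w\<in>A. fps_const (res_coeff \<xi> A w) * ((\<Prod>w'\<in>A - {w}. fps_of_poly [:1, \<xi> w':]) * ?G))"
    by (subst partial_fractions_poly[OF fin inj nz], assumption)
      (simp add: fps_of_poly_add fps_of_poly_smult fps_of_poly_sum fps_of_poly_prod distrib_right sum_distrib_right mult.assoc)
  also have "(\<Sum>w\<in>A. fps_const (res_coeff \<xi> A w) * ((\<Prod>w'\<in>A - {w}. fps_of_poly [:1, \<xi> w':]) * ?G)) =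
      (\<Sum>w\<in>A. fps_const (res_coeff \<xi> A w) * geo (\<xi> w))"
  proof (rule sum.cong[OF refl])
    fix w assume "w \<in> A"
    then have "?G = geo (\<xi> w) * (\<Prod>w'\<in>A - {w}. geo (\<xi> w'))" by (rule prod.remove[OF fin])
    then have "(\<Prod>w'\<in>A - {w}. fps_of_poly [:1, \<xi> w':]) * ?G =
        geo (\<xi> w) * ((\<Prod>w'\<in>A - {w}. fps_of_poly [:1, \<xi> w':]) * (\<Prod>w'\<in>A - {w}. geo (\<xi> w')))"
      by (simp only: mult_ac)
    then show "fps_const (res_coeff \<xi> A w) * ((\<Prod>w'\<in>A - {w}. fps_of_poly [:1, \<xi> w':]) * ?G) =
        fps_const (res_coeff \<xi> A w) * geo (\<xi> w)" by (simp only: 1 mult_1_right)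
  qed
  finally show ?thesis by (simp only: 1) (simp add: fps_sum_nth geo_def)
qed

section \<open>Products over pairs\<close>

abbreviation pairs :: "nat \<Rightarrow> (nat \<times> nat) set" where
  "pairs n \<equiv> {(i, j). i < j \<and> j < n}"

lemma finite_pairs [simp]: "finite (pairs n)"
  by (rule finite_subset[of _ "{..<n} \<times> {..<n}"]) auto

text \<open>The transposition reverses the order in the pair (a, b) and in the pairs (a, c) and (c,
  b) with a < c < b, an odd number in all. Skewness costs one sign for each.\<close>

lemma prod_pairs_transpose:
  fixes f :: "nat \<Rightarrow> nat \<Rightarrow> 'r :: comm_ring_1"
  assumes skew: "\<And>i j. i < n \<Longrightarrow> j < n \<Longrightarrow> i \<noteq> j \<Longrightarrow> f j i = - f i j" and ab: "a < b" "b < n"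
  shows "(\<Prod>(i, j)\<in>pairs n. f (transpose a b i) (transpose a b j)) = - (\<Prod>(i, j)\<in>pairs n. f i j)"
proof -
  let ?t = "transpose a b"
  have tn: "?t i < n" if "i < n" for i using that ab by (auto simp: transpose_def)
  have tinj: "?t i = ?t j \<longleftrightarrow> i = j" for i j by (metis transpose_involutory)
  define I where "I = {(i, j) \<in> pairs n. ?t j < ?t i}"
  have "I = insert (a, b) (Pair a ` {a<..<b} \<union> (\<lambda>c. (c, b)) ` {a<..<b})"
    using ab unfolding I_def by (auto simp: transpose_def split: if_splits)
  moreover have "card (Pair a ` {a<..<b} \<union> (\<lambda>c. (c, b)) ` {a<..<b}) = (b - a - 1) + (b - a - 1)"
    by (subst card_Un_disjoint) (auto simp: card_image inj_on_def)
  moreover have "(a, b) \<notin> Pair a ` {a<..<b} \<union> (\<lambda>c. (c, b)) ` {a<..<b}" by auto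
  ultimately have "card I = Suc ((b - a - 1) + (b - a - 1))" by simp
  then have odd: "odd (card I)" by simp
  have fin: "finite I" by (rule finite_subset[OF _ finite_pairs[of n]]) (auto simp: I_def)
  define h where "h p = (case p of (i, j) \<Rightarrow> f (min (?t i) (?t j)) (max (?t i) (?t j)))" for p
  have "(\<Prod>(i, j)\<in>pairs n. f (?t i) (?t j)) = (\<Prod>p\<in>pairs n. (if p \<in> I then -1 else 1) * h p)"
  proof (rule prod.cong[OF refl], clarify)
    fix i j assume ij: "i < j" "j < n"
    then have "?t i \<noteq> ?t j" "?t i < n" "?t j < n" using tn by (auto simp: tinj)
    then show "f (?t i) (?t j) = (if (i, j) \<in> I then -1 else 1) * h (i, j)"
      using ij skew[of "?t j" "?t i"] by (auto simp: I_def h_def min_def max_def)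
  qed
  also have "\<dots> = (\<Prod>p\<in>pairs n. if p \<in> I then -1 else 1) * (\<Prod>p\<in>pairs n. h p)"
    by (rule prod.distrib)
  also have "(\<Prod>p\<in>pairs n. if p \<in> I then -1 else 1) = (\<Prod>p\<in>I. -1 :: 'r)"
    by (rule prod.mono_neutral_cong_right) (auto simp: I_def)
  also have "\<dots> = -1" using odd by simp
  also have "(\<Prod>p\<in>pairs n. h p) = (\<Prod>(i, j)\<in>pairs n. f i j)"
  proof (rule prod.reindex_bij_witness)
    \<comment> \<open>Transposing and then sorting a pair is an involution of the set of ordered
      pairs.\<close>
    let ?s = "\<lambda>(i, j). (min (?t i) (?t j), max (?t i) (?t j))"
    have *: "?s (?s p) = p \<and> ?s p \<in> pairs n" if mem: "p \<in> pairs n" for p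
    proof -
      obtain i j where p: "p = (i, j)" "i < j" "j < n" using mem by (cases p) auto
      show ?thesis
      proof (cases "?t i < ?t j")
        case True
        then show ?thesis using p tn by (simp add: min_def max_def)
      next
        case False
        then have "?t j < ?t i" using tinj[of i j] p by (simp add: not_less order.order_iff_strict)
        then show ?thesis using p tn by (simp add: min_def max_def)
      qed
    qed
    show "?s (?s p) = p" "?s (?s p) = p" "?s p \<in> pairs n" "?s p \<in> pairs n" if "p \<in> pairs n" for p
      using *[OF that] by (simp_all only: simp_thms)
    show "(case ?s p of (i, j) \<Rightarrow> f i j) = h p" if "p \<in> pairs n" for p
      by (cases p) (simp add: h_def)
  qed
  finally show ?thesis by simp
qed

lemma prod_pairs_permutes:
  fixes f :: "nat \<Rightarrow> nat \<Rightarrow> 'r :: comm_ring_1"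
  assumes "p permutes {..<n}" and "\<And>i j. i < n \<Longrightarrow> j < n \<Longrightarrow> i \<noteq> j \<Longrightarrow> f j i = - f i j"
  shows "(\<Prod>(i, j)\<in>pairs n. f (p i) (p j)) = of_int (sign p) * (\<Prod>(i, j)\<in>pairs n. f i j)"
proof -
  have "finite {..<n}" by simp
  \<comment> \<open>The function \<open>f\<close> is quantified inside the induction, since the
    hypothesis is applied to \<open>f\<close> with both arguments transposed.\<close>
  from assms(1) this have "\<forall>f :: nat \<Rightarrow> nat \<Rightarrow> 'r. (\<forall>i<n. \<forall>j<n. i \<noteq> j \<longrightarrow> f j i = - f i j) \<longrightarrow>
    (\<Prod>(i, j)\<in>pairs n. f (p i) (p j)) = of_int (sign p) * (\<Prod>(i, j)\<in>pairs n. f i j)"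
  proof (induction rule: permutes_induct)
    case id
    then show ?case by simp
  next
    case (swap a b p)
    let ?t = "transpose a b"
    have tn: "?t i < n" if "i < n" for i using that swap.hyps by (auto simp: transpose_def)
    have tinj: "?t i = ?t j \<longleftrightarrow> i = j" for i j by (metis transpose_involutory)
    have sgn: "sign (?t \<circ> p) = - sign p"
      using swap.hyps by (subst sign_compose) (auto simp: sign_swap_id permutation_swap_id intro: permutation_permutes[THEN iffD2])
    show ?case
    proof (intro allI impI)
      fix f :: "nat \<Rightarrow> nat \<Rightarrow> 'r" assume f: "\<forall>i<n. \<forall>j<n. i \<noteq> j \<longrightarrow> f j i = - f i j"
      have "(\<Prod>(i, j)\<in>pairs n. f ((?t \<circ> p) i) ((?t \<circ> p) j)) =
          of_int (sign p) * (\<Prod>(i, j)\<in>pairs n. f (?t i) (?t j))"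
        unfolding o_def
        by (rule swap.IH[rule_format, of "\<lambda>i j. f (?t i) (?t j)"])
          (rule f[rule_format]; simp add: tn tinj)
      also have "(\<Prod>(i, j)\<in>pairs n. f (?t i) (?t j)) = - (\<Prod>(i, j)\<in>pairs n. f i j)"
      proof (cases "a < b")
        case True
        then show ?thesis
          by (intro prod_pairs_transpose) (blast intro: f[rule_format], use swap.hyps in auto)
      next
        case False
        have "(\<Prod>(i, j)\<in>pairs n. f (transpose b a i) (transpose b a j)) = - (\<Prod>(i, j)\<in>pairs n. f i j)"
          by (intro prod_pairs_transpose) (blast intro: f[rule_format], use False swap.hyps in auto)
        then show ?thesis by (simp only: transpose_commute)
      qed
      finally show "(\<Prod>(i, j)\<in>pairs n. f ((?t \<circ> p) i) ((?t \<circ> p) j)) =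
          of_int (sign (?t \<circ> p)) * (\<Prod>(i, j)\<in>pairs n. f i j)" by (simp add: sgn)
    qed
  qed
  then show ?thesis using assms(2) by blast
qed

section \<open>Pfaffians\<close>

text \<open>
  An alternating function of \<open>2 n\<close> arguments that satisfies the expansion along the first
  argument is a Pfaffian: averaging the expansion over all permutations of the arguments makes
  all its terms equal.
\<close>

definition pf_term :: "('v \<Rightarrow> 'v \<Rightarrow> 'r) \<Rightarrow> (nat \<Rightarrow> 'v) \<Rightarrow> nat \<Rightarrow> (nat \<Rightarrow> nat) \<Rightarrow> 'r :: comm_ring_1" where
  "pf_term b W n p = of_int (sign p) * (\<Prod>i<n. b (W (p (2 * i))) (W (p (2 * i + 1))))"

lemma permutation_lessThan: "p permutes {..<n :: nat} \<Longrightarrow> permutation p"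
  by (auto intro: permutation_permutes[THEN iffD2])

lemma pfaffian_of_expansion:
  fixes S :: "nat \<Rightarrow> (nat \<Rightarrow> 'v) \<Rightarrow> 'r :: field_char_0"
  assumes S0: "\<And>W. S 0 W = 1"
    and alt: "\<And>n W p. p permutes {..<2 * n} \<Longrightarrow> inj_on W {..<2 * n} \<Longrightarrow>
      S n (W \<circ> p) = of_int (sign p) * S n W"
    and expand: "\<And>n W. inj_on W {..<2 * Suc n} \<Longrightarrow> S (Suc n) W =
      (\<Sum>j\<in>{1..<2 * Suc n}. of_int (sign (transpose 1 j)) * b (W 0) (W j) *
        S n (\<lambda>i. W (transpose 1 j (i + 2))))"
  shows "inj_on W {..<2 * n} \<Longrightarrow> 2 ^ n * fact n * S n W = (\<Sum>p | p permutes {..<2 * n}. pf_term b W n p)"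
proof (induction n arbitrary: W)
  case 0
  then show ?case by (simp add: S0 pf_term_def)
next
  case (Suc n)
  let ?M = "2 * Suc n"
  let ?P = "{p. p permutes {..<?M}}" and ?Q = "{q. q permutes {..<2 * n}}"
  \<comment> \<open>\<open>G p\<close> is the term j = 1 in the expansion of
    \<open>S (Suc n) (W \<circ> p)\<close>, times the sign of \<open>p\<close>. The term j is then
    \<open>G (p \<circ> transpose 1 j)\<close>.\<close>
  define G where "G p = of_int (sign p) * b (W (p 0)) (W (p 1)) * S n (\<lambda>i. W (p (i + 2)))" for p
  \<comment> \<open>A permutation of the remaining arguments, moved to the positions from 2
    on.\<close>
  define up where "up q = map_permutation {..<2 * n} (\<lambda>x. x + 2) q" for q
  have up: "up q permutes {..<?M}" "sign (up q) = sign q" "up q 0 = 0" "up q 1 = 1"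
    "\<And>x. x < 2 * n \<Longrightarrow> up q (x + 2) = q x + 2" if q: "q permutes {..<2 * n}" for q
  proof -
    have bij: "bij_betw (\<lambda>x. x + 2) {..<2 * n} {2..<?M}"
      by (rule bij_betwI[where g = "\<lambda>x. x - 2"]) auto
    have up2: "up q permutes {2..<?M}"
      unfolding up_def by (rule map_permutation_permutes[OF bij q])
    then show "up q permutes {..<?M}" by (rule permutes_subset) auto
    show "up q 0 = 0" "up q 1 = 1" using up2 by (auto intro: permutes_not_in)
    show "sign (up q) = sign q" unfolding up_def using q by (intro sign_map_permutation) (auto simp: inj_on_def)
    show "up q (x + 2) = q x + 2" if "x < 2 * n" for x
      unfolding up_def using that by (intro map_permutation_apply) (auto simp: inj_on_def)
  qed
  have injp: "inj_on (\<lambda>i. W (p (i + 2))) {..<2 * n}" if p: "p permutes {..<?M}" for p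
  proof (rule inj_onI)
    fix x y assume xy: "x \<in> {..<2 * n}" "y \<in> {..<2 * n}" "W (p (x + 2)) = W (p (y + 2))"
    have "p (x + 2) \<in> {..<?M}" "p (y + 2) \<in> {..<?M}" using xy permutes_in_image[OF p] by auto
    then have "p (x + 2) = p (y + 2)" using Suc.prems xy by (auto dest: inj_onD)
    then show "x = y" using permutes_inj[OF p] by (auto dest: injD)
  qed
  have card: "card ?P = fact ?M" "card ?Q = fact (2 * n)" by (intro card_permutations; simp)+
  have "fact ?M * S (Suc n) W = (\<Sum>p\<in>?P. S (Suc n) W)"
    by (simp only: sum_constant card of_nat_fact)
  also have "\<dots> = (\<Sum>p\<in>?P. \<Sum>j\<in>{1..<?M}. G (p \<circ> transpose 1 j))"
  proof (rule sum.cong[OF refl])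
    fix p assume "p \<in> ?P"
    then have p: "p permutes {..<?M}" by simp
    have "S (Suc n) W = of_int (sign p) * S (Suc n) (W \<circ> p)"
      by (subst alt[OF p Suc.prems])
        (simp add: mult.assoc[symmetric] of_int_mult[symmetric] del: of_int_mult)
    also have "inj_on (W \<circ> p) {..<?M}"
      using Suc.prems p by (simp add: comp_inj_on permutes_image permutes_inj_on)
    then have "S (Suc n) (W \<circ> p) = (\<Sum>j\<in>{1..<?M}. of_int (sign (transpose 1 j)) *
        b ((W \<circ> p) 0) ((W \<circ> p) j) * S n (\<lambda>i. (W \<circ> p) (transpose 1 j (i + 2))))"
      by (rule expand)
    also have "of_int (sign p) * \<dots> = (\<Sum>j\<in>{1..<?M}. G (p \<circ> transpose 1 j))"
      unfolding sum_distrib_left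
    proof (rule sum.cong[OF refl])
      fix j assume j: "j \<in> {1..<?M}"
      have "sign (p \<circ> transpose 1 j) = sign p * sign (transpose 1 j)"
        by (rule sign_compose) (use p in \<open>auto intro: permutation_lessThan permutation_swap_id\<close>)
      then show "of_int (sign p) * (of_int (sign (transpose 1 j)) * b ((W \<circ> p) 0) ((W \<circ> p) j) *
          S n (\<lambda>i. (W \<circ> p) (transpose 1 j (i + 2)))) = G (p \<circ> transpose 1 j)"
        using j by (simp add: G_def transpose_def mult.assoc)
    qed
    finally show "S (Suc n) W = (\<Sum>j\<in>{1..<?M}. G (p \<circ> transpose 1 j))" .
  qed
  also have "\<dots> = (\<Sum>j\<in>{1..<?M}. \<Sum>p\<in>?P. G (p \<circ> transpose 1 j))" by (rule sum.swap)
  \<comment> \<open>Composition with a fixed transposition only reorders the sum over all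
    permutations, so the \<open>?M - 1\<close> values of j contribute equally.\<close>
  also have "\<dots> = (\<Sum>j\<in>{1..<?M}. \<Sum>p\<in>?P. G p)"
    by (intro sum.cong[OF refl] sum_permutations_compose_right[symmetric] permutes_swap_id) auto
  also have "\<dots> = of_nat (?M - 1) * (\<Sum>p\<in>?P. G p)" by simp
  finally have 1: "fact ?M * S (Suc n) W = of_nat (?M - 1) * (\<Sum>p\<in>?P. G p)" .
  \<comment> \<open>The induction hypothesis resolves each \<open>G p\<close> into Pfaffian terms of
    the permutations \<open>p \<circ> up q\<close>; for fixed \<open>q\<close> these again run over
    all permutations.\<close>
  have "2 ^ n * fact n * (\<Sum>p\<in>?P. G p) = (\<Sum>p\<in>?P. \<Sum>q\<in>?Q. pf_term b W (Suc n) (p \<circ> up q))"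
    unfolding sum_distrib_left
  proof (rule sum.cong[OF refl])
    fix p assume "p \<in> ?P"
    then have p: "p permutes {..<?M}" by simp
    have "2 ^ n * fact n * G p = of_int (sign p) * b (W (p 0)) (W (p 1)) *
        (2 ^ n * fact n * S n (\<lambda>i. W (p (i + 2))))"
      by (simp add: G_def mult_ac)
    also have "\<dots> = (\<Sum>q\<in>?Q. of_int (sign p) * b (W (p 0)) (W (p 1)) * pf_term b (\<lambda>i. W (p (i + 2))) n q)"
      unfolding Suc.IH[OF injp[OF p]] by (rule sum_distrib_left)
    also have "\<dots> = (\<Sum>q\<in>?Q. pf_term b W (Suc n) (p \<circ> up q))"
    proof (rule sum.cong[OF refl])
      fix q assume "q \<in> ?Q"
      then have q: "q permutes {..<2 * n}" by simp
      have sgn: "sign (p \<circ> up q) = sign p * sign q"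
        by (subst sign_compose) (use p up[OF q] in \<open>auto intro: permutation_lessThan\<close>)
      have "(\<Prod>i<Suc n. b (W ((p \<circ> up q) (2 * i))) (W ((p \<circ> up q) (2 * i + 1)))) =
          b (W (p 0)) (W (p 1)) * (\<Prod>i<n. b (W (p (up q (2 * i + 2)))) (W (p (up q ((2 * i + 1) + 2)))))"
        unfolding prod.lessThan_Suc_shift by (simp add: up[OF q, simplified])
      also have "(\<Prod>i<n. b (W (p (up q (2 * i + 2)))) (W (p (up q ((2 * i + 1) + 2))))) =
          (\<Prod>i<n. b (W (p (q (2 * i) + 2))) (W (p (q (2 * i + 1) + 2))))"
      proof (rule prod.cong[OF refl])
        fix i assume "i \<in> {..<n}"
        then have "2 * i < 2 * n" "2 * i + 1 < 2 * n" by auto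
        then show "b (W (p (up q (2 * i + 2)))) (W (p (up q ((2 * i + 1) + 2)))) =
            b (W (p (q (2 * i) + 2))) (W (p (q (2 * i + 1) + 2)))"
          by (simp only: up(5)[OF q])
      qed
      finally show "of_int (sign p) * b (W (p 0)) (W (p 1)) * pf_term b (\<lambda>i. W (p (i + 2))) n q =
          pf_term b W (Suc n) (p \<circ> up q)"
        unfolding pf_term_def sgn by (simp only: of_int_mult mult_ac)
    qed
    finally show "2 ^ n * fact n * G p = (\<Sum>q\<in>?Q. pf_term b W (Suc n) (p \<circ> up q))" .
  qed
  also have "\<dots> = (\<Sum>q\<in>?Q. \<Sum>p\<in>?P. pf_term b W (Suc n) (p \<circ> up q))" by (rule sum.swap)
  also have "\<dots> = (\<Sum>q\<in>?Q. \<Sum>p\<in>?P. pf_term b W (Suc n) p)"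
  proof (rule sum.cong[OF refl])
    fix q assume "q \<in> ?Q"
    then have "up q permutes {..<?M}" using up(1) by (simp only: mem_Collect_eq)
    then show "(\<Sum>p\<in>?P. pf_term b W (Suc n) (p \<circ> up q)) = (\<Sum>p\<in>?P. pf_term b W (Suc n) p)"
      by (rule sum_permutations_compose_right[symmetric])
  qed
  also have "\<dots> = fact (2 * n) * (\<Sum>p\<in>?P. pf_term b W (Suc n) p)"
    by (simp only: sum_constant card of_nat_fact)
  finally have 2: "2 ^ n * fact n * (\<Sum>p\<in>?P. G p) = fact (2 * n) * (\<Sum>p\<in>?P. pf_term b W (Suc n) p)" .
  \<comment> \<open>In \<open>fact ?M = ?M * (?M - 1) * fact (2 * n)\<close> the factor
    \<open>?M = 2 * Suc n\<close> is what turns \<open>2 ^ n * fact n\<close> into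
    \<open>2 ^ Suc n * fact (Suc n)\<close>.\<close>
  let ?c = "of_nat (?M - 1) * fact (2 * n) :: 'r"
  have M: "fact ?M = of_nat ?M * ?c"
    by (simp add: fact_Suc algebra_simps)
  have "?c * (2 ^ Suc n * fact (Suc n) * S (Suc n) W) = 2 ^ n * fact n * (fact ?M * S (Suc n) W)"
    unfolding M by (simp add: fact_Suc algebra_simps)
  also have "\<dots> = of_nat (?M - 1) * (2 ^ n * fact n * (\<Sum>p\<in>?P. G p))"
    unfolding 1 by (simp only: mult_ac)
  also have "\<dots> = ?c * (\<Sum>p\<in>?P. pf_term b W (Suc n) p)"
    unfolding 2 by (simp only: mult_ac)
  finally have eq: "?c * (2 ^ Suc n * fact (Suc n) * S (Suc n) W) = ?c * (\<Sum>p\<in>?P. pf_term b W (Suc n) p)" .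
  have "?c \<noteq> 0" using of_nat_neq_0[of "2 * n", where 'a = 'r] by simp
  then show ?case using eq by (simp only: mult_cancel_left simp_thms)
qed

section \<open>The bilinear identity\<close>

lemma op_exp_op_deriv_eq_0:
  assumes "n > 0"
  shows "op_exp (op_deriv a) (z_const f) n = 0"
proof (rule mfps_eqI)
  fix \<alpha>
  have "mfps_nth (op_exp (op_deriv a) (z_const f) n) \<alpha> =
      (\<Sum>j\<in>{}. mfps_nth (mfps_const (1 / fact j) * (op_deriv a ^^ j) (z_const f) n) \<alpha>)"
    unfolding op_exp_def using assms by (intro mfps_nth_mfps_sum) (auto simp: op_deriv_power_eq_0)
  then show "mfps_nth (op_exp (op_deriv a) (z_const f) n) \<alpha> = mfps_nth 0 \<alpha>" by simp
qed

text \<open>The differentiation part gives nonpositive powers of z only, and the multiplication part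
  pays weight m for z^m.\<close>

lemma vertex_op_eq_0:
  assumes "n > int (wt \<alpha>)"
  shows "mfps_nth (vertex_op a f n) \<alpha> = 0"
  unfolding vertex_op_def
  by (rule mfps_nth_op_exp_op_times_eq_0) (use assms in \<open>auto simp: op_exp_op_deriv_eq_0\<close>)

text \<open>The bounds of the sum depend on the weights alone, so the residue can be interchanged
  with the sums over monomials of given weights.\<close>

lemma res_tensor_vertex_op:
  assumes "wt \<alpha> = p" "wt \<beta> = q"
  shows "res_tensor (vertex_op a f) (z_neg (vertex_op a f)) \<alpha> \<beta> =
    (\<Sum>n\<in>{- int q..int p}. (if even n then 1 else -1) *
      (mfps_nth (vertex_op a f n) \<alpha> * mfps_nth (vertex_op a f (- n)) \<beta>))"
proof -
  have "res_tensor (vertex_op a f) (z_neg (vertex_op a f)) \<alpha> \<beta> =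
      (\<Sum>n\<in>{- int q..int p}. mfps_nth (vertex_op a f n) \<alpha> * mfps_nth (z_neg (vertex_op a f) (- n)) \<beta>)"
    unfolding res_tensor_def
  proof (rule Sum_any.expand_superset)
    show "{n. mfps_nth (vertex_op a f n) \<alpha> * mfps_nth (z_neg (vertex_op a f) (- n)) \<beta> \<noteq> 0} \<subseteq> {- int q..int p}"
    proof (rule subsetI, rule ccontr)
      fix n
      assume n: "n \<in> {n. mfps_nth (vertex_op a f n) \<alpha> * mfps_nth (z_neg (vertex_op a f) (- n)) \<beta> \<noteq> 0}"
      assume "n \<notin> {- int q..int p}"
      then consider "n > int (wt \<alpha>)" | "- n > int (wt \<beta>)" using assms by fastforce
      then show False using n by cases (simp_all add: vertex_op_eq_0 z_neg_def)
    qed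
  qed simp
  also have "\<dots> = (\<Sum>n\<in>{- int q..int p}. (if even n then 1 else -1) *
      (mfps_nth (vertex_op a f n) \<alpha> * mfps_nth (vertex_op a f (- n)) \<beta>))"
    by (intro sum.cong refl) (simp add: z_neg_def power_int_minus_left)
  finally show ?thesis .
qed

section \<open>Evaluation of the residue pairing in fixed weight\<close>

definition parity_sign :: "int \<Rightarrow> 'r :: comm_ring_1" where
  "parity_sign n = (if even n then 1 else -1)"

context complex_hom_field
begin

text \<open>\<open>p\<close> and \<open>q\<close> are target weights: the weights in the two copies
  of the variables after the vertex operators have acted.\<close>

definition bilin :: "comp \<Rightarrow> tvar mfps \<Rightarrow> (tvar \<Rightarrow> 'r) \<Rightarrow> (tvar \<Rightarrow> 'r) \<Rightarrow> nat \<Rightarrow> nat \<Rightarrow> 'r" where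
  "bilin a f s s' p q = (\<Sum>n\<in>{- int q..int p}. parity_sign n *
     (ev \<iota> s p (vertex_op a f n) * ev \<iota> s' q (vertex_op a f (- n))))"

lemma bilin_res_tensor:
  "bilin a f s s' p q = (\<Sum>\<alpha> | wt \<alpha> = p. \<Sum>\<beta> | wt \<beta> = q.
     \<iota> (res_tensor (vertex_op a f) (z_neg (vertex_op a f)) \<alpha> \<beta>) * (mono_val s \<alpha> * mono_val s' \<beta>))"
proof -
  define g where "g n \<alpha> \<beta> = parity_sign n * (\<iota> (mfps_nth (vertex_op a f n) \<alpha>) * mono_val s \<alpha> *
      (\<iota> (mfps_nth (vertex_op a f (- n)) \<beta>) * mono_val s' \<beta>))" for n \<alpha> \<beta>
  have hom_parity_sign: "\<iota> (if even n then 1 else -1) = parity_sign n" for n :: int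
    by (simp add: parity_sign_def hom_uminus)
  have "bilin a f s s' p q = (\<Sum>n\<in>{- int q..int p}. \<Sum>\<alpha> | wt \<alpha> = p. \<Sum>\<beta> | wt \<beta> = q. g n \<alpha> \<beta>)"
    unfolding bilin_def ev_def g_def by (simp only: sum_product sum_distrib_left[of "parity_sign _"])
  also have "\<dots> = (\<Sum>\<alpha> | wt \<alpha> = p. \<Sum>n\<in>{- int q..int p}. \<Sum>\<beta> | wt \<beta> = q. g n \<alpha> \<beta>)"
    by (rule sum.swap)
  also have "\<dots> = (\<Sum>\<alpha> | wt \<alpha> = p. \<Sum>\<beta> | wt \<beta> = q. \<Sum>n\<in>{- int q..int p}. g n \<alpha> \<beta>)"
    by (intro sum.cong refl sum.swap)
  also have "\<dots> = (\<Sum>\<alpha> | wt \<alpha> = p. \<Sum>\<beta> | wt \<beta> = q.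
     \<iota> (res_tensor (vertex_op a f) (z_neg (vertex_op a f)) \<alpha> \<beta>) * (mono_val s \<alpha> * mono_val s' \<beta>))"
  proof (intro sum.cong refl)
    fix \<alpha> \<beta> assume "\<alpha> \<in> {\<alpha>. wt \<alpha> = p}" "\<beta> \<in> {\<beta>. wt \<beta> = q}"
    then have wt: "wt \<alpha> = p" "wt \<beta> = q" by simp_all
    show "(\<Sum>n\<in>{- int q..int p}. g n \<alpha> \<beta>) =
        \<iota> (res_tensor (vertex_op a f) (z_neg (vertex_op a f)) \<alpha> \<beta>) * (mono_val s \<alpha> * mono_val s' \<beta>)"
      unfolding res_tensor_vertex_op[OF wt] hom_sum hom_mult hom_parity_sign sum_distrib_right g_def
      by (simp only: mult_ac)
  qed
  finally show ?thesis .
qed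

lemma bilin_tau:
  assumes "tau_function_2BKP \<tau>"
  shows "bilin Comp1 \<tau> s s' p q = bilin Comp2 \<tau> s s' p q"
proof -
  have "res_tensor (vertex_op Comp1 \<tau>) (z_neg (vertex_op Comp1 \<tau>)) \<alpha> \<beta> =
      res_tensor (vertex_op Comp2 \<tau>) (z_neg (vertex_op Comp2 \<tau>)) \<alpha> \<beta>" for \<alpha> \<beta>
    using assms unfolding tau_function_2BKP_def by (metis right_minus_eq)
  then show ?thesis by (simp only: bilin_res_tensor)
qed

text \<open>\<open>i\<close> is the source weight: the coefficient of z^(-l) lowers weights by
  \<open>l\<close>, so only the part of \<open>f\<close> of weight \<open>i\<close>
  contributes.\<close>

definition ev_D :: "comp \<Rightarrow> tvar mfps \<Rightarrow> (tvar \<Rightarrow> 'r) \<Rightarrow> nat \<Rightarrow> nat \<Rightarrow> 'r" where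
  "ev_D a f s i l = ev \<iota> s (i - l) (op_exp (op_deriv a) (z_const f) (- int l))"

lemma sum_ev_D: "(\<Sum>l\<le>i. y ^ l * ev_D a f s i l) = ev \<iota> (\<lambda>v. s v + shift a y v) i f"
proof -
  interpret complex_hom_shift \<iota> s a y ..
  show ?thesis unfolding ev_D_def by (rule ev_op_exp_op_deriv)
qed

lemma ev_D_0: "ev_D a f s i 0 = ev \<iota> s i f"
proof -
  have "ev_D a f s i 0 = (\<Sum>l\<in>{0}. 0 ^ l * ev_D a f s i l)" by simp
  also have "\<dots> = (\<Sum>l\<le>i. 0 ^ l * ev_D a f s i l)"
    by (rule sum.mono_neutral_left) auto
  also have "\<dots> = ev \<iota> (\<lambda>v. s v + shift a 0 v) i f" by (rule sum_ev_D)
  also have "(\<lambda>v. s v + shift a 0 v) = s" by (auto simp: shift_def)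
  finally show ?thesis .
qed

text \<open>Extended by 0 to negative indices, so that the range of \<open>n\<close> in the residue
  need not depend on the indices of the derivatives.\<close>

definition exp_s :: "comp \<Rightarrow> (tvar \<Rightarrow> 'r) \<Rightarrow> int \<Rightarrow> 'r" where
  "exp_s a s k = (if k < 0 then 0 else exp_comp (odd_series a s) $ nat k)"

text \<open>Target weight i + n in the coefficient of z^n means source weight i. With
  \<open>m = l + n\<close> the factor \<open>ev_D\<close> no longer depends on
  \<open>n\<close>.\<close>

lemma ev_vertex_op:
  assumes "int i + n \<ge> 0"
  shows "ev \<iota> s (nat (int i + n)) (vertex_op a f n) = (\<Sum>l\<le>i. exp_s a s (int l + n) * ev_D a f s i l)"
proof -
  let ?W = "op_exp (op_deriv a) (z_const f)" and ?p = "nat (int i + n)"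
  have "ev \<iota> s ?p (vertex_op a f n) =
      (\<Sum>m\<le>?p. exp_comp (odd_series a s) $ m * ev \<iota> s (?p - m) (?W (n - int m)))"
    unfolding vertex_op_def by (rule ev_op_exp_op_times)
  also have "\<dots> = (\<Sum>m | m \<le> ?p \<and> n \<le> int m. exp_comp (odd_series a s) $ m * ev \<iota> s (?p - m) (?W (n - int m)))"
  proof (rule sum.mono_neutral_right)
    have "?W (n - int m) = 0" if "\<not> n \<le> int m" for m
      using that by (intro op_exp_op_deriv_eq_0) simp
    then show "\<forall>m\<in>{..?p} - {m. m \<le> ?p \<and> n \<le> int m}.
        exp_comp (odd_series a s) $ m * ev \<iota> s (?p - m) (?W (n - int m)) = 0"
      by simp
  qed auto
  also have "\<dots> = (\<Sum>l | l \<le> i \<and> 0 \<le> int l + n. exp_comp (odd_series a s) $ nat (int l + n) * ev_D a f s i l)"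
  proof (rule sum.reindex_bij_witness[where i = "\<lambda>l. nat (int l + n)" and j = "\<lambda>m. nat (int m - n)"])
    fix m assume "m \<in> {m. m \<le> ?p \<and> n \<le> int m}"
    then have m: "m \<le> ?p" "n \<le> int m" by auto
    have "n - int m = - int (nat (int m - n))" "?p - m = i - nat (int m - n)" "nat (int (nat (int m - n)) + n) = m"
      using m assms by linarith+
    then show "exp_comp (odd_series a s) $ nat (int (nat (int m - n)) + n) * ev_D a f s i (nat (int m - n)) =
        exp_comp (odd_series a s) $ m * ev \<iota> s (?p - m) (?W (n - int m))"
      by (simp only: ev_D_def)
  qed (use assms in auto)
  also have "\<dots> = (\<Sum>l\<le>i. exp_s a s (int l + n) * ev_D a f s i l)"
    by (rule sum.mono_neutral_cong_left) (auto simp: exp_s_def)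
  finally show ?thesis .
qed

text \<open>Outside -l..l' the summands vanish, and what is left is the convolution of one
  exponential in y with the other in -y. With n = k - l the sign splits into (-1)^l' and (-1)^(l +
  l' - k); the latter inverts the second exponential.\<close>

lemma sum_exp_s:
  assumes "l \<le> i" "l' \<le> j"
  shows "(\<Sum>n\<in>{- int i..int j}. parity_sign n * (exp_s a s (int l + n) * exp_s a s' (int l' - n))) =
    (-1) ^ l' * exp_comp (odd_series a s - odd_series a s') $ (l + l')"
proof -
  let ?E = "exp_comp (odd_series a s)" and ?E' = "exp_comp (odd_series a s')"
  have odd0: "odd_series a t $ m = 0" if "even m" for t :: "tvar \<Rightarrow> 'r" and m
    using that by (simp add: odd_series_def)
  have "(\<Sum>n\<in>{- int i..int j}. parity_sign n * (exp_s a s (int l + n) * exp_s a s' (int l' - n))) =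
      (\<Sum>n\<in>{- int l..int l'}. parity_sign n * (?E $ nat (int l + n) * ?E' $ nat (int l' - n)))"
    by (rule sum.mono_neutral_cong_right) (use assms in \<open>auto simp: exp_s_def\<close>)
  also have "\<dots> = (\<Sum>k\<in>{0..l + l'}. parity_sign (int k - int l) * (?E $ k * ?E' $ (l + l' - k)))"
  proof (rule sum.reindex_bij_witness[where i = "\<lambda>k. int k - int l" and j = "\<lambda>n. nat (n + int l)"])
    fix n assume "n \<in> {- int l..int l'}"
    then have n: "- int l \<le> n" "n \<le> int l'" by auto
    have "int (nat (n + int l)) - int l = n" "nat (n + int l) = nat (int l + n)"
      "l + l' - nat (n + int l) = nat (int l' - n)" using n by linarith+
    then show "parity_sign (int (nat (n + int l)) - int l) * (?E $ nat (n + int l) * ?E' $ (l + l' - nat (n + int l))) =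
        parity_sign n * (?E $ nat (int l + n) * ?E' $ nat (int l' - n))" by (simp only:)
  qed auto
  also have "\<dots> = (\<Sum>k\<in>{0..l + l'}. (-1) ^ l' * (?E $ k * ((-1) ^ (l + l' - k) * ?E' $ (l + l' - k))))"
  proof (rule sum.cong[OF refl])
    fix k assume "k \<in> {0..l + l'}"
    then have k: "k \<le> l + l'" by simp
    have "even (int k - int l) \<longleftrightarrow> even (l' + (l + l' - k))" using k by presburger
    then have "parity_sign (int k - int l) = (-1 :: 'r) ^ l' * (-1) ^ (l + l' - k)"
      by (simp add: parity_sign_def power_add[symmetric] minus_one_power_iff)
    then show "parity_sign (int k - int l) * (?E $ k * ?E' $ (l + l' - k)) =
        (-1) ^ l' * (?E $ k * ((-1) ^ (l + l' - k) * ?E' $ (l + l' - k)))" by (simp only: mult_ac)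
  qed
  also have "\<dots> = (-1) ^ l' * (?E * Abs_fps (\<lambda>k. (-1) ^ k * ?E' $ k)) $ (l + l')"
    by (simp add: fps_mult_nth sum_distrib_left)
  also have "?E * Abs_fps (\<lambda>k. (-1) ^ k * ?E' $ k) = exp_comp (odd_series a s + - odd_series a s')"
  proof -
    have "Abs_fps (\<lambda>k. (-1) ^ k * ?E' $ k) = exp_comp (- odd_series a s')"
      by (rule exp_comp_odd) (rule odd0)
    moreover have "exp_comp (odd_series a s + - odd_series a s') = ?E * exp_comp (- odd_series a s')"
      by (rule exp_comp_add) (simp_all add: odd0)
    ultimately show ?thesis by (simp only:)
  qed
  finally show ?thesis by simp
qed

text \<open>The sum over all splittings of \<open>d\<close> permits the passage from the target
  weight p to the source weight i = p - n. For fixed i the residue sum over n then involves the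
  exponential coefficients only.\<close>

lemma sum_bilin:
  "(\<Sum>p\<le>d. bilin a f s s' p (d - p)) = (\<Sum>i\<le>d. \<Sum>l\<le>i. \<Sum>l'\<le>d - i.
     (-1) ^ l' * exp_comp (odd_series a s - odd_series a s') $ (l + l') * (ev_D a f s i l * ev_D a f s' (d - i) l'))"
proof -
  define X where "X p n = parity_sign n * (ev \<iota> s p (vertex_op a f n) * ev \<iota> s' (d - p) (vertex_op a f (- n)))" for p n
  have "(\<Sum>p\<le>d. bilin a f s s' p (d - p)) = (\<Sum>p\<le>d. \<Sum>n\<in>{- int (d - p)..int p}. X p n)"
    by (simp add: bilin_def X_def)
  also have "\<dots> = (\<Sum>(p, n) \<in> (SIGMA p:{..d}. {- int (d - p)..int p}). X p n)"
    by (rule sum.Sigma) auto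
  also have "\<dots> = (\<Sum>(i, n) \<in> (SIGMA i:{..d}. {- int i..int (d - i)}). X (nat (int i + n)) n)"
    by (rule sum.reindex_bij_witness[where i = "\<lambda>(i, n). (nat (int i + n), n)" and
          j = "\<lambda>(p, n). (nat (int p - n), n)"]) auto
  also have "\<dots> = (\<Sum>i\<le>d. \<Sum>n\<in>{- int i..int (d - i)}. X (nat (int i + n)) n)"
    by (rule sum.Sigma[symmetric]) auto
  also have "\<dots> = (\<Sum>i\<le>d. \<Sum>l\<le>i. \<Sum>l'\<le>d - i.
     (-1) ^ l' * exp_comp (odd_series a s - odd_series a s') $ (l + l') * (ev_D a f s i l * ev_D a f s' (d - i) l'))"
  proof (rule sum.cong[OF refl])
    fix i assume "i \<in> {..d}"
    then have i: "i \<le> d" by simp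
    let ?N = "{- int i..int (d - i)}"
    let ?g = "\<lambda>n l l'. parity_sign n * (exp_s a s (int l + n) * exp_s a s' (int l' - n)) * (ev_D a f s i l * ev_D a f s' (d - i) l')"
    have "(\<Sum>n\<in>?N. X (nat (int i + n)) n) = (\<Sum>n\<in>?N. \<Sum>l\<le>i. \<Sum>l'\<le>d - i. ?g n l l')"
    proof (rule sum.cong[OF refl])
      fix n assume "n \<in> ?N"
      then have n: "int i + n \<ge> 0" "int (d - i) + - n \<ge> 0" "d - nat (int i + n) = nat (int (d - i) + - n)"
        using i by auto
      show "X (nat (int i + n)) n = (\<Sum>l\<le>i. \<Sum>l'\<le>d - i. ?g n l l')"
        unfolding X_def n(3) ev_vertex_op[OF n(1)] ev_vertex_op[OF n(2)]
        by (simp only: sum_product sum_distrib_left[of "parity_sign _"]) (simp add: mult_ac)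
    qed
    also have "\<dots> = (\<Sum>l\<le>i. \<Sum>n\<in>?N. \<Sum>l'\<le>d - i. ?g n l l')" by (rule sum.swap)
    also have "\<dots> = (\<Sum>l\<le>i. \<Sum>l'\<le>d - i. \<Sum>n\<in>?N. ?g n l l')" by (intro sum.cong refl sum.swap)
    also have "\<dots> = (\<Sum>l\<le>i. \<Sum>l'\<le>d - i. (-1) ^ l' * exp_comp (odd_series a s - odd_series a s') $ (l + l') *
        (ev_D a f s i l * ev_D a f s' (d - i) l'))"
    proof (intro sum.cong refl)
      fix l l' assume "l \<in> {..i}" "l' \<in> {..d - i}"
      then show "(\<Sum>n\<in>?N. ?g n l l') = (-1) ^ l' * exp_comp (odd_series a s - odd_series a s') $ (l + l') *
        (ev_D a f s i l * ev_D a f s' (d - i) l')"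
        by (simp add: sum_exp_s sum_distrib_right[symmetric])
    qed
    finally show "(\<Sum>n\<in>?N. X (nat (int i + n)) n) = (\<Sum>l\<le>i. \<Sum>l'\<le>d - i.
        (-1) ^ l' * exp_comp (odd_series a s - odd_series a s') $ (l + l') *
        (ev_D a f s i l * ev_D a f s' (d - i) l'))" .
  qed
  finally show ?thesis .
qed

text \<open>A grading variable, in which the sum over splittings of the total weight is a
  product.\<close>

definition ev_fps :: "tvar mfps \<Rightarrow> (tvar \<Rightarrow> 'r) \<Rightarrow> 'r fps" where
  "ev_fps f s = Abs_fps (\<lambda>d. ev \<iota> s d f)"

text \<open>At the pole of w the signs combine to (-1)^l' (-\<xi>)^(l + l') = (-\<xi>)^l \<xi>^l',
  so the double sum factors into two Taylor shifts, by -\<xi> in the first copy and by \<xi> in the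
  second. The constant term of the partial fractions is met at l = l' = 0 only and leaves both
  arguments unshifted.\<close>

lemma sum_bilin_residues:
  assumes fin: "finite A" and inj: "inj_on \<xi> A" and nz: "\<And>w. w \<in> A \<Longrightarrow> \<xi> w \<noteq> 0"
    and diff: "\<And>k. s (a, k) - s' (a, k) = - 2 / of_nat (2 * k + 1) * (\<Sum>w\<in>A. \<xi> w ^ (2 * k + 1))"
  shows "(\<Sum>p\<le>d. bilin a f s s' p (d - p)) = (fps_const ((-1) ^ card A) * (ev_fps f s * ev_fps f s') +
    (\<Sum>w\<in>A. fps_const (res_coeff \<xi> A w) * (ev_fps f (\<lambda>v. s v + shift a (- \<xi> w) v) *
      ev_fps f (\<lambda>v. s' v + shift a (\<xi> w) v)))) $ d"
proof -
  let ?c = "\<lambda>K. if K = 0 then (-1) ^ card A else (0 :: 'r)"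
  let ?C = "res_coeff \<xi> A"
  have "odd_series a s - odd_series a s' =
      Abs_fps (\<lambda>m. if odd m then - 2 / of_nat m * (\<Sum>w\<in>A. \<xi> w ^ m) else 0)"
  proof (rule fps_ext)
    fix m
    show "(odd_series a s - odd_series a s') $ m =
      Abs_fps (\<lambda>m. if odd m then - 2 / of_nat m * (\<Sum>w\<in>A. \<xi> w ^ m) else 0) $ m"
    proof (cases "even m")
      case False
      then obtain k where "m = 2 * k + 1" by (auto elim: oddE)
      then show ?thesis using diff[of k] by (simp add: odd_series_def)
    qed (simp add: odd_series_def)
  qed
  then have E: "exp_comp (odd_series a s - odd_series a s') $ K = ?c K + (\<Sum>w\<in>A. ?C w * (- \<xi> w) ^ K)" for K
    by (simp only: exp_comp_log_ratio[OF fin] coeff_prod_ratio[OF fin inj nz])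
  have "(\<Sum>p\<le>d. bilin a f s s' p (d - p)) = (\<Sum>i\<le>d. (-1) ^ card A * (ev \<iota> s i f * ev \<iota> s' (d - i) f) +
      (\<Sum>w\<in>A. ?C w * (ev \<iota> (\<lambda>v. s v + shift a (- \<xi> w) v) i f * ev \<iota> (\<lambda>v. s' v + shift a (\<xi> w) v) (d - i) f)))"
    unfolding sum_bilin
  proof (rule sum.cong[OF refl])
    fix i assume "i \<in> {..d}"
    let ?h = "\<lambda>l l'. ev_D a f s i l * ev_D a f s' (d - i) l'"
    have "(\<Sum>l\<le>i. \<Sum>l'\<le>d - i. (-1) ^ l' * exp_comp (odd_series a s - odd_series a s') $ (l + l') * ?h l l') =
        (\<Sum>l\<le>i. \<Sum>l'\<le>d - i. (-1) ^ l' * ?c (l + l') * ?h l l' +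
          (\<Sum>w\<in>A. ?C w * ((- \<xi> w) ^ l * ev_D a f s i l * (\<xi> w ^ l' * ev_D a f s' (d - i) l'))))"
    proof (intro sum.cong refl)
      fix l l'
      have "(-1) ^ l' * (- \<xi> w) ^ (l + l') = (- \<xi> w) ^ l * \<xi> w ^ l'" for w
        by (simp add: power_add power_mult_distrib[symmetric] mult.left_commute)
      then have "(-1) ^ l' * (?C w * (- \<xi> w) ^ (l + l')) * ?h l l' =
          ?C w * ((- \<xi> w) ^ l * ev_D a f s i l * (\<xi> w ^ l' * ev_D a f s' (d - i) l'))" for w
        by (simp only: mult.assoc mult.left_commute[of "(-1) ^ l'"]) (simp only: mult_ac)
      then show "(-1) ^ l' * exp_comp (odd_series a s - odd_series a s') $ (l + l') * ?h l l' =
          (-1) ^ l' * ?c (l + l') * ?h l l' +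
          (\<Sum>w\<in>A. ?C w * ((- \<xi> w) ^ l * ev_D a f s i l * (\<xi> w ^ l' * ev_D a f s' (d - i) l')))"
        unfolding E by (simp only: distrib_left distrib_right sum_distrib_left sum_distrib_right)
    qed
    also have "\<dots> = (\<Sum>l\<le>i. \<Sum>l'\<le>d - i. (-1) ^ l' * ?c (l + l') * ?h l l') +
        (\<Sum>l\<le>i. \<Sum>l'\<le>d - i. \<Sum>w\<in>A. ?C w * ((- \<xi> w) ^ l * ev_D a f s i l * (\<xi> w ^ l' * ev_D a f s' (d - i) l')))"
      by (simp only: sum.distrib)
    also have "(\<Sum>l\<le>i. \<Sum>l'\<le>d - i. (-1) ^ l' * ?c (l + l') * ?h l l') =
        (\<Sum>l\<in>{0}. \<Sum>l'\<in>{0}. (-1) ^ l' * ?c (l + l') * ?h l l')"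
      by (intro sum.mono_neutral_cong_right) auto
    also have "\<dots> = (-1) ^ card A * (ev \<iota> s i f * ev \<iota> s' (d - i) f)"
      by (simp add: ev_D_0)
    also have "(\<Sum>l\<le>i. \<Sum>l'\<le>d - i. \<Sum>w\<in>A. ?C w * ((- \<xi> w) ^ l * ev_D a f s i l * (\<xi> w ^ l' * ev_D a f s' (d - i) l'))) =
        (\<Sum>l\<le>i. \<Sum>w\<in>A. \<Sum>l'\<le>d - i. ?C w * ((- \<xi> w) ^ l * ev_D a f s i l * (\<xi> w ^ l' * ev_D a f s' (d - i) l')))"
      by (intro sum.cong refl sum.swap)
    also have "\<dots> = (\<Sum>w\<in>A. \<Sum>l\<le>i. \<Sum>l'\<le>d - i. ?C w * ((- \<xi> w) ^ l * ev_D a f s i l * (\<xi> w ^ l' * ev_D a f s' (d - i) l')))"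
      by (rule sum.swap)
    also have "\<dots> = (\<Sum>w\<in>A. ?C w * (ev \<iota> (\<lambda>v. s v + shift a (- \<xi> w) v) i f *
        ev \<iota> (\<lambda>v. s' v + shift a (\<xi> w) v) (d - i) f))"
      by (simp only: sum_ev_D[symmetric] sum_product sum_distrib_left[of "res_coeff \<xi> A _"])
    finally show "(\<Sum>l\<le>i. \<Sum>l'\<le>d - i. (-1) ^ l' * exp_comp (odd_series a s - odd_series a s') $ (l + l') * ?h l l') =
        (-1) ^ card A * (ev \<iota> s i f * ev \<iota> s' (d - i) f) +
        (\<Sum>w\<in>A. ?C w * (ev \<iota> (\<lambda>v. s v + shift a (- \<xi> w) v) i f * ev \<iota> (\<lambda>v. s' v + shift a (\<xi> w) v) (d - i) f))" .
  qed
  also have "\<dots> = (-1) ^ card A * (\<Sum>i\<le>d. ev \<iota> s i f * ev \<iota> s' (d - i) f) +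
      (\<Sum>w\<in>A. ?C w * (\<Sum>i\<le>d. ev \<iota> (\<lambda>v. s v + shift a (- \<xi> w) v) i f * ev \<iota> (\<lambda>v. s' v + shift a (\<xi> w) v) (d - i) f))"
    unfolding sum.distrib sum_distrib_left by (subst sum.swap) (rule refl)
  finally show ?thesis
    by (simp only: fps_add_nth fps_sum_nth fps_mult_left_const_nth)
      (simp only: fps_mult_nth ev_fps_def fps_nth_Abs_fps atLeast0AtMost)
qed

end

section \<open>Homogeneous components\<close>

text \<open>Characteristic 0 qualifies the field of fractions as a target of the evaluation.\<close>

instance mfps :: (type) ring_char_0
proof
  have nth_0: "mfps_nth (of_nat n :: 'a mfps) 0 = of_nat n" for n
    by (induction n) (simp_all add: one_mfps.rep_eq)
  show "inj (of_nat :: nat \<Rightarrow> 'a mfps)"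
  proof (rule injI)
    fix m n assume "(of_nat m :: 'a mfps) = of_nat n"
    then have "mfps_nth (of_nat m :: 'a mfps) 0 = mfps_nth (of_nat n :: 'a mfps) 0" by simp
    then show "m = n" by (simp add: nth_0)
  qed
qed

instance fract :: ("{idom, ring_char_0}") field_char_0
proof
  show "inj (of_nat :: nat \<Rightarrow> 'a fract)"
    by (rule injI) (simp add: Fraction_Field.Fract_of_nat_eq[symmetric] eq_fract)
qed

text \<open>The degree in the variables 1/z, to which \<open>wt\<close> corresponds under the Miwa
  substitution.\<close>

definition deg :: "('v \<Rightarrow>\<^sub>0 nat) \<Rightarrow> nat" where
  "deg \<gamma> = (\<Sum>v\<in>Poly_Mapping.keys \<gamma>. Poly_Mapping.lookup \<gamma> v)"

lemma deg_superset:
  assumes "finite V" "Poly_Mapping.keys \<gamma> \<subseteq> V"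
  shows "deg \<gamma> = (\<Sum>v\<in>V. Poly_Mapping.lookup \<gamma> v)"
  unfolding deg_def by (rule sum.mono_neutral_left) (use assms in \<open>auto simp: in_keys_iff\<close>)

lemma deg_add: "deg (\<alpha> + \<beta>) = deg \<alpha> + deg \<beta>"
  using deg_superset[of "Poly_Mapping.keys \<alpha> \<union> Poly_Mapping.keys \<beta>"]
  by (simp add: keys_plus_nat lookup_add sum.distrib)

definition homogeneous :: "nat \<Rightarrow> 'v mfps \<Rightarrow> bool" where
  "homogeneous d f \<longleftrightarrow> (\<forall>\<gamma>. mfps_nth f \<gamma> \<noteq> 0 \<longrightarrow> deg \<gamma> = d)"

lemma homogeneous_1: "homogeneous 0 1"
  by (auto simp: homogeneous_def one_mfps.rep_eq deg_def)

lemma homogeneous_var: "homogeneous 1 (mfps_var v)"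
  by (auto simp: homogeneous_def mfps_var_def deg_def)

lemma homogeneous_const_mult: "homogeneous d f \<Longrightarrow> homogeneous d (mfps_const c * f)"
  by (auto simp: homogeneous_def)

lemma homogeneous_sum: "(\<And>i. i \<in> A \<Longrightarrow> homogeneous d (f i)) \<Longrightarrow> homogeneous d (sum f A)"
  by (auto simp: homogeneous_def dest: sum.not_neutral_contains_not_neutral)

lemma homogeneous_mult:
  assumes "homogeneous d f" "homogeneous e g"
  shows "homogeneous (d + e) (f * g)"
  unfolding homogeneous_def
proof (intro allI impI)
  fix \<gamma> assume "mfps_nth (f * g) \<gamma> \<noteq> 0"
  then obtain p where "p \<in> {(\<alpha>, \<beta>). \<alpha> + \<beta> = \<gamma>}" "(case p of (\<alpha>, \<beta>) \<Rightarrow> mfps_nth f \<alpha> * mfps_nth g \<beta>) \<noteq> 0"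
    unfolding mfps_nth_times by (rule sum.not_neutral_contains_not_neutral)
  then show "deg \<gamma> = d + e" using assms by (auto simp: homogeneous_def deg_add)
qed

lemma homogeneous_power: "homogeneous d f \<Longrightarrow> homogeneous (n * d) (f ^ n)"
  by (induction n) (auto simp: homogeneous_1 dest: homogeneous_mult)

lemma homogeneous_prod:
  "(\<And>i. i \<in> A \<Longrightarrow> homogeneous (d i) (f i)) \<Longrightarrow> homogeneous (sum d A) (prod f A)"
  by (induction A rule: infinite_finite_induct) (auto simp: homogeneous_1 intro: homogeneous_mult)

lemma homogeneous_mono_val:
  assumes "\<And>v. homogeneous (var_wt v) (s v)"
  shows "homogeneous (wt \<alpha>) (mono_val s \<alpha>)"
  unfolding wt_def mono_val_def by (intro homogeneous_prod homogeneous_power assms)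

definition hcomp :: "nat \<Rightarrow> 'v mfps \<Rightarrow> 'v mfps" where
  "hcomp d f = Abs_mfps (\<lambda>\<gamma>. if deg \<gamma> = d then mfps_nth f \<gamma> else 0)"

lemma mfps_nth_hcomp [simp]: "mfps_nth (hcomp d f) \<gamma> = (if deg \<gamma> = d then mfps_nth f \<gamma> else 0)"
  by (simp add: hcomp_def)

text \<open>A monomial of weight d becomes homogeneous of degree d, so only the finitely many
  monomials of weight \<open>deg \<gamma>\<close> can contribute at \<gamma>.\<close>

lemma hcomp_subst:
  assumes "\<And>v. homogeneous (var_wt v) (s v)"
  shows "hcomp d (mfps_subst s f) = (\<Sum>\<alpha> | wt \<alpha> = d. mfps_const (mfps_nth f \<alpha>) * mono_val s \<alpha>)"
proof (rule mfps_eqI)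
  fix \<gamma>
  have nz: "mfps_nth (mono_val s \<alpha>) \<gamma> = 0" if "wt \<alpha> \<noteq> deg \<gamma>" for \<alpha>
    using homogeneous_mono_val[of s \<alpha>, OF assms] that unfolding homogeneous_def by metis
  have "mfps_nth (mfps_subst s f) \<gamma> =
      (\<Sum>\<alpha> | wt \<alpha> = deg \<gamma>. mfps_nth (mfps_const (mfps_nth f \<alpha>) * mono_val s \<alpha>) \<gamma>)"
    unfolding mfps_subst_def mono_val_def[symmetric]
    by (rule mfps_nth_mfps_sum) (simp_all add: nz)
  then show "mfps_nth (hcomp d (mfps_subst s f)) \<gamma> =
      mfps_nth (\<Sum>\<alpha> | wt \<alpha> = d. mfps_const (mfps_nth f \<alpha>) * mono_val s \<alpha>) \<gamma>"
    by (auto simp: nz intro!: sum.neutral[symmetric])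
qed

lemma hcomp_mult:
  fixes f g :: "'v mfps"
  shows "hcomp d (f * g) = (\<Sum>j\<le>d. hcomp j f * hcomp (d - j) g)"
proof (rule mfps_eqI)
  fix \<gamma> :: "'v \<Rightarrow>\<^sub>0 nat"
  let ?D = "{(\<alpha>, \<beta>). \<alpha> + \<beta> = \<gamma>}"
  have "mfps_nth (\<Sum>j\<le>d. hcomp j f * hcomp (d - j) g) \<gamma> =
      (\<Sum>p\<in>?D. \<Sum>j\<le>d. mfps_nth (hcomp j f) (fst p) * mfps_nth (hcomp (d - j) g) (snd p))"
    by (simp only: mfps_nth_sum mfps_nth_times case_prod_unfold) (rule sum.swap)
  also have "\<dots> = (\<Sum>p\<in>?D. if deg \<gamma> = d then mfps_nth f (fst p) * mfps_nth g (snd p) else 0)"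
  proof (rule sum.cong[OF refl])
    fix p assume "p \<in> ?D"
    then have dg: "deg \<gamma> = deg (fst p) + deg (snd p)" by (auto simp: deg_add)
    have "(\<Sum>j\<le>d. mfps_nth (hcomp j f) (fst p) * mfps_nth (hcomp (d - j) g) (snd p)) =
        (\<Sum>j\<le>d. if j = deg (fst p) then (if deg \<gamma> = d then mfps_nth f (fst p) * mfps_nth g (snd p) else 0) else 0)"
      by (intro sum.cong refl) (auto simp: dg)
    also have "\<dots> = (if deg \<gamma> = d then mfps_nth f (fst p) * mfps_nth g (snd p) else 0)"
      by (auto simp: dg)
    finally show "(\<Sum>j\<le>d. mfps_nth (hcomp j f) (fst p) * mfps_nth (hcomp (d - j) g) (snd p)) =
        (if deg \<gamma> = d then mfps_nth f (fst p) * mfps_nth g (snd p) else 0)" .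
  qed
  also have "\<dots> = mfps_nth (hcomp d (f * g)) \<gamma>"
    by (simp add: mfps_nth_times case_prod_unfold)
  finally show "mfps_nth (hcomp d (f * g)) \<gamma> = mfps_nth (\<Sum>j\<le>d. hcomp j f * hcomp (d - j) g) \<gamma>" ..
qed

lemma mfps_nth_mult_hcomp:
  fixes f g :: "'v mfps"
  shows "mfps_nth (f * g) \<gamma> = (\<Sum>d\<le>deg \<gamma>. mfps_nth (f * hcomp d g) \<gamma>)"
proof -
  let ?D = "{(\<alpha>, \<beta>). \<alpha> + \<beta> = \<gamma>}"
  have "(\<Sum>d\<le>deg \<gamma>. mfps_nth (f * hcomp d g) \<gamma>) =
      (\<Sum>p\<in>?D. \<Sum>d\<le>deg \<gamma>. mfps_nth f (fst p) * mfps_nth (hcomp d g) (snd p))"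
    unfolding mfps_nth_times case_prod_unfold by (rule sum.swap)
  also have "\<dots> = (\<Sum>p\<in>?D. mfps_nth f (fst p) * mfps_nth g (snd p))"
  proof (rule sum.cong[OF refl])
    fix p assume "p \<in> ?D"
    then have "deg (snd p) \<le> deg \<gamma>" by (auto simp: deg_add)
    then show "(\<Sum>d\<le>deg \<gamma>. mfps_nth f (fst p) * mfps_nth (hcomp d g) (snd p)) =
        mfps_nth f (fst p) * mfps_nth g (snd p)"
      by (simp add: if_distrib cong: if_cong)
  qed
  finally show ?thesis by (simp add: mfps_nth_times case_prod_unfold)
qed

section \<open>The field of fractions\<close>

interpretation to_frac: inj_comm_ring_hom to_frac
  by unfold_locales (auto simp: to_frac_def Fract_def[symmetric] One_fract_def Zero_fract_def eq_fract)

lemma mfps_nth_const: "mfps_nth (mfps_const c) \<alpha> = (if \<alpha> = 0 then c else 0)"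
  by (simp add: mfps_const_def)

lemma mfps_const_hom:
  "mfps_const 0 = 0" "mfps_const 1 = 1" "mfps_const (c + d) = mfps_const c + mfps_const d"
  "mfps_const (c * d) = mfps_const c * mfps_const d"
  by (rule mfps_eqI, simp add: mfps_nth_const one_mfps.rep_eq)+

interpretation scalar: complex_hom_field scalar
  by unfold_locales (simp_all add: scalar_def mfps_const_hom to_frac.hom_add to_frac.hom_mult)

lemma common_denominator:
  fixes c :: "'i \<Rightarrow> zvar mfps fract"
  assumes "finite I"
  shows "\<exists>D n. D \<noteq> 0 \<and> (\<forall>i\<in>I. c i * to_frac D = to_frac (n i))"
  using assms
proof (induction I rule: finite_induct)
  case (insert i I)
  then obtain D n where D: "D \<noteq> 0" "\<And>i. i \<in> I \<Longrightarrow> c i * to_frac D = to_frac (n i)" by blast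
  obtain a b where ab: "c i = Fraction_Field.Fract a b" "b \<noteq> 0" by (cases "c i") auto
  have "c i * to_frac (D * b) = to_frac (a * D)"
    using ab by (simp add: to_frac_def eq_fract)
  moreover have "c j * to_frac (D * b) = to_frac (n j * b)" if "j \<in> I" for j
    by (simp add: to_frac.hom_mult D(2)[OF that, symmetric] mult.assoc)
  ultimately have "\<forall>j\<in>insert i I. c j * to_frac (D * b) = to_frac ((if j = i then a * D else n j * b))"
    by auto
  moreover have "D * b \<noteq> 0" using ab D by simp
  ultimately show ?case by (intro exI[of _ "D * b"] exI[of _ "\<lambda>j. if j = i then a * D else n j * b"]) blast
qed (auto intro: exI[of _ 1])

text \<open>The coefficients are fractions, and infinitely many degrees cannot be added up in the
  field of fractions. After a common denominator is cleared, each coefficient of the sum involves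
  finitely many components.\<close>

lemma sum_eq_0_of_hcomp:
  fixes c :: "'i \<Rightarrow> zvar mfps fract"
  assumes "finite I" and hc: "\<And>d. (\<Sum>i\<in>I. c i * to_frac (hcomp d (P i))) = 0"
  shows "(\<Sum>i\<in>I. c i * to_frac (P i)) = 0"
proof -
  obtain D n where D: "D \<noteq> 0" "\<And>i. i \<in> I \<Longrightarrow> c i * to_frac D = to_frac (n i)"
    using common_denominator[OF assms(1), of c] by blast
  have frac: "to_frac D * (\<Sum>i\<in>I. c i * to_frac (g i)) = to_frac (\<Sum>i\<in>I. n i * g i)" for g
    unfolding sum_distrib_left to_frac.hom_sum to_frac.hom_mult
    by (intro sum.cong refl) (simp add: D(2)[symmetric] mult_ac)
  have 0: "(\<Sum>i\<in>I. n i * hcomp d (P i)) = 0" for d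
    using frac[of "\<lambda>i. hcomp d (P i)"] hc[of d] by simp
  have "(\<Sum>i\<in>I. n i * P i) = 0"
  proof (rule mfps_eqI)
    fix \<gamma>
    have "mfps_nth (\<Sum>i\<in>I. n i * P i) \<gamma> = (\<Sum>d\<le>deg \<gamma>. mfps_nth (\<Sum>i\<in>I. n i * hcomp d (P i)) \<gamma>)"
      unfolding mfps_nth_sum mfps_nth_mult_hcomp[of _ "P _"] by (rule sum.swap)
    then show "mfps_nth (\<Sum>i\<in>I. n i * P i) \<gamma> = mfps_nth 0 \<gamma>" by (simp only: 0 mfps_nth_0 sum.neutral_const)
  qed
  then have "to_frac D * (\<Sum>i\<in>I. c i * to_frac (P i)) = 0" by (simp only: frac to_frac.hom_zero)
  then show ?thesis using D(1) by simp
qed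

section \<open>The Fay identity\<close>

definition zinv :: "zvar \<Rightarrow> zvar mfps fract" where
  "zinv u = to_frac (mfps_var u)"

lemma mfps_nth_var: "mfps_nth (mfps_var u) (Poly_Mapping.single v 1) = (if u = v then 1 else 0)"
proof -
  have "u = v" if "Poly_Mapping.single v (1 :: nat) = Poly_Mapping.single u 1"
    using arg_cong[OF that, of "\<lambda>p. Poly_Mapping.lookup p v"]
    by (simp add: lookup_single when_def split: if_splits)
  then show ?thesis by (auto simp: mfps_var_def)
qed

lemma zinv_neq_0: "zinv u \<noteq> 0"
proof
  assume "zinv u = 0"
  then have "mfps_nth (mfps_var u) (Poly_Mapping.single u 1) = 0" by (simp add: zinv_def)
  then show False by (simp only: mfps_nth_var) simp
qed

text \<open>Besides the denominators, this keeps the points of the partial fractions distinct, one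
  of which is negated.\<close>

lemma zinv_neq_uminus: "zinv u \<noteq> - zinv v"
proof
  assume "zinv u = - zinv v"
  then have "to_frac (mfps_var u + mfps_var v) = 0" by (simp add: zinv_def to_frac.hom_add)
  then have "mfps_nth (mfps_var u + mfps_var v) (Poly_Mapping.single u 1) = 0" by simp
  then show False by (simp only: mfps_nth_add mfps_nth_var) (simp split: if_splits)
qed

lemma zinv_eq_iff: "zinv u = zinv v \<longleftrightarrow> u = v"
proof
  assume "zinv u = zinv v"
  then have "mfps_nth (mfps_var u) (Poly_Mapping.single u 1) = mfps_nth (mfps_var v) (Poly_Mapping.single u 1)"
    by (simp add: zinv_def)
  then show "u = v" by (simp only: mfps_nth_var) (simp split: if_splits)
qed simp

text \<open>Indexed by a set, since the points are distinct and their order is immaterial; the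
  component is part of the point.\<close>

definition miwa_point :: "zvar set \<Rightarrow> tvar \<Rightarrow> zvar mfps" where
  "miwa_point U v = mfps_const (- 2 / of_nat (var_wt v)) * (\<Sum>u | u \<in> U \<and> fst u = fst v. mfps_var u ^ var_wt v)"

definition miwa_set :: "tvar mfps \<Rightarrow> zvar set \<Rightarrow> zvar mfps" where
  "miwa_set f U = mfps_subst (miwa_point U) f"

lemma ev_miwa_point: "ev scalar (\<lambda>v. to_frac (miwa_point U v)) d f = to_frac (hcomp d (miwa_set f U))"
proof -
  have "homogeneous (var_wt v) (miwa_point U v)" for v
    unfolding miwa_point_def
    using homogeneous_power[OF homogeneous_var, of "var_wt v"]
    by (intro homogeneous_const_mult homogeneous_sum) simp
  then show ?thesis
    unfolding miwa_set_def by (subst hcomp_subst)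
      (simp_all add: ev_def scalar_def mono_val_def to_frac.hom_sum to_frac.hom_mult to_frac.hom_prod to_frac.hom_power)
qed

lemma scalar_minus_two: "scalar (- 2 / of_nat m) = - 2 / of_nat m" if "m \<noteq> 0"
proof -
  have "scalar (- 2 / of_nat m) * of_nat m = scalar (- 2 / of_nat m * of_nat m)"
    by (simp only: scalar.hom_mult scalar.hom_of_nat)
  also have "\<dots> = - 2" using that by (simp add: scalar.hom_uminus scalar.hom_numeral)
  finally show ?thesis using that by (simp add: field_simps)
qed

lemma to_frac_miwa_point:
  "to_frac (miwa_point U v) = scalar (- 2 / of_nat (var_wt v)) * (\<Sum>u | u \<in> U \<and> fst u = fst v. zinv u ^ var_wt v)"
  by (simp only: miwa_point_def zinv_def scalar_def to_frac.hom_mult to_frac.hom_sum to_frac.hom_power)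

lemma miwa_point_insert:
  assumes "finite U" "u \<notin> U"
  shows "to_frac (miwa_point (insert u U) v) = to_frac (miwa_point U v) + scalar.shift (fst u) (zinv u) v"
proof (cases "fst u = fst v")
  case True
  have "{w. w \<in> insert u U \<and> fst w = fst v} = insert u {w. w \<in> U \<and> fst w = fst v}" using True by auto
  then show ?thesis
    using assms True unfolding to_frac_miwa_point scalar.shift_def by (simp add: distrib_left add.commute)
next
  case False
  then have "{w. w \<in> insert u U \<and> fst w = fst v} = {w. w \<in> U \<and> fst w = fst v}" by auto
  then show ?thesis using False by (simp add: to_frac_miwa_point scalar.shift_def)
qed

lemma shift_uminus: "scalar.shift a (- y) v = - scalar.shift a y v"
  by (simp add: scalar.shift_def)

definition comp_sgn :: "comp \<Rightarrow> zvar mfps fract" where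
  "comp_sgn a = (case a of Comp1 \<Rightarrow> 1 | Comp2 \<Rightarrow> -1)"

definition fay_point :: "zvar \<Rightarrow> zvar \<Rightarrow> zvar mfps fract" where
  "fay_point w0 w = (if w = w0 then - zinv w else zinv w)"

definition same_comp :: "zvar set \<Rightarrow> comp \<Rightarrow> zvar set" where
  "same_comp A a = {w \<in> A. fst w = a}"

text \<open>
  The bilinear identity at \<open>t' = - \<Sum>\<^sub>w [z\<^sub>w\<^bsup>-1\<^esup>]\<close> (sum over \<open>w \<noteq> w\<^sub>0\<close>) and \<open>t'' = - [z\<^bsub>w\<^sub>0\<^esub>\<^bsup>-1\<^esup>]\<close>;
  the residues at infinity of the two components cancel.
\<close>

lemma fay_identity:
  assumes tau: "tau_function_2BKP \<tau>" and fin: "finite A" and w0: "w0 \<in> A" and even: "even (card A)"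
  shows "(\<Sum>w\<in>A. comp_sgn (fst w) * res_coeff (fay_point w0) (same_comp A (fst w)) w *
    to_frac (miwa_set \<tau> (if w = w0 then A else A - {w0, w}) * miwa_set \<tau> (if w = w0 then {} else {w0, w}))) = 0"
proof (rule sum_eq_0_of_hcomp[OF fin])
  fix d
  let ?\<xi> = "fay_point w0"
  define s where "s U v = to_frac (miwa_point U v)" for U v
  let ?R = "\<lambda>a w. fps_const (res_coeff ?\<xi> (same_comp A a) w) *
      (scalar.ev_fps \<tau> (\<lambda>v. s (A - {w0}) v + scalar.shift a (- ?\<xi> w) v) *
       scalar.ev_fps \<tau> (\<lambda>v. s {w0} v + scalar.shift a (?\<xi> w) v))"
  define T where "T w = miwa_set \<tau> (if w = w0 then A else A - {w0, w}) * miwa_set \<tau> (if w = w0 then {} else {w0, w})" for w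
  have finS: "finite (same_comp A a)" for a using fin by (simp add: same_comp_def)
  have "a = Comp1 \<or> a = Comp2" for a by (cases a) auto
  then have A: "A = same_comp A Comp1 \<union> same_comp A Comp2" unfolding same_comp_def by blast
  have disj: "same_comp A Comp1 \<inter> same_comp A Comp2 = {}" by (auto simp: same_comp_def)
  have "card A = card (same_comp A Comp1) + card (same_comp A Comp2)"
    using disj by (subst A) (simp add: card_Un_disjoint finS)
  then have par: "(-1 :: zvar mfps fract) ^ card (same_comp A Comp1) = (-1) ^ card (same_comp A Comp2)"
    using even by (simp add: minus_one_power_iff)
  have bil: "(\<Sum>p\<le>d. scalar.bilin a \<tau> (s (A - {w0})) (s {w0}) p (d - p)) =
      (fps_const ((-1) ^ card (same_comp A a)) * (scalar.ev_fps \<tau> (s (A - {w0})) * scalar.ev_fps \<tau> (s {w0})) +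
       (\<Sum>w\<in>same_comp A a. ?R a w)) $ d" for a
  proof (rule scalar.sum_bilin_residues[OF finS])
    show "inj_on ?\<xi> (same_comp A a)"
    proof (rule inj_onI)
      fix u v assume "?\<xi> u = ?\<xi> v"
      then show "u = v"
        unfolding fay_point_def by (metis zinv_eq_iff zinv_neq_uminus)
    qed
    show "?\<xi> w \<noteq> 0" for w by (simp add: fay_point_def zinv_neq_0)
    fix k
    have U: "{u. u \<in> A - {w0} \<and> fst u = a} = same_comp A a - {w0}" by (auto simp: same_comp_def)
    have "(\<Sum>u | u \<in> A - {w0} \<and> fst u = a. zinv u ^ (2 * k + 1)) -
        (\<Sum>u | u \<in> {w0} \<and> fst u = a. zinv u ^ (2 * k + 1)) = (\<Sum>w\<in>same_comp A a. ?\<xi> w ^ (2 * k + 1))"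
    proof (cases "fst w0 = a")
      case True
      then have W: "{u. u \<in> {w0} \<and> fst u = a} = {w0}" "w0 \<in> same_comp A a" using w0 by (auto simp: same_comp_def)
      have "(\<Sum>w\<in>same_comp A a. ?\<xi> w ^ (2 * k + 1)) =
          ?\<xi> w0 ^ (2 * k + 1) + (\<Sum>w\<in>same_comp A a - {w0}. ?\<xi> w ^ (2 * k + 1))"
        by (rule sum.remove[OF finS W(2)])
      also have "(\<Sum>w\<in>same_comp A a - {w0}. ?\<xi> w ^ (2 * k + 1)) = (\<Sum>w\<in>same_comp A a - {w0}. zinv w ^ (2 * k + 1))"
        by (rule sum.cong) (auto simp: fay_point_def)
      finally show ?thesis unfolding U W(1) by (simp add: fay_point_def)
    next
      case False
      then have W: "{u. u \<in> {w0} \<and> fst u = a} = {}" "same_comp A a - {w0} = same_comp A a"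
        by (auto simp: same_comp_def)
      have "(\<Sum>w\<in>same_comp A a. ?\<xi> w ^ (2 * k + 1)) = (\<Sum>w\<in>same_comp A a. zinv w ^ (2 * k + 1))"
        by (rule sum.cong) (use W(2) in \<open>auto simp: fay_point_def\<close>)
      then show ?thesis unfolding U W by simp
    qed
    then show "s (A - {w0}) (a, k) - s {w0} (a, k) = - 2 / of_nat (2 * k + 1) * (\<Sum>w\<in>same_comp A a. ?\<xi> w ^ (2 * k + 1))"
      unfolding s_def to_frac_miwa_point fst_conv snd_conv
      using scalar_minus_two[of "2 * k + 1"] by (simp only: right_diff_distrib[symmetric])
  qed
  \<comment> \<open>A pole w other than w0 moves w from the first argument to the second. Since
    \<open>fay_point w0 w0\<close> is negated, the pole of w0 moves w0 from the second to the first,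
    which produces the arguments \<open>A\<close> and \<open>{}\<close>.\<close>
  have hc: "to_frac (hcomp d (T w)) = (scalar.ev_fps \<tau> (\<lambda>v. s (A - {w0}) v + scalar.shift (fst w) (- ?\<xi> w) v) *
       scalar.ev_fps \<tau> (\<lambda>v. s {w0} v + scalar.shift (fst w) (?\<xi> w) v)) $ d" if w: "w \<in> A" for w
  proof -
    have "s (A - {w0}) v + scalar.shift (fst w) (- ?\<xi> w) v = s (if w = w0 then A else A - {w0, w}) v" for v
    proof (cases "w = w0")
      case True
      then show ?thesis using miwa_point_insert[of "A - {w0}" w0 v] fin w0
        by (simp add: s_def fay_point_def insert_absorb)
    next
      case False
      have "insert w (A - {w0, w}) = A - {w0}" using w False by auto
      then show ?thesis using miwa_point_insert[of "A - {w0, w}" w v] fin False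
        by (simp add: s_def fay_point_def shift_uminus)
    qed
    moreover have "s {w0} v + scalar.shift (fst w) (?\<xi> w) v = s (if w = w0 then {} else {w0, w}) v" for v
      using miwa_point_insert[of "{w0}" w v] miwa_point_insert[of "{}" w0 v]
      by (auto simp: s_def fay_point_def shift_uminus insert_commute)
    ultimately show ?thesis
      unfolding T_def hcomp_mult to_frac.hom_sum to_frac.hom_mult
      by (simp only: scalar.ev_fps_def fps_mult_nth fps_nth_Abs_fps s_def ev_miwa_point atLeast0AtMost)
  qed
  have sums: "(\<Sum>w\<in>same_comp A a. ?R a w) $ d =
      (\<Sum>w\<in>same_comp A a. res_coeff ?\<xi> (same_comp A (fst w)) w * to_frac (hcomp d (T w)))" for a
    unfolding fps_sum_nth
  proof (rule sum.cong[OF refl])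
    fix w assume "w \<in> same_comp A a"
    then have w: "w \<in> A" "fst w = a" by (auto simp: same_comp_def)
    show "?R a w $ d = res_coeff ?\<xi> (same_comp A (fst w)) w * to_frac (hcomp d (T w))"
      unfolding hc[OF w(1)] w(2) by (rule fps_mult_left_const_nth)
  qed
  have eq: "(\<Sum>w\<in>same_comp A Comp1. res_coeff ?\<xi> (same_comp A (fst w)) w * to_frac (hcomp d (T w))) =
      (\<Sum>w\<in>same_comp A Comp2. res_coeff ?\<xi> (same_comp A (fst w)) w * to_frac (hcomp d (T w)))"
    using bil[of Comp1] bil[of Comp2] scalar.bilin_tau[OF tau] par
    unfolding fps_add_nth sums by simp
  have "(\<Sum>w\<in>A. comp_sgn (fst w) * res_coeff ?\<xi> (same_comp A (fst w)) w * to_frac (hcomp d (T w))) =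
      (\<Sum>w\<in>same_comp A Comp1. comp_sgn (fst w) * res_coeff ?\<xi> (same_comp A (fst w)) w * to_frac (hcomp d (T w))) +
      (\<Sum>w\<in>same_comp A Comp2. comp_sgn (fst w) * res_coeff ?\<xi> (same_comp A (fst w)) w * to_frac (hcomp d (T w)))"
    by (subst A, rule sum.union_disjoint) (simp_all add: finS disj)
  also have "\<dots> = (\<Sum>w\<in>same_comp A Comp1. res_coeff ?\<xi> (same_comp A (fst w)) w * to_frac (hcomp d (T w))) +
      (\<Sum>w\<in>same_comp A Comp2. - (res_coeff ?\<xi> (same_comp A (fst w)) w * to_frac (hcomp d (T w))))"
    by (intro arg_cong2[of _ _ _ _ "(+)"] sum.cong refl) (auto simp: comp_sgn_def same_comp_def)
  also have "\<dots> = 0" unfolding eq sum_negf by simp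
  finally show "(\<Sum>w\<in>A. comp_sgn (fst w) * res_coeff ?\<xi> (same_comp A (fst w)) w * to_frac (hcomp d
      (miwa_set \<tau> (if w = w0 then A else A - {w0, w}) * miwa_set \<tau> (if w = w0 then {} else {w0, w})))) = 0"
    unfolding T_def .
qed

section \<open>Signs\<close>

text \<open>
  Between points of different components, \<open>pair_ratio\<close> contributes the sign of the permutation that
  moves the points of the first component to the front.  \<open>phase U\<close> is \<open>\<i>\<close> to the power \<open>n\<^sup>2\<close>, where \<open>n\<close> is
  the number of points of the first component.
\<close>

definition pair_ratio :: "zvar \<Rightarrow> zvar \<Rightarrow> zvar mfps fract" where
  "pair_ratio u v = (if fst u = fst v then (zinv v - zinv u) / (zinv u + zinv v) else comp_sgn (fst u))"

definition phase :: "zvar set \<Rightarrow> zvar mfps fract" where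
  "phase U = (if even (card (same_comp U Comp1)) then 1 else scalar \<i>)"

lemma scalar_ii: "scalar \<i> * scalar \<i> = - 1"
  by (simp add: scalar.hom_mult[symmetric] scalar.hom_uminus)

lemma comp_sgn_mult_self: "comp_sgn a * comp_sgn a = 1"
  by (cases a) (simp_all add: comp_sgn_def)

lemma comp_sgn_neq: "a \<noteq> b \<Longrightarrow> comp_sgn b = - comp_sgn a"
  by (cases a; cases b) (simp_all add: comp_sgn_def)

lemma comp_sgn_power: "comp_sgn a ^ n = (if even n then 1 else comp_sgn a)"
  by (cases a) (simp_all add: comp_sgn_def minus_one_power_iff)

lemma comp_sgn_inverse: "inverse (comp_sgn a) = comp_sgn a"
  by (cases a) (simp_all add: comp_sgn_def)

lemma pair_ratio_skew: "pair_ratio v u = - pair_ratio u v"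
proof (cases "fst u = fst v")
  case True
  then show ?thesis by (simp add: pair_ratio_def minus_divide_left add.commute)
next
  case False
  then show ?thesis using comp_sgn_neq[OF False] by (simp add: pair_ratio_def)
qed

lemma zinv_add_neq_0: "zinv u + zinv v \<noteq> 0"
  using zinv_neq_uminus[of u v] by (simp add: eq_neg_iff_add_eq_0)

lemma pair_ratio_neq_0: "u \<noteq> v \<Longrightarrow> pair_ratio u v \<noteq> 0"
  using zinv_add_neq_0[of u v] zinv_eq_iff[of v u] comp_sgn_mult_self[of "fst u"]
  by (auto simp: pair_ratio_def)

section \<open>The residues in terms of pair ratios\<close>

text \<open>The negated point exchanges sums and differences, so the pair ratios themselves appear;
  at the other poles it is their inverses.\<close>

lemma res_coeff_first:
  assumes "finite S" "w0 \<in> S" "\<And>v. v \<in> S \<Longrightarrow> fst v = fst w0"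
  shows "res_coeff (fay_point w0) S w0 = 2 * (-1) ^ (card S - 1) * (\<Prod>v\<in>S - {w0}. pair_ratio w0 v)"
proof -
  have "(fay_point w0 w0 + fay_point w0 v) / (fay_point w0 w0 - fay_point w0 v) = - pair_ratio w0 v"
    if "v \<in> S - {w0}" for v
  proof -
    have "(- zinv w0 + zinv v) / (- zinv w0 - zinv v) = - ((zinv v - zinv w0) / (zinv w0 + zinv v))"
      unfolding minus_divide_right by (intro arg_cong2[of _ _ _ _ "(/)"]) simp_all
    then show ?thesis using that assms(3)[of v] by (simp add: fay_point_def pair_ratio_def)
  qed
  then have "(\<Prod>v\<in>S - {w0}. (fay_point w0 w0 + fay_point w0 v) / (fay_point w0 w0 - fay_point w0 v)) =
      (\<Prod>v\<in>S - {w0}. - pair_ratio w0 v)" by (rule prod.cong[OF refl])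
  then show ?thesis using assms(1,2) by (simp add: res_coeff_def prod_uminus mult.assoc)
qed

lemma fay_point_ratio:
  assumes "w \<noteq> w0" "v \<noteq> w0" "fst v = fst w"
  shows "(fay_point w0 w + fay_point w0 v) / (fay_point w0 w - fay_point w0 v) = - inverse (pair_ratio w v)"
proof -
  have "(zinv w + zinv v) / (zinv w - zinv v) = - ((zinv w + zinv v) / (zinv v - zinv w))"
    by (simp only: minus_divide_right minus_diff_eq)
  then show ?thesis using assms by (simp add: fay_point_def pair_ratio_def)
qed

text \<open>The factor of \<open>w0\<close> is a pair ratio; the other \<open>card S - 2\<close>
  factors are negated inverses, and their sign is (-1)^(card S).\<close>

lemma res_coeff_same:
  assumes "finite S" "w0 \<in> S" "w \<in> S" "w \<noteq> w0" "\<And>v. v \<in> S \<Longrightarrow> fst v = fst w0"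
  shows "res_coeff (fay_point w0) S w =
    2 * (-1) ^ card S * pair_ratio w0 w * inverse (\<Prod>v\<in>S - {w0, w}. pair_ratio w v)"
proof -
  let ?g = "\<lambda>v. (fay_point w0 w + fay_point w0 v) / (fay_point w0 w - fay_point w0 v)"
  have w: "fst w = fst w0" by (rule assms(5)[OF assms(3)])
  have card: "card S = Suc (Suc (card (S - {w0, w})))"
    using card_Diff_subset[of "{w0, w}" S] card_mono[of S "{w0, w}"] assms(1-4) by simp
  have S: "S - {w} - {w0} = S - {w0, w}" by auto
  have "(\<Prod>v\<in>S - {w}. ?g v) = ?g w0 * (\<Prod>v\<in>S - {w} - {w0}. ?g v)"
    by (rule prod.remove) (use assms(1-4) in auto)
  also have "?g w0 = pair_ratio w0 w"
    using assms(4) w by (simp add: fay_point_def pair_ratio_def add.commute)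
  also have "(\<Prod>v\<in>S - {w} - {w0}. ?g v) = (\<Prod>v\<in>S - {w0, w}. - inverse (pair_ratio w v))"
    unfolding S
  proof (rule prod.cong[OF refl])
    fix v assume v: "v \<in> S - {w0, w}"
    then have "fst v = fst w" using assms(5)[of v] w by simp
    with v show "?g v = - inverse (pair_ratio w v)" by (intro fay_point_ratio[OF assms(4)]) auto
  qed
  also have "\<dots> = (-1) ^ card S * inverse (\<Prod>v\<in>S - {w0, w}. pair_ratio w v)"
    by (simp add: card prod_uminus prod_inversef[symmetric] o_def)
  finally show ?thesis by (simp add: res_coeff_def mult_ac)
qed

text \<open>Here \<open>w0\<close> lies in the other component, so all \<open>card S - 1\<close>
  factors are negated inverses.\<close>

lemma res_coeff_other:
  assumes "finite S" "w0 \<notin> S" "w \<in> S" "\<And>v. v \<in> S \<Longrightarrow> fst v = fst w"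
  shows "res_coeff (fay_point w0) S w = 2 * (-1) ^ (card S - 1) * inverse (\<Prod>v\<in>S - {w}. pair_ratio w v)"
proof -
  have "(\<Prod>v\<in>S - {w}. (fay_point w0 w + fay_point w0 v) / (fay_point w0 w - fay_point w0 v)) =
      (\<Prod>v\<in>S - {w}. - inverse (pair_ratio w v))"
  proof (rule prod.cong[OF refl])
    fix v assume v: "v \<in> S - {w}"
    then have "fst v = fst w" using assms(4)[of v] by simp
    moreover have "w \<noteq> w0" "v \<noteq> w0" using v assms(2,3) by auto
    ultimately show "(fay_point w0 w + fay_point w0 v) / (fay_point w0 w - fay_point w0 v) = - inverse (pair_ratio w v)"
      by (intro fay_point_ratio)
  qed
  then show ?thesis using assms(1-3)
    by (simp add: res_coeff_def prod_uminus prod_inversef[symmetric] o_def mult.assoc)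
qed

lemma prod_pair_ratio_cross:
  assumes "\<And>v. v \<in> S \<Longrightarrow> fst v \<noteq> fst w"
  shows "(\<Prod>v\<in>S. pair_ratio w v) = comp_sgn (fst w) ^ card S"
proof -
  have "(\<Prod>v\<in>S. pair_ratio w v) = (\<Prod>v\<in>S. comp_sgn (fst w))"
  proof (rule prod.cong[OF refl])
    fix v assume "v \<in> S"
    then have "fst w \<noteq> fst v" using assms by metis
    then show "pair_ratio w v = comp_sgn (fst w)" by (simp add: pair_ratio_def)
  qed
  then show ?thesis by simp
qed

text \<open>In a set of even size both components have the same parity, so the phase can be read off
  the component of any point \<open>w\<close>. In the uses \<open>k\<close> is the number of points
  removed from \<open>m\<close>.\<close>

lemma phase_eq:
  assumes "finite U" "card (same_comp U (fst w)) + k = m" "even (card U)"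
  shows "phase U = (if even m = even k then 1 else scalar \<i>)"
proof -
  have "same_comp U Comp1 \<union> same_comp U Comp2 = U"
  proof -
    have "a = Comp1 \<or> a = Comp2" for a by (cases a) auto
    then show ?thesis unfolding same_comp_def by blast
  qed
  moreover have "same_comp U Comp1 \<inter> same_comp U Comp2 = {}" by (auto simp: same_comp_def)
  ultimately have "card U = card (same_comp U Comp1) + card (same_comp U Comp2)"
    using assms(1) by (metis card_Un_disjoint finite_Un)
  then have "even (card (same_comp U Comp1)) \<longleftrightarrow> even (card (same_comp U (fst w)))"
    using assms(3) by (cases "fst w") auto
  then show ?thesis using assms(2) by (auto simp: phase_def)
qed

text \<open>The Fay identity divided by a common factor \<open>c\<close>: its coefficient at
  \<open>w0\<close> is \<open>c\<close> times the one on the left, and at every other point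
  \<open>- c\<close> times the one on the right. The cases are the parity of the component of
  \<open>w0\<close> and whether \<open>w\<close> belongs to it.\<close>

lemma pfaffian_fay:
  assumes tau: "tau_function_2BKP \<tau>" and fin: "finite A" and w0: "w0 \<in> A" and ev: "even (card A)"
  shows "phase A * (\<Prod>v\<in>A - {w0}. pair_ratio w0 v) * to_frac (miwa_set \<tau> A * miwa_set \<tau> {}) =
    (\<Sum>w\<in>A - {w0}. pair_ratio w0 w * phase {w0, w} * phase (A - {w0, w}) *
      inverse (\<Prod>v\<in>A - {w0, w}. pair_ratio w v) * to_frac (miwa_set \<tau> (A - {w0, w}) * miwa_set \<tau> {w0, w}))"
    (is "?lhs * ?one = (\<Sum>w\<in>A - {w0}. ?L w * ?T w)")
proof -
  let ?K = "\<lambda>w. comp_sgn (fst w) * res_coeff (fay_point w0) (same_comp A (fst w)) w"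
  let ?\<kappa> = "comp_sgn (fst w0)"
  define S0 where "S0 = same_comp A (fst w0)"
  define S1 where "S1 = A - S0"
  \<comment> \<open>The quotient of the Fay coefficient at \<open>w0\<close> by the left-hand
    coefficient. For odd \<open>card S0\<close> it is 2/\<i>, since the phase is \<i> and the
    component sign cancels against the mixed pairs.\<close>
  define c where "c = (if even (card S0) then - 2 * ?\<kappa> else - 2 * scalar \<i>)"
  have S0: "finite S0" "w0 \<in> S0" "\<And>v. v \<in> S0 \<Longrightarrow> fst v = fst w0" "S0 \<subseteq> A"
    using fin w0 by (auto simp: S0_def same_comp_def)
  have S1: "finite S1" "\<And>v. v \<in> S1 \<Longrightarrow> fst v \<noteq> fst w0"
    using fin by (auto simp: S1_def S0_def same_comp_def)
  have A: "A = S0 \<union> S1" "S0 \<inter> S1 = {}" using S0(4) by (auto simp: S1_def)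
  have "card A = card S0 + card S1" unfolding A(1) by (rule card_Un_disjoint[OF S0(1) S1(1) A(2)])
  then have par: "even (card S1) \<longleftrightarrow> even (card S0)" using ev by simp
  have m0: "card S0 > 0" using S0(1,2) by (auto simp: card_gt_0_iff)
  have phA: "phase A = (if even (card S0) then 1 else scalar \<i>)"
    using phase_eq[OF fin _ ev, of w0 0 "card S0"] by (simp add: S0_def)
  have K0: "?K w0 = c * ?lhs"
  proof -
    have "A - {w0} = (S0 - {w0}) \<union> S1" using A S0 by blast
    then have "(\<Prod>v\<in>A - {w0}. pair_ratio w0 v) = (\<Prod>v\<in>S0 - {w0}. pair_ratio w0 v) * (\<Prod>v\<in>S1. pair_ratio w0 v)"
      using A(2) S0(1) S1(1) by (simp only:) (rule prod.union_disjoint; blast intro: finite_Diff)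
    also have "(\<Prod>v\<in>S1. pair_ratio w0 v) = ?\<kappa> ^ card S1"
      using S1(2) by (rule prod_pair_ratio_cross)
    finally have P: "(\<Prod>v\<in>A - {w0}. pair_ratio w0 v) = (\<Prod>v\<in>S0 - {w0}. pair_ratio w0 v) * ?\<kappa> ^ card S1" .
    have "(-1 :: zvar mfps fract) ^ (card S0 - 1) = (if even (card S0) then -1 else 1)"
      using m0 by (simp add: minus_one_power_iff)
    moreover have "res_coeff (fay_point w0) S0 w0 = 2 * (-1) ^ (card S0 - 1) * (\<Prod>v\<in>S0 - {w0}. pair_ratio w0 v)"
      using S0(1,2,3) by (rule res_coeff_first)
    ultimately have K: "?K w0 = (if even (card S0) then - 2 * ?\<kappa> else 2 * ?\<kappa>) * (\<Prod>v\<in>S0 - {w0}. pair_ratio w0 v)"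
      by (simp add: S0_def[symmetric])
    show ?thesis
    proof (cases "even (card S0)")
      case True
      then show ?thesis unfolding K P phA c_def by (simp add: comp_sgn_power par)
    next
      case False
      have "2 * k * P = - 2 * j * (j * (P * k))" if "j * j = - 1" for j k P :: "zvar mfps fract"
      proof -
        have "- 2 * j * (j * (P * k)) = - 2 * (j * j) * k * P" by (simp only: mult_ac)
        then show ?thesis by (simp only: that mult_minus_left mult_minus_right minus_minus mult_1_right)
      qed
      from this[OF scalar_ii] show ?thesis using False
        unfolding K P phA c_def by (simp only: comp_sgn_power par if_False)
    qed
  qed
  have Kw: "?K w = - c * ?L w" if w: "w \<in> A - {w0}" for w
  proof (cases "fst w = fst w0")
    case True
    then have wS: "w \<in> S0" "w \<noteq> w0" using w by (auto simp: S0_def same_comp_def)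
    have card: "card S0 = card (S0 - {w0, w}) + 2"
      using card_Diff_subset[of "{w0, w}" S0] card_mono[of S0 "{w0, w}"] S0(1,2) wS by simp
    have cardA: "card A = card (A - {w0, w}) + 2"
      using card_Diff_subset[of "{w0, w}" A] card_mono[of A "{w0, w}"] fin w w0 by (simp add: card_insert_if split: if_splits)
    have "same_comp (A - {w0, w}) (fst w0) = S0 - {w0, w}" by (auto simp: S0_def same_comp_def)
    then have ph: "phase (A - {w0, w}) = (if even (card S0) then 1 else scalar \<i>)"
      using phase_eq[of "A - {w0, w}" w0 2 "card S0"] fin ev card cardA by simp
    have "same_comp {w0, w} (fst w0) = {w0, w}" using True by (auto simp: same_comp_def)
    then have ph2: "phase {w0, w} = 1"
      using phase_eq[of "{w0, w}" w0 0 2] wS by (simp add: card_insert_if)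
    have "A - {w0, w} = (S0 - {w0, w}) \<union> S1" using A S0 wS by blast
    then have "(\<Prod>v\<in>A - {w0, w}. pair_ratio w v) = (\<Prod>v\<in>S0 - {w0, w}. pair_ratio w v) * (\<Prod>v\<in>S1. pair_ratio w v)"
      using A(2) S0(1) S1(1) by (simp only:) (rule prod.union_disjoint; blast intro: finite_Diff)
    also have "(\<Prod>v\<in>S1. pair_ratio w v) = ?\<kappa> ^ card S1"
      using S1(2) unfolding True[symmetric] by (rule prod_pair_ratio_cross)
    finally have P: "inverse (\<Prod>v\<in>A - {w0, w}. pair_ratio w v) =
        inverse (\<Prod>v\<in>S0 - {w0, w}. pair_ratio w v) * ?\<kappa> ^ card S1"
      by (simp add: comp_sgn_power comp_sgn_inverse)
    define Q where "Q = inverse (\<Prod>v\<in>S0 - {w0, w}. pair_ratio w v)"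
    have "res_coeff (fay_point w0) S0 w = 2 * (-1) ^ card S0 * pair_ratio w0 w * Q"
      unfolding Q_def using S0(1,2) wS S0(3) by (rule res_coeff_same)
    then have K: "?K w = ?\<kappa> * (2 * (-1) ^ card S0 * pair_ratio w0 w * Q)"
      unfolding True S0_def[symmetric] by (simp only:)
    show ?thesis
    proof (cases "even (card S0)")
      case True
      then show ?thesis unfolding K P ph ph2 c_def Q_def[symmetric] by (simp add: comp_sgn_power par mult_ac)
    next
      case False
      have "k * (2 * - 1 * r * q) = - (- 2 * j) * (r * 1 * j * (q * k))" if "j * j = - 1"
        for j k q r :: "zvar mfps fract"
        unfolding that[symmetric] by (simp only: mult_minus_left mult_minus_right minus_minus mult_1_left mult_1_right mult_ac)
      from this[OF scalar_ii] show ?thesis using False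
        unfolding K P ph ph2 c_def Q_def[symmetric] by (simp only: comp_sgn_power minus_one_power_iff par if_False)
    qed
  next
    \<comment> \<open>The pair takes one point from each component, so the phase of the remaining
      points has the other parity. For even \<open>card S0\<close> the two phases multiply to -1,
      which cancels the sign left by the mixed pair ratios.\<close>
    case False
    then have wS: "w \<in> S1" "w \<noteq> w0" using w by (auto simp: S1_def S0_def same_comp_def)
    have same: "a = fst w" if "a \<noteq> fst w0" for a using that False by (cases a; cases "fst w"; cases "fst w0") auto
    have S1w: "same_comp A (fst w) = S1"
    proof -
      have "fst v = fst w \<longleftrightarrow> fst v \<noteq> fst w0" for v :: zvar using False same by metis
      then show ?thesis unfolding S1_def S0_def same_comp_def by blast
    qed
    have m1: "card S1 > 0" using S1(1) wS by (auto simp: card_gt_0_iff)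
    have cardA: "card A = card (A - {w0, w}) + 2"
      using card_Diff_subset[of "{w0, w}" A] card_mono[of A "{w0, w}"] fin w w0 by (simp add: card_insert_if split: if_splits)
    have "same_comp (A - {w0, w}) (fst w0) = S0 - {w0}" using False by (auto simp: S0_def same_comp_def)
    then have ph: "phase (A - {w0, w}) = (if even (card S0) then scalar \<i> else 1)"
      using phase_eq[of "A - {w0, w}" w0 1 "card S0"] fin ev cardA m0 S0(1,2) by simp
    have "same_comp {w0, w} (fst w0) = {w0}" using False by (auto simp: same_comp_def)
    then have ph2: "phase {w0, w} = scalar \<i>"
      using phase_eq[of "{w0, w}" w0 0 1] wS by (simp add: card_insert_if)
    have "A - {w0, w} = (S1 - {w}) \<union> (S0 - {w0})" using A S0 S1 wS by blast
    then have "(\<Prod>v\<in>A - {w0, w}. pair_ratio w v) = (\<Prod>v\<in>S1 - {w}. pair_ratio w v) * (\<Prod>v\<in>S0 - {w0}. pair_ratio w v)"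
      using A(2) S0(1) S1(1) by (simp only:) (rule prod.union_disjoint; blast intro: finite_Diff)
    also have "(\<Prod>v\<in>S0 - {w0}. pair_ratio w v) = comp_sgn (fst w) ^ card (S0 - {w0})"
    proof (rule prod_pair_ratio_cross)
      fix v assume "v \<in> S0 - {w0}"
      then have "fst v = fst w0" using S0(3) by blast
      then show "fst v \<noteq> fst w" using False by simp
    qed
    also have "card (S0 - {w0}) = card S0 - 1" using S0(1,2) by simp
    finally have P: "inverse (\<Prod>v\<in>A - {w0, w}. pair_ratio w v) =
        inverse (\<Prod>v\<in>S1 - {w}. pair_ratio w v) * (if even (card S0) then - ?\<kappa> else 1)"
      using m0 comp_sgn_neq[OF False[symmetric]]
      by (simp add: comp_sgn_power comp_sgn_inverse)
    define Q where "Q = inverse (\<Prod>v\<in>S1 - {w}. pair_ratio w v)"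
    have "w0 \<notin> S1" using S0(2) A(2) by blast
    moreover have "fst v = fst w" if "v \<in> S1" for v using S1(2)[OF that] by (rule same)
    ultimately have res: "res_coeff (fay_point w0) S1 w = 2 * (-1) ^ (card S1 - 1) * Q"
      unfolding Q_def using S1(1) wS(1) by (intro res_coeff_other)
    have K: "?K w = (if even (card S0) then 2 * ?\<kappa> else - 2 * ?\<kappa>) * Q"
      unfolding S1w res using m1 comp_sgn_neq[OF False[symmetric]] by (simp add: minus_one_power_iff par)
    have \<rho>: "pair_ratio w0 w = ?\<kappa>" using False by (simp add: pair_ratio_def)
    show ?thesis
    proof (cases "even (card S0)")
      case True
      have "- (- 2 * k) * (k * j * j * (q * - k)) = - 2 * (j * j) * (k * k) * k * q" for k j q :: "zvar mfps fract"
        by (simp only: mult_minus_left mult_minus_right minus_minus mult_ac)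
      from this[of ?\<kappa> "scalar \<i>" Q] show ?thesis using True
        unfolding K P ph ph2 \<rho> c_def Q_def[symmetric] by (simp add: scalar_ii comp_sgn_mult_self)
    next
      case False
      have "- (- 2 * j) * (k * j * 1 * (q * 1)) = 2 * (j * j) * k * q" for k j q :: "zvar mfps fract"
        by (simp only: mult_minus_left mult_minus_right minus_minus mult_1_left mult_1_right mult_ac)
      from this[of "scalar \<i>" ?\<kappa> Q] show ?thesis using False
        unfolding K P ph ph2 \<rho> c_def Q_def[symmetric] by (simp add: scalar_ii)
    qed
  qed
  have "0 = (\<Sum>w\<in>A. ?K w * to_frac (miwa_set \<tau> (if w = w0 then A else A - {w0, w}) *
      miwa_set \<tau> (if w = w0 then {} else {w0, w})))"
    by (rule fay_identity[OF tau fin w0 ev, symmetric])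
  also have "\<dots> = ?K w0 * ?one + (\<Sum>w\<in>A - {w0}. ?K w * ?T w)"
    by (subst sum.remove[OF fin w0]) (intro arg_cong2[of _ _ _ _ "(+)"] sum.cong; simp)
  also have "(\<Sum>w\<in>A - {w0}. ?K w * ?T w) = (\<Sum>w\<in>A - {w0}. - c * (?L w * ?T w))"
    by (rule sum.cong[OF refl]) (simp only: Kw mult.assoc)
  also have "?K w0 * ?one + \<dots> = c * (?lhs * ?one - (\<Sum>w\<in>A - {w0}. ?L w * ?T w))"
    unfolding K0 by (simp only: sum_distrib_left[symmetric] right_diff_distrib mult.assoc) simp
  finally have "c * (?lhs * ?one - (\<Sum>w\<in>A - {w0}. ?L w * ?T w)) = 0" ..
  moreover have "c \<noteq> 0"
    using scalar_ii comp_sgn_mult_self[of "fst w0"] by (auto simp: c_def)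
  ultimately show ?thesis by simp
qed

section \<open>The normalised tau-function and its Pfaffian expansion\<close>

definition pf_entry :: "tvar mfps \<Rightarrow> zvar \<Rightarrow> zvar \<Rightarrow> zvar mfps fract" where
  "pf_entry \<tau> u v = phase {u, v} * pair_ratio u v * to_frac (miwa_set \<tau> {u, v}) / scalar (tau_0 \<tau>)"

text \<open>Alternating in the points: the pair ratios are skew, the other factors depend on the set
  of points only. For n = 1 it is \<open>pf_entry\<close>.\<close>

definition pf_value :: "tvar mfps \<Rightarrow> nat \<Rightarrow> (nat \<Rightarrow> zvar) \<Rightarrow> zvar mfps fract" where
  "pf_value \<tau> n W = phase (W ` {..<2 * n}) * (\<Prod>(i, j)\<in>pairs (2 * n). pair_ratio (W i) (W j)) *
     to_frac (miwa_set \<tau> (W ` {..<2 * n})) / scalar (tau_0 \<tau>)"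

lemma scalar_neq_0: "c \<noteq> 0 \<Longrightarrow> scalar c \<noteq> 0"
proof
  assume "c \<noteq> 0" "scalar c = 0"
  then have "mfps_nth (mfps_const c :: zvar mfps) 0 = mfps_nth 0 0" by (simp add: scalar_def)
  then show False using \<open>c \<noteq> 0\<close> by (simp add: mfps_nth_const)
qed

lemma pf_entry_skew: "pf_entry \<tau> v u = - pf_entry \<tau> u v"
  unfolding pf_entry_def insert_commute[of v u] pair_ratio_skew[of v u] by simp

lemma miwa_set_empty: "miwa_set \<tau> {} = mfps_const (tau_0 \<tau>)"
proof (rule mfps_eqI)
  fix \<gamma>
  have p: "miwa_point {} = (\<lambda>_. 0)" by (auto simp: miwa_point_def)
  have prod_0: "(\<Prod>v\<in>Poly_Mapping.keys \<alpha>. (0 :: zvar mfps) ^ Poly_Mapping.lookup \<alpha> v) = 0" if nz: "\<alpha> \<noteq> 0" for \<alpha> :: "tvar \<Rightarrow>\<^sub>0 nat"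
  proof -
    have "Poly_Mapping.keys \<alpha> \<noteq> {}" using nz by simp
    then obtain v where "v \<in> Poly_Mapping.keys \<alpha>" by blast
    then show ?thesis by (intro prod_zero bexI[of _ v]) (auto simp: in_keys_iff)
  qed
  have "mfps_nth (miwa_set \<tau> {}) \<gamma> = (\<Sum>\<alpha>\<in>{0}. mfps_nth (mfps_const (mfps_nth \<tau> \<alpha>) *
      (\<Prod>v\<in>Poly_Mapping.keys \<alpha>. 0 ^ Poly_Mapping.lookup \<alpha> v)) \<gamma>)"
    unfolding miwa_set_def mfps_subst_def p
    by (intro mfps_nth_mfps_sum)
      (simp, simp only: prod_0 insert_iff empty_iff simp_thms mult_zero_right mfps_nth_0)
  then show "mfps_nth (miwa_set \<tau> {}) \<gamma> = mfps_nth (mfps_const (tau_0 \<tau>)) \<gamma>"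
    by (simp add: tau_0_def)
qed

lemma prod_pairs_Suc:
  fixes g :: "nat \<Rightarrow> nat \<Rightarrow> 'r :: comm_monoid_mult"
  shows "(\<Prod>(i, j)\<in>pairs (Suc m). g i j) = (\<Prod>i<m. g 0 (Suc i)) * (\<Prod>(i, j)\<in>pairs m. g (Suc i) (Suc j))"
proof -
  have "pairs (Suc m) = (\<lambda>i. (0, Suc i)) ` {..<m} \<union> map_prod Suc Suc ` pairs m"
  proof (intro equalityI subsetI)
    fix p assume "p \<in> pairs (Suc m)"
    then obtain i j where p: "p = (i, Suc j)" "i < Suc j" "j < m" by (cases p; cases "snd p") auto
    then show "p \<in> (\<lambda>i. (0, Suc i)) ` {..<m} \<union> map_prod Suc Suc ` pairs m"
      by (cases i) (auto simp: image_iff)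
  qed auto
  moreover have "(\<lambda>i. (0, Suc i)) ` {..<m} \<inter> map_prod Suc Suc ` pairs m = {}" by auto
  ultimately have "(\<Prod>(i, j)\<in>pairs (Suc m). g i j) =
      (\<Prod>(i, j)\<in>(\<lambda>i. (0, Suc i)) ` {..<m}. g i j) * (\<Prod>(i, j)\<in>map_prod Suc Suc ` pairs m. g i j)"
    by (simp add: prod.union_disjoint)
  also have "(\<Prod>(i, j)\<in>(\<lambda>i. (0, Suc i)) ` {..<m}. g i j) = (\<Prod>i<m. g 0 (Suc i))"
    by (subst prod.reindex) (auto simp: inj_on_def)
  also have "(\<Prod>(i, j)\<in>map_prod Suc Suc ` pairs m. g i j) = (\<Prod>(i, j)\<in>pairs m. g (Suc i) (Suc j))"
    by (subst prod.reindex) (auto simp: inj_on_def case_prod_unfold)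
  finally show ?thesis .
qed

text \<open>With W 0 and W j moved to the front, at the cost of the sign of the transposition, the
  product over all pairs splits into the pairs of W 0, the pairs of W j with the rest, and the pairs
  within the rest. The first part is the same for every j; the second cancels the inverse product in
  the Fay identity.\<close>

lemma pf_value_expand:
  assumes tau: "tau_function_2BKP \<tau>" and nz: "tau_0 \<tau> \<noteq> 0" and inj: "inj_on W {..<2 * Suc n}"
  shows "pf_value \<tau> (Suc n) W = (\<Sum>j\<in>{1..<2 * Suc n}. of_int (sign (transpose 1 j)) * pf_entry \<tau> (W 0) (W j) *
    pf_value \<tau> n (\<lambda>i. W (transpose 1 j (i + 2))))"
proof -
  let ?M = "2 * Suc n"
  define A where "A = W ` {..<?M}"
  let ?w0 = "W 0"
  let ?tau0 = "scalar (tau_0 \<tau>)"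
  let ?P = "\<Prod>(i, j)\<in>pairs ?M. pair_ratio (W i) (W j)"
  let ?Q = "\<Prod>v\<in>A - {?w0}. pair_ratio ?w0 v"
  let ?F = "\<lambda>w. pair_ratio ?w0 w * phase {?w0, w} * phase (A - {?w0, w}) *
      inverse (\<Prod>v\<in>A - {?w0, w}. pair_ratio w v) * to_frac (miwa_set \<tau> (A - {?w0, w}) * miwa_set \<tau> {?w0, w})"
  have fin: "finite A" by (simp add: A_def)
  have cardA: "card A = ?M" unfolding A_def using inj by (simp add: card_image)
  have w0: "?w0 \<in> A" by (simp add: A_def)
  have t0: "?tau0 \<noteq> 0" using nz by (rule scalar_neq_0)
  have Q: "?Q \<noteq> 0" using fin by (auto simp: pair_ratio_neq_0)
  \<comment> \<open>The prefactor of \<open>?F (W j)\<close> is free of j, so the Fay identity can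
    be applied to the whole sum.\<close>
  have summand: "of_int (sign (transpose 1 j)) * pf_entry \<tau> ?w0 (W j) * pf_value \<tau> n (\<lambda>i. W (transpose 1 j (i + 2))) =
      ?P / (?Q * ?tau0 * ?tau0) * ?F (W j)" if j: "j \<in> {1..<?M}" for j
  proof -
    let ?swap = "transpose 1 j"
    define W' where "W' i = W (?swap i)" for i
    let ?V = "A - {?w0, W j}" and ?sg = "of_int (sign ?swap) :: zvar mfps fract"
    let ?P2 = "\<Prod>(i, k)\<in>pairs (2 * n). pair_ratio (W' (i + 2)) (W' (k + 2))"
    let ?G = "\<lambda>w. \<Prod>v\<in>?V. pair_ratio w v"
    have t: "?swap permutes {..<?M}" using j by (intro permutes_swap_id) auto
    have W'_eq: "W' = W \<circ> ?swap" by (simp add: fun_eq_iff W'_def)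
    have inj': "inj_on W' {..<?M}"
      unfolding W'_eq by (rule comp_inj_on[OF permutes_inj_on[OF t]]) (simp only: permutes_image[OF t] inj)
    have img: "W' ` {..<?M} = A"
      unfolding A_def W'_eq by (simp only: image_comp[symmetric] permutes_image[OF t])
    have W': "W' 0 = ?w0" "W' 1 = W j" using j by (auto simp: W'_def transpose_def)
    have split: "{..<?M} = insert 0 (insert 1 ((\<lambda>i. i + 2) ` {..<2 * n}))"
    proof (intro equalityI subsetI)
      fix x assume "x \<in> {..<?M}"
      then show "x \<in> insert 0 (insert 1 ((\<lambda>i. i + 2) ` {..<2 * n}))"
        by (cases x; cases "x - 1") (auto simp: image_iff)
    qed auto
    have injV: "inj_on (\<lambda>i. W' (i + 2)) {..<2 * n}"
      using inj' by (auto simp: inj_on_def)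
    have V: "(\<lambda>i. W' (i + 2)) ` {..<2 * n} = ?V"
    proof -
      have "(\<lambda>i. W' (i + 2)) ` {..<2 * n} = W' ` ((\<lambda>i. i + 2) ` {..<2 * n})" by (simp add: image_image)
      also have "(\<lambda>i. i + 2) ` {..<2 * n} = {..<?M} - {0, 1}" unfolding split by auto
      also have "W' ` ({..<?M} - {0, 1}) = W' ` {..<?M} - W' ` {0, 1}"
        by (rule inj_on_image_set_diff[OF inj']) auto
      finally show ?thesis by (simp only: img image_insert image_empty W')
    qed
    have reidx: "(\<Prod>i<2 * n. h (W' (i + 2))) = (\<Prod>v\<in>?V. h v)" for h :: "zvar \<Rightarrow> zvar mfps fract"
      unfolding V[symmetric] by (rule prod.reindex_cong[OF injV refl refl, symmetric])
    have "?sg * ?P = (\<Prod>(i, k)\<in>pairs ?M. pair_ratio (W' i) (W' k))"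
      unfolding W'_def by (rule prod_pairs_permutes[OF t, symmetric]) (rule pair_ratio_skew)
    also have "\<dots> = pair_ratio ?w0 (W j) * (\<Prod>i<2 * n. pair_ratio ?w0 (W' (i + 2))) *
        ((\<Prod>i<2 * n. pair_ratio (W j) (W' (i + 2))) * ?P2)"
    proof -
      have M: "?M = Suc (Suc (2 * n))" by simp
      show ?thesis unfolding M prod_pairs_Suc prod.lessThan_Suc_shift
        by (simp only: W' W'[unfolded One_nat_def] add_2_eq_Suc' mult.assoc)
    qed
    also have "\<dots> = pair_ratio ?w0 (W j) * ?G ?w0 * (?G (W j) * ?P2)"
      unfolding reidx[of "pair_ratio ?w0"] reidx[of "pair_ratio (W j)"] ..
    also have "pair_ratio ?w0 (W j) * ?G ?w0 = ?Q"
    proof -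
      have "W j \<in> A - {?w0}" using j inj by (auto simp: A_def inj_on_def)
      moreover have "A - {?w0} - {W j} = ?V" by auto
      ultimately show ?thesis using prod.remove[of "A - {?w0}" "W j" "pair_ratio ?w0"] fin by simp
    qed
    finally have P: "?sg * ?P = ?Q * (?G (W j) * ?P2)" .
    have G: "?G (W j) \<noteq> 0" using fin by (auto simp: pair_ratio_neq_0)
    have "?sg * ?sg = 1" by (simp add: of_int_mult[symmetric] del: of_int_mult)
    then have "?P = ?sg * (?sg * ?P)" by (simp add: mult.assoc[symmetric])
    then have "?P / ?Q * inverse (?G (W j)) = ?sg * ?P2"
      unfolding P using Q G by (simp add: field_simps)
    then have "?P / (?Q * ?tau0 * ?tau0) * ?F (W j) = pair_ratio ?w0 (W j) * phase {?w0, W j} * phase ?V *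
        (?sg * ?P2) * (to_frac (miwa_set \<tau> ?V) * to_frac (miwa_set \<tau> {?w0, W j})) / (?tau0 * ?tau0)"
      unfolding to_frac.hom_mult by (simp add: divide_inverse mult_ac)
    also have "\<dots> = ?sg * pf_entry \<tau> ?w0 (W j) * pf_value \<tau> n (\<lambda>i. W' (i + 2))"
      unfolding pf_entry_def pf_value_def V by (simp add: divide_inverse mult_ac)
    finally show ?thesis by (simp only: W'_def)
  qed
  have "bij_betw W {1..<?M} (A - {?w0})"
  proof -
    have "{1..<?M} = {..<?M} - {0}" by auto
    then have "W ` {1..<?M} = W ` {..<?M} - W ` {0}"
      using inj_on_image_set_diff[OF inj, of "{..<?M}" "{0}"] by simp
    moreover have "inj_on W {1..<?M}" by (rule inj_on_subset[OF inj]) auto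
    ultimately show ?thesis by (simp add: bij_betw_def A_def)
  qed
  then have "(\<Sum>j\<in>{1..<?M}. ?F (W j)) = (\<Sum>w\<in>A - {?w0}. ?F w)" by (rule sum.reindex_bij_betw)
  also have "\<dots> = phase A * ?Q * to_frac (miwa_set \<tau> A * miwa_set \<tau> {})"
    by (rule pfaffian_fay[OF tau fin w0, symmetric]) (simp add: cardA)
  also have "to_frac (miwa_set \<tau> A * miwa_set \<tau> {}) = to_frac (miwa_set \<tau> A) * ?tau0"
    by (simp only: to_frac.hom_mult miwa_set_empty scalar_def)
  finally have F: "(\<Sum>j\<in>{1..<?M}. ?F (W j)) = phase A * ?Q * (to_frac (miwa_set \<tau> A) * ?tau0)" .
  have "(\<Sum>j\<in>{1..<?M}. of_int (sign (transpose 1 j)) * pf_entry \<tau> ?w0 (W j) *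
      pf_value \<tau> n (\<lambda>i. W (transpose 1 j (i + 2)))) = (\<Sum>j\<in>{1..<?M}. ?P / (?Q * ?tau0 * ?tau0) * ?F (W j))"
    by (rule sum.cong[OF refl]) (rule summand)
  also have "\<dots> = ?P / (?Q * ?tau0 * ?tau0) * (phase A * ?Q * (to_frac (miwa_set \<tau> A) * ?tau0))"
    unfolding sum_distrib_left[symmetric] F ..
  also have "\<dots> = pf_value \<tau> (Suc n) W"
    unfolding pf_value_def A_def[symmetric] using Q t0 by (simp add: field_simps)
  finally show ?thesis ..
qed

lemma pf_value_permutes:
  assumes "p permutes {..<2 * n}"
  shows "pf_value \<tau> n (W \<circ> p) = of_int (sign p) * pf_value \<tau> n W"
proof -
  have "(W \<circ> p) ` {..<2 * n} = W ` {..<2 * n}"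
    by (simp only: image_comp[symmetric] permutes_image[OF assms])
  moreover have "(\<Prod>(i, j)\<in>pairs (2 * n). pair_ratio ((W \<circ> p) i) ((W \<circ> p) j)) =
      of_int (sign p) * (\<Prod>(i, j)\<in>pairs (2 * n). pair_ratio (W i) (W j))"
    unfolding o_def by (rule prod_pairs_permutes[OF assms]) (rule pair_ratio_skew)
  ultimately show ?thesis unfolding pf_value_def by (simp only: mult_ac times_divide_eq_right)
qed

lemma pf_value_pfaffian:
  assumes "tau_function_2BKP \<tau>" "tau_0 \<tau> \<noteq> 0" "inj_on W {..<2 * n}"
  shows "2 ^ n * fact n * pf_value \<tau> n W = (\<Sum>p | p permutes {..<2 * n}. pf_term (pf_entry \<tau>) W n p)"
proof (rule pfaffian_of_expansion)
  have "scalar (tau_0 \<tau>) \<noteq> 0" using assms(2) by (rule scalar_neq_0)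
  then show "pf_value \<tau> 0 W = 1" for W
    by (simp add: pf_value_def phase_def same_comp_def miwa_set_empty scalar_def)
  show "inj_on W {..<2 * n}" by fact
qed (use pf_value_permutes pf_value_expand[OF assms(1,2)] in blast)+

section \<open>The matrix of two-point functions\<close>

lemma miwa_eq_miwa_set:
  assumes "distinct us" "distinct vs" "fst ` set us \<subseteq> {Comp1}" "fst ` set vs \<subseteq> {Comp2}"
  shows "miwa \<tau> us vs = miwa_set \<tau> (set us \<union> set vs)"
proof -
  have "(\<Sum>u\<leftarrow>(case a of Comp1 \<Rightarrow> us | Comp2 \<Rightarrow> vs). mfps_var u ^ (2 * k + 1)) =
      (\<Sum>u | u \<in> set us \<union> set vs \<and> fst u = a. mfps_var u ^ (2 * k + 1))" for a and k :: nat
  proof (cases a)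
    case Comp1
    have "{u. u \<in> set us \<union> set vs \<and> fst u = Comp1} = set us" using assms(3,4) by auto
    then show ?thesis using assms(1) Comp1 by (simp add: sum_list_distinct_conv_sum_set)
  next
    case Comp2
    have "{u. u \<in> set us \<union> set vs \<and> fst u = Comp2} = set vs" using assms(3,4) by auto
    then show ?thesis using assms(2) Comp2 by (simp add: sum_list_distinct_conv_sum_set)
  qed
  then show ?thesis
    unfolding miwa_def miwa_set_def miwa_point_def
    by (intro arg_cong2[of _ _ _ _ mfps_subst] ext refl) (auto split: prod.splits)
qed

text \<open>The first component comes first, so that each mixed pair contributes
  \<open>comp_sgn Comp1 = 1\<close> to the product of pair ratios.\<close>

definition zvars :: "nat \<Rightarrow> nat \<Rightarrow> zvar" where
  "zvars N1 i = (if i < N1 then (Comp1, i) else (Comp2, i - N1))"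

lemma inj_zvars: "inj_on (zvars N1) S"
  by (auto simp: inj_on_def zvars_def split: if_splits)

lemma zvars_image:
  "zvars N1 ` {..<N1 + N2} = Pair Comp1 ` {..<N1} \<union> Pair Comp2 ` {..<N2}"
proof (intro equalityI subsetI)
  fix u assume "u \<in> Pair Comp1 ` {..<N1} \<union> Pair Comp2 ` {..<N2}"
  then show "u \<in> zvars N1 ` {..<N1 + N2}"
  proof (elim UnE imageE)
    fix i assume "u = (Comp1, i)" "i \<in> {..<N1}"
    then show ?thesis by (intro image_eqI[of _ _ i]) (simp_all add: zvars_def)
  next
    fix i assume "u = (Comp2, i)" "i \<in> {..<N2}"
    then show ?thesis by (intro image_eqI[of _ _ "i + N1"]) (simp_all add: zvars_def)
  qed
qed (auto simp: zvars_def)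

lemma tau_Z_eq: "tau_Z \<tau> N1 N2 = miwa_set \<tau> (zvars N1 ` {..<N1 + N2})"
  unfolding tau_Z_def zvars_image
  by (subst miwa_eq_miwa_set) (auto simp: distinct_map inj_on_def atLeast0LessThan)

text \<open>A square is 0 or 1 modulo 4 according to its parity, so \<i>^(N1^2) depends on the
  parity of \<open>N1\<close> just as \<open>phase\<close> does.\<close>

lemma phase_zvars: "phase (zvars N1 ` {..<N1 + N2}) = scalar \<i> ^ N1\<^sup>2"
proof -
  have "same_comp (zvars N1 ` {..<N1 + N2}) Comp1 = Pair Comp1 ` {..<N1}"
    unfolding zvars_image by (auto simp: same_comp_def)
  then have card: "card (same_comp (zvars N1 ` {..<N1 + N2}) Comp1) = N1"
    by (simp add: card_image inj_on_def)
  have i4: "scalar \<i> ^ (4 * k) = 1" for k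
    unfolding power_mult by (simp add: numeral_eq_Suc scalar_ii mult.assoc[symmetric])
  show ?thesis
  proof (cases "even N1")
    case True
    then obtain k where "N1 = 2 * k" by (elim evenE)
    then have "N1\<^sup>2 = 4 * k\<^sup>2" by (simp add: power2_eq_square)
    then show ?thesis using True by (simp add: phase_def card i4)
  next
    case False
    then obtain k where "N1 = 2 * k + 1" by (elim oddE)
    then have "N1\<^sup>2 = Suc (4 * (k\<^sup>2 + k))" by (simp add: power2_eq_square algebra_simps)
    then show ?thesis using False by (simp only: phase_def card power_Suc i4 if_False mult_1_right)
  qed
qed

lemma z_of_ratio: "(z_of u - z_of v) / (z_of u + z_of v) = (zinv v - zinv u) / (zinv u + zinv v)"
proof -
  let ?a = "zinv u" and ?b = "zinv v"
  have ab: "?a \<noteq> 0" "?b \<noteq> 0" by (rule zinv_neq_0)+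
  have "inverse ?a - inverse ?b = (?b - ?a) * inverse (?a * ?b)"
    "inverse ?a + inverse ?b = (?a + ?b) * inverse (?a * ?b)"
    using ab by (simp_all add: field_simps)
  then show ?thesis using ab unfolding z_of_def zinv_def by simp
qed

lemma prod_pair_ratio_zvars:
  "(\<Prod>(i, j)\<in>pairs (N1 + N2). pair_ratio (zvars N1 i) (zvars N1 j)) =
    z_ratio_prod Comp1 N1 * z_ratio_prod Comp2 N2"
proof -
  let ?g = "\<lambda>(i, j). pair_ratio (zvars N1 i) (zvars N1 j)"
  let ?s = "map_prod (\<lambda>i. i + N1) (\<lambda>i. i + N1)"
  have sub: "pairs N1 \<union> ?s ` pairs N2 \<subseteq> pairs (N1 + N2)" by auto
  have "prod ?g (pairs (N1 + N2)) = prod ?g (pairs N1 \<union> ?s ` pairs N2)"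
  proof (rule prod.mono_neutral_right[OF finite_pairs sub], rule ballI)
    fix p assume p: "p \<in> pairs (N1 + N2) - (pairs N1 \<union> ?s ` pairs N2)"
    obtain i j where ij: "p = (i, j)" by (cases p)
    have "i < N1"
    proof (rule ccontr)
      assume "\<not> i < N1"
      then have "p = ?s (i - N1, j - N1)" "(i - N1, j - N1) \<in> pairs N2" using p ij by auto
      then show False using p by blast
    qed
    moreover have "\<not> j < N1" using p ij by auto
    ultimately show "?g p = 1" by (simp add: ij pair_ratio_def zvars_def comp_sgn_def)
  qed
  also have "\<dots> = prod ?g (pairs N1) * prod ?g (?s ` pairs N2)"
    by (rule prod.union_disjoint) auto
  also have "prod ?g (pairs N1) = z_ratio_prod Comp1 N1"
    unfolding z_ratio_prod_def
    by (rule prod.cong[OF refl]) (auto simp: z_of_ratio pair_ratio_def zvars_def)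
  also have "prod ?g (?s ` pairs N2) = prod (?g \<circ> ?s) (pairs N2)"
    by (rule prod.reindex) (auto simp: inj_on_def)
  also have "\<dots> = z_ratio_prod Comp2 N2"
    unfolding z_ratio_prod_def
    by (rule prod.cong[OF refl]) (auto simp: z_of_ratio pair_ratio_def zvars_def)
  finally show ?thesis .
qed

lemma phase_pair:
  "phase {(Comp1, i), (Comp1, j)} = (if i = j then scalar \<i> else 1)"
  "phase {(Comp2, i), (Comp2, j)} = 1" "phase {(Comp1, i), (Comp2, j)} = scalar \<i>"
proof -
  have "same_comp {(Comp1, i), (Comp1, j)} Comp1 = {(Comp1, i), (Comp1, j)}"
    "same_comp {(Comp2, i), (Comp2, j)} Comp1 = {}" "same_comp {(Comp1, i), (Comp2, j)} Comp1 = {(Comp1, i)}"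
    by (auto simp: same_comp_def)
  then show "phase {(Comp1, i), (Comp1, j)} = (if i = j then scalar \<i> else 1)"
    "phase {(Comp2, i), (Comp2, j)} = 1" "phase {(Comp1, i), (Comp2, j)} = scalar \<i>"
    by (simp_all add: phase_def card_insert_if)
qed

text \<open>The points must differ: for equal points the list in \<open>phi11\<close> or
  \<open>phi22\<close> counts the point twice, the set in \<open>pf_entry\<close> once. The factor
  \<i> of the mixed block is the phase of a mixed pair.\<close>

lemma phi_eq:
  "i \<noteq> j \<Longrightarrow> phi11 \<tau> (Comp1, i) (Comp1, j) = 1 / 2 * pf_entry \<tau> (Comp1, i) (Comp1, j)"
  "i \<noteq> j \<Longrightarrow> phi22 \<tau> (Comp2, i) (Comp2, j) = 1 / 2 * pf_entry \<tau> (Comp2, i) (Comp2, j)"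
  "scalar \<i> * phi12 \<tau> (Comp1, i) (Comp2, j) = 1 / 2 * pf_entry \<tau> (Comp1, i) (Comp2, j)"
proof -
  show "phi11 \<tau> (Comp1, i) (Comp1, j) = 1 / 2 * pf_entry \<tau> (Comp1, i) (Comp1, j)" if "i \<noteq> j"
    unfolding phi11_def pf_entry_def z_of_ratio using that
    by (subst miwa_eq_miwa_set) (simp_all add: phase_pair pair_ratio_def)
  show "phi22 \<tau> (Comp2, i) (Comp2, j) = 1 / 2 * pf_entry \<tau> (Comp2, i) (Comp2, j)" if "i \<noteq> j"
    unfolding phi22_def pf_entry_def z_of_ratio using that
    by (subst miwa_eq_miwa_set) (simp_all add: phase_pair pair_ratio_def)
  show "scalar \<i> * phi12 \<tau> (Comp1, i) (Comp2, j) = 1 / 2 * pf_entry \<tau> (Comp1, i) (Comp2, j)"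
    unfolding phi12_def pf_entry_def
    by (subst miwa_eq_miwa_set) (simp_all add: phase_pair pair_ratio_def comp_sgn_def insert_commute)
qed

lemma skew_mat_index:
  assumes "i < n" "j < n" "\<And>i j. i \<noteq> j \<Longrightarrow> f i j = 1 / 2 * pf_entry \<tau> (a, i) (a, j)"
  shows "skew_mat n f $$ (i, j) = 1 / 2 * pf_entry \<tau> (a, i) (a, j)"
proof -
  have "pf_entry \<tau> (a, i) (a, i) = 0" by (simp add: pf_entry_def pair_ratio_def)
  then show ?thesis
    using assms(1,2) assms(3)[of i j] assms(3)[of j i] pf_entry_skew[of \<tau> "(a, j)" "(a, i)"]
    by (cases i j rule: linorder_cases) (simp_all add: skew_mat_def)
qed

lemma Phi_mat_index:
  assumes ij: "i < N1 + N2" "j < N1 + N2"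
  shows "Phi_mat \<tau> N1 N2 $$ (i, j) = 1 / 2 * pf_entry \<tau> (zvars N1 i) (zvars N1 j)"
proof -
  let ?P11 = "skew_mat N1 (\<lambda>i j. phi11 \<tau> (Comp1, i) (Comp1, j))"
  let ?P22 = "skew_mat N2 (\<lambda>i j. phi22 \<tau> (Comp2, i) (Comp2, j))"
  let ?P12 = "mat N1 N2 (\<lambda>(i, j). scalar \<i> * phi12 \<tau> (Comp1, i) (Comp2, j))"
  have dims: "dim_row ?P11 = N1" "dim_col ?P11 = N1" "dim_row ?P22 = N2" "dim_col ?P22 = N2"
    by (simp_all add: skew_mat_def)
  have P: "Phi_mat \<tau> N1 N2 $$ (i, j) = (if i < N1 then if j < N1 then ?P11 $$ (i, j) else ?P12 $$ (i, j - N1)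
      else if j < N1 then (- transpose_mat ?P12) $$ (i - N1, j) else ?P22 $$ (i - N1, j - N1))"
    unfolding Phi_mat_def Let_def by (subst index_mat_four_block(1)) (use ij dims in auto)
  consider "i < N1" "j < N1" | "i < N1" "\<not> j < N1" | "\<not> i < N1" "j < N1" | "\<not> i < N1" "\<not> j < N1" by blast
  then show ?thesis
  proof cases
    case 1
    then show ?thesis unfolding P by (simp add: zvars_def skew_mat_index phi_eq)
  next
    case 2
    then show ?thesis unfolding P using ij by (simp add: zvars_def phi_eq)
  next
    case 3
    then show ?thesis unfolding P using ij pf_entry_skew[of \<tau> "(Comp2, i - N1)" "(Comp1, j)"]
      by (simp add: zvars_def phi_eq)
  next
    case 4
    then show ?thesis unfolding P using ij by (simp add: zvars_def skew_mat_index phi_eq)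
  qed
qed

text \<open>The power of 2 compensates the factor 1/2 in each of the \<open>n\<close> entries of a
  Pfaffian term.\<close>

lemma pfaffian_Phi_mat:
  assumes "tau_function_2BKP \<tau>" "tau_0 \<tau> \<noteq> 0" and n: "N1 + N2 = 2 * n"
  shows "2 ^ n * pfaffian (Phi_mat \<tau> N1 N2) = pf_value \<tau> n (zvars N1)"
proof -
  have dim: "dim_row (Phi_mat \<tau> N1 N2) div 2 = n"
    using n by (simp add: Phi_mat_def Let_def skew_mat_def)
  have "(\<Sum>p | p permutes {0..<2 * n}. of_int (sign p) *
      (\<Prod>i<n. Phi_mat \<tau> N1 N2 $$ (p (2 * i), p (2 * i + 1)))) =
      (\<Sum>p | p permutes {..<2 * n}. (1 / 2) ^ n * pf_term (pf_entry \<tau>) (zvars N1) n p)"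
    unfolding atLeast0LessThan
  proof (rule sum.cong[OF refl])
    fix p assume "p \<in> {p. p permutes {..<2 * n}}"
    then have p: "p permutes {..<2 * n}" by simp
    have "(\<Prod>i<n. Phi_mat \<tau> N1 N2 $$ (p (2 * i), p (2 * i + 1))) =
        (\<Prod>i<n. 1 / 2 * pf_entry \<tau> (zvars N1 (p (2 * i))) (zvars N1 (p (2 * i + 1))))"
    proof (rule prod.cong[OF refl])
      fix i assume "i \<in> {..<n}"
      then have "p (2 * i) < N1 + N2" "p (2 * i + 1) < N1 + N2"
        using permutes_in_image[OF p, of "2 * i"] permutes_in_image[OF p, of "2 * i + 1"] n by auto
      then show "Phi_mat \<tau> N1 N2 $$ (p (2 * i), p (2 * i + 1)) =
          1 / 2 * pf_entry \<tau> (zvars N1 (p (2 * i))) (zvars N1 (p (2 * i + 1)))"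
        by (rule Phi_mat_index)
    qed
    also have "\<dots> = (1 / 2) ^ n * (\<Prod>i<n. pf_entry \<tau> (zvars N1 (p (2 * i))) (zvars N1 (p (2 * i + 1))))"
      by (simp only: prod.distrib prod_constant card_lessThan)
    finally show "of_int (sign p) * (\<Prod>i<n. Phi_mat \<tau> N1 N2 $$ (p (2 * i), p (2 * i + 1))) =
        (1 / 2) ^ n * pf_term (pf_entry \<tau>) (zvars N1) n p"
      unfolding pf_term_def by (simp only: mult_ac)
  qed
  also have "\<dots> = (1 / 2) ^ n * (2 ^ n * fact n * pf_value \<tau> n (zvars N1))"
    unfolding sum_distrib_left[symmetric] pf_value_pfaffian[OF assms(1,2) inj_zvars] ..
  finally have pf: "pfaffian (Phi_mat \<tau> N1 N2) =
      (1 / 2) ^ n * (2 ^ n * fact n * pf_value \<tau> n (zvars N1)) / (2 ^ n * of_nat (fact n))"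
    unfolding pfaffian_def Let_def dim by (simp only:)
  show ?thesis unfolding pf of_nat_fact by (simp add: power_one_over)
qed

theorem proposition3p5:
  fixes \<tau> :: "tvar mfps" and N1 N2 :: nat
  assumes "tau_function_2BKP \<tau>"
    and "tau_0 \<tau> \<noteq> 0"
    and "even (N1 + N2)"
  shows "to_frac (tau_Z \<tau> N1 N2) =
    scalar (tau_0 \<tau>) *
      ((2 ^ ((N1 + N2) div 2) * pfaffian (Phi_mat \<tau> N1 N2)) /
       (scalar \<i> ^ (N1\<^sup>2) * (z_ratio_prod Comp1 N1 * z_ratio_prod Comp2 N2)))"
proof -
  obtain n where n: "N1 + N2 = 2 * n" using assms(3) by (elim evenE)
  let ?phase = "scalar \<i> ^ (N1\<^sup>2)" and ?ratio = "z_ratio_prod Comp1 N1 * z_ratio_prod Comp2 N2"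
  have "?phase \<noteq> 0" using scalar_ii by auto
  moreover have "?ratio \<noteq> 0"
    unfolding prod_pair_ratio_zvars[symmetric] using inj_zvars[of N1 UNIV]
    by (auto intro!: pair_ratio_neq_0 dest: injD)
  \<comment> \<open>For the points \<open>zvars N1\<close> the phase and the product of pair ratios
    are exactly the denominator of the claim.\<close>
  moreover have "2 ^ n * pfaffian (Phi_mat \<tau> N1 N2) = ?phase * ?ratio * to_frac (tau_Z \<tau> N1 N2) / scalar (tau_0 \<tau>)"
    unfolding pfaffian_Phi_mat[OF assms(1,2) n] pf_value_def n[symmetric] phase_zvars prod_pair_ratio_zvars tau_Z_eq ..
  moreover have "scalar (tau_0 \<tau>) \<noteq> 0" using assms(2) by (rule scalar_neq_0)
  moreover have "(N1 + N2) div 2 = n" using n by simp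
  ultimately show ?thesis by simp
qed

end
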